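(* Let $d\ge 3$. A set $Z\subseteq\mathbb{P}^2$ of $d^2-d+1$ (distinct) points is the eigenscheme of a tensor in $(\mathbb{C}^3)^{\otimes d}$ if and only if all of the following hold: (1) $\dim I_Z(d)=3$; (2) $Z$ contains no $d+1$ collinear points; (3) for every $k\in\{2,\dots,d-1\}$, no $kd$ points of $Z$ lie on a plane curve of degree $k$.
   Context: Everything is over $\mathbb{C}$. $I_Z\subseteq\mathbb{C}[x_0,x_1,x_2]$ is the homogeneous ideal of the reduced scheme $Z$ and $I_Z(d)$ is its degree $d$ graded piece. A tensor $T=(T_{i_1\dots i_d})\in(\mathbb{C}^3)^{\otimes d}$ determines forms $g_i=\sum_{i_2,\dots,i_d}T_{i\,i_2\dots i_d}x_{i_2}\cdots x_{i_d}$ ($i=0,1,2$) of degree $d-1$, and its eigenscheme $E(T)\subseteq\mathbb{P}^2$ is the closed subscheme defined by the $2\times2$ minors of $\begin{pmatrix}x_0&x_1&x_2\\ g_0&g_1&g_2\end{pmatrix}$. Every triple $(g_0,g_1,g_2)\in(\mathrm{Sym}^{d-1}\mathbb{C}^3)^{\oplus3}$ of forms of degree $d-1$ (a partially symmetric tensor) arises in this way, so one may equivalently consider only such triples. *)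

theory Defs
  imports "HOL-Analysis.Analysis" "HOL-Library.Poly_Mapping"
begin

section \<open>Ternary polynomials\<close>

text \<open>The polynomial ring \<open>\<complex>[x\<^sub>0, x\<^sub>1, x\<^sub>2]\<close>: finitely supported coefficient functions on exponent
  vectors, with the convolution product. The index type has exactly the elements 0, 1, 2.\<close>

type_synonym tpoly = "(3 \<Rightarrow>\<^sub>0 nat) \<Rightarrow>\<^sub>0 complex"

definition var :: "3 \<Rightarrow> tpoly" where
  "var i = Poly_Mapping.single (Poly_Mapping.single i 1) 1"

definition const :: "complex \<Rightarrow> tpoly" where
  "const c = Poly_Mapping.single 0 c"

definition smult_tpoly :: "complex \<Rightarrow> tpoly \<Rightarrow> tpoly" where
  "smult_tpoly c f = const c * f"

definition eval_tpoly :: "tpoly \<Rightarrow> complex ^ 3 \<Rightarrow> complex" where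
  "eval_tpoly f v = (\<Sum>m\<in>Poly_Mapping.keys f.
     Poly_Mapping.lookup f m * (\<Prod>i\<in>UNIV. v $ i ^ Poly_Mapping.lookup m i))"

definition is_form :: "nat \<Rightarrow> tpoly \<Rightarrow> bool" where
  "is_form n f \<longleftrightarrow> (\<forall>m\<in>Poly_Mapping.keys f. (\<Sum>i\<in>UNIV. Poly_Mapping.lookup m i) = n)"

text \<open>\<open>ideal.span B\<close> is the ideal generated by \<open>B\<close>, and \<open>tpoly.dim V\<close> is the dimension over \<open>\<complex>\<close>.\<close>

interpretation ideal: module "(*) :: tpoly \<Rightarrow> tpoly \<Rightarrow> tpoly"
  by standard (simp_all add: distrib_left distrib_right mult.assoc)

interpretation tpoly: vector_space smult_tpoly
proof
  fix a b :: complex and f g :: tpoly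
  show "smult_tpoly a (f + g) = smult_tpoly a f + smult_tpoly a g"
    by (simp add: smult_tpoly_def distrib_left)
  show "smult_tpoly (a + b) f = smult_tpoly a f + smult_tpoly b f"
    by (simp add: smult_tpoly_def const_def single_add distrib_right)
  have "const a * const b = const (a * b)"
    by (simp add: const_def mult_single)
  then show "smult_tpoly a (smult_tpoly b f) = smult_tpoly (a * b) f"
    by (simp add: smult_tpoly_def flip: mult.assoc)
  show "smult_tpoly 1 f = f"
    by (simp add: smult_tpoly_def const_def)
qed

section \<open>Closed subschemes of the projective plane\<close>

text \<open>Setting \<open>x\<^sub>i = 1\<close> identifies the degree-zero part of the localisation of \<open>\<complex>[x\<^sub>0, x\<^sub>1, x\<^sub>2]\<close> at
  \<open>x\<^sub>i\<close>, that is, the coordinate ring of the standard affine chart \<open>x\<^sub>i \<noteq> 0\<close>, with the ring of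
  polynomials in which \<open>x\<^sub>i\<close> does not occur.\<close>

definition dehomogenize :: "3 \<Rightarrow> tpoly \<Rightarrow> tpoly" where
  "dehomogenize i f =
     (\<Sum>m\<in>Poly_Mapping.keys f. Poly_Mapping.single (Poly_Mapping.update i 0 m)
       (Poly_Mapping.lookup f m))"

text \<open>A closed subscheme of the projective plane is the same as its ideal sheaf, which is given by
  its ideals on the three standard charts. So \<open>proj_scheme I\<close> is the closed subscheme defined by
  the homogeneous ideal \<open>I\<close>, and equality of its values is equality of closed subschemes.\<close>

definition proj_scheme :: "tpoly set \<Rightarrow> 3 \<Rightarrow> tpoly set" where
  "proj_scheme I = (\<lambda>i. dehomogenize i ` I)"

section \<open>Points of the projective plane\<close>

definition proj_plane :: "(complex ^ 3) set set" where
  "proj_plane = {vec.span {v} | v. v \<noteq> 0}"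

text \<open>Vanishing at a point is only used for forms, for which it does not depend on the
  representative.\<close>

definition vanishes_on :: "tpoly \<Rightarrow> (complex ^ 3) set set \<Rightarrow> bool" where
  "vanishes_on f Z \<longleftrightarrow> (\<forall>p\<in>Z. \<forall>v\<in>p. eval_tpoly f v = 0)"

definition vanishing_ideal :: "(complex ^ 3) set set \<Rightarrow> tpoly set" where
  "vanishing_ideal Z = ideal.span {f. (\<exists>n. is_form n f) \<and> vanishes_on f Z}"

definition graded_piece :: "tpoly set \<Rightarrow> nat \<Rightarrow> tpoly set" where
  "graded_piece I n = {f \<in> I. is_form n f}"

definition reduced_scheme :: "(complex ^ 3) set set \<Rightarrow> 3 \<Rightarrow> tpoly set" where
  "reduced_scheme Z = proj_scheme (vanishing_ideal Z)"

text \<open>Plane curves may be reducible or non-reduced.\<close>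

definition on_curve_of_degree :: "nat \<Rightarrow> (complex ^ 3) set set \<Rightarrow> bool" where
  "on_curve_of_degree k S \<longleftrightarrow> (\<exists>f. f \<noteq> 0 \<and> is_form k f \<and> vanishes_on f S)"

definition collinear_points :: "(complex ^ 3) set set \<Rightarrow> bool" where
  "collinear_points S \<longleftrightarrow> (\<exists>l. l \<noteq> 0 \<and> is_form 1 l \<and> vanishes_on l S)"

section \<open>Eigenschemes of tensors\<close>

text \<open>A tensor in \<open>(\<complex>\<^sup>3)\<^sup>\<otimes>\<^sup>d\<close> is the array of its coordinates, indexed by lists of length \<open>d\<close>; entries
  at other lists are set to 0.\<close>

definition tensors :: "nat \<Rightarrow> (3 list \<Rightarrow> complex) set" where
  "tensors d = {T. \<forall>is. length is \<noteq> d \<longrightarrow> T is = 0}"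

definition tensor_form :: "nat \<Rightarrow> (3 list \<Rightarrow> complex) \<Rightarrow> 3 \<Rightarrow> tpoly" where
  "tensor_form d T i =
     (\<Sum>js | length js = d - 1. smult_tpoly (T (i # js)) (prod_list (map var js)))"

definition eigen_ideal :: "nat \<Rightarrow> (3 list \<Rightarrow> complex) \<Rightarrow> tpoly set" where
  "eigen_ideal d T =
     ideal.span {var i * tensor_form d T j - var j * tensor_form d T i | i j. i < j}"

definition eigenscheme :: "nat \<Rightarrow> (3 list \<Rightarrow> complex) \<Rightarrow> 3 \<Rightarrow> tpoly set" where
  "eigenscheme d T = proj_scheme (eigen_ideal d T)"

end

theory Submission
  imports Defs
    "HOL-Computational_Algebra.Polynomial_Factorial"
    "HOL-Computational_Algebra.Field_as_Ring"
    "HOL-Computational_Algebra.Fundamental_Theorem_Algebra"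
begin

text \<open>Let \<open>M = x \<times> g\<close> be the minors. If their scheme is \<open>Z\<close>, they have no common factor, and by
  Hilbert-Burch the ideal \<open>(M\<^sub>1, M\<^sub>2, M\<^sub>3)\<close> is saturated, so its degree \<open>d\<close> part is spanned by the
  \<open>M\<^sub>i\<close>. Bezout's bound excludes \<open>d + 1\<close> points on a line. If \<open>k d\<close> points lie on a curve \<open>C\<close> of degree
  \<open>k\<close>, Max Noether's theorem writes \<open>M\<^sub>i = A\<^sub>i C + b\<^sub>i F\<close> for a generic combination \<open>F\<close> of the minors, and
  \<open>x \<cdot> M = 0\<close> forces \<open>b = 0\<close>.

  Conversely, conditions (2) and (3) exclude a common factor of the three forms through \<open>Z\<close>, so two
  generic combinations \<open>F, G\<close> of them form a complete intersection, linked to a residual scheme of degree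
  \<open>d - 1\<close>. With \<open>H\<close> the third form, the Hilbert function of \<open>(F, G, H) / (F, G)\<close> is at most \<open>d - 1\<close>, and by
  the socle degree \<open>2d - 2\<close> of a plane complete intersection it grows as \<open>1, 2, \<dots>, d - 1\<close>. So some linear
  multiple of \<open>H\<close> lies in \<open>(F, G)\<close> (the residual scheme lies on a line), which is a syzygy \<open>x \<cdot> M = 0\<close> among
  three forms \<open>M\<^sub>i\<close> of degree \<open>d\<close> through \<open>Z\<close>. Condition (3) makes the \<open>M\<^sub>i\<close> independent, and the Koszul
  complex gives \<open>M = x \<times> g\<close>.\<close>

text \<open>Everything rests on dimension counts in graded pieces and on one device: a line
  \<open>generic_line t\<close> that misses all the points in question. Modulo two coprime forms, or
  modulo the minors, such a line can be cancelled, because the forms stay coprime when restricted to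
  it and syzygies of the restrictions lift. Cancellation carries statements down from large degrees,
  where counting decides them, and takes the place of local algebra and cohomology. The constant
  \<open>d - 1\<close> is \<open>d * d - card Z\<close>, the degree left over when two curves of
  degree \<open>d\<close> through Z meet properly. The linear relation comes from a tight count: if
  no nonzero linear multiple of \<open>H\<close> lay in \<open>(F, G)\<close>, the Hilbert function
  would reach 3 instead of 2 in degree \<open>d + 1\<close>, and its strict growth would push it to
  \<open>d\<close> in degree \<open>2 * d - 2\<close>. Condition (3) enters the converse twice:
  against a common factor, where every degree below \<open>d\<close> can occur, and with
  \<open>k = d - 1\<close> against a constant relation among the three forms of the syzygy.\<close>

section \<open>Evaluation homomorphisms and the grading\<close>

text \<open>As a simp rule, this would reassociate all products to the left, against \<open>algebra_simps\<close>.\<close>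

declare ideal.scale_scale [simp del]

lemma tpoly_sum_single: "(\<Sum>m\<in>Poly_Mapping.keys f. Poly_Mapping.single m (Poly_Mapping.lookup f m)) = f"
  by (rule poly_mapping_eqI)
    (simp add: lookup_sum lookup_single when_def in_keys_iff)

lemma tpoly_induct [case_names single add]:
  fixes f :: tpoly
  assumes single: "\<And>m c. P (Poly_Mapping.single m c)"
    and add: "\<And>f g. P f \<Longrightarrow> P g \<Longrightarrow> P (f + g)"
  shows "P f"
proof -
  have "P (\<Sum>m\<in>A. Poly_Mapping.single m (Poly_Mapping.lookup f m))" if "finite A" for A
    using that
  proof induction
    case empty
    show ?case using single[of 0 0] by simp
  next
    case (insert m A)
    then show ?case using single add by simp
  qed
  from this[OF finite_keys, of f] show ?thesis
    by (simp add: tpoly_sum_single)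
qed

definition monomial :: "(3 \<Rightarrow> 'r :: comm_ring_1) \<Rightarrow> (3 \<Rightarrow>\<^sub>0 nat) \<Rightarrow> 'r" where
  "monomial x m = (\<Prod>i\<in>UNIV. x i ^ Poly_Mapping.lookup m i)"

text \<open>Every ring homomorphism used below is an instance: evaluation at a point, linear
  substitution, dehomogenization, \<open>grade\<close> and \<open>to_polys\<close>. Their
  computation rules are thus proved once, in \<open>coeff_hom\<close>.\<close>

definition ev :: "(complex \<Rightarrow> 'r :: comm_ring_1) \<Rightarrow> (3 \<Rightarrow> 'r) \<Rightarrow> tpoly \<Rightarrow> 'r" where
  "ev h x f = (\<Sum>m\<in>Poly_Mapping.keys f. h (Poly_Mapping.lookup f m) * monomial x m)"

lemma monomial_0 [simp]: "monomial x 0 = 1"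
  by (simp add: monomial_def)

lemma monomial_add: "monomial x (m + n) = monomial x m * monomial x n"
  by (simp add: monomial_def lookup_add power_add prod.distrib)

lemma monomial_single: "monomial x (Poly_Mapping.single i n) = x i ^ n"
proof -
  have "monomial x (Poly_Mapping.single i n) = (\<Prod>j\<in>UNIV. if j = i then x i ^ n else 1)"
    unfolding monomial_def by (rule prod.cong) (auto simp: lookup_single when_def)
  then show ?thesis by simp
qed

locale coeff_hom =
  fixes h :: "complex \<Rightarrow> 'r :: comm_ring_1"
  assumes h_one: "h 1 = 1" and h_add: "h (a + b) = h a + h b" and h_mult: "h (a * b) = h a * h b"
begin

lemma h_zero: "h 0 = 0"
  using h_add[of 0 0] by simp

lemma ev_superset:
  assumes "finite A" "Poly_Mapping.keys f \<subseteq> A"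
  shows "ev h x f = (\<Sum>m\<in>A. h (Poly_Mapping.lookup f m) * monomial x m)"
  unfolding ev_def
  by (rule sum.mono_neutral_left) (use assms in \<open>auto simp: in_keys_iff h_zero\<close>)

lemma ev_single: "ev h x (Poly_Mapping.single m c) = h c * monomial x m"
  by (subst ev_superset[of "{m}"]) (auto split: if_splits)

lemma ev_add: "ev h x (f + g) = ev h x f + ev h x g"
proof -
  let ?A = "Poly_Mapping.keys f \<union> Poly_Mapping.keys g"
  have "ev h x (f + g) = (\<Sum>m\<in>?A. h (Poly_Mapping.lookup (f + g) m) * monomial x m)"
    using keys_add[of f g] by (intro ev_superset) auto
  moreover have "ev h x f = (\<Sum>m\<in>?A. h (Poly_Mapping.lookup f m) * monomial x m)"
    by (rule ev_superset) auto
  moreover have "ev h x g = (\<Sum>m\<in>?A. h (Poly_Mapping.lookup g m) * monomial x m)"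
    by (rule ev_superset) auto
  ultimately show ?thesis
    by (simp add: lookup_add h_add distrib_right sum.distrib)
qed

lemma ev_mult: "ev h x (f * g) = ev h x f * ev h x g"
proof (induction f rule: tpoly_induct)
  case (single m c)
  show ?case
  proof (induction g rule: tpoly_induct)
    case (single n e)
    show ?case
      by (simp add: mult_single ev_single h_mult monomial_add mult_ac)
  qed (simp add: distrib_left ev_add)
qed (simp add: distrib_right ev_add)

lemma ev_const: "ev h x (const c) = h c"
  by (simp add: const_def ev_single)

lemma ev_var: "ev h x (var i) = x i"
  by (simp add: var_def ev_single h_one monomial_single)

lemma ev_0: "ev h x 0 = 0"
  by (simp add: ev_def)

lemma ev_1: "ev h x 1 = 1"
  using ev_const[of x 1] by (simp add: const_def h_one)

lemma ev_minus: "ev h x (- f) = - ev h x f"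
  using ev_add[of x f "- f"] by (simp add: ev_0 add_eq_0_iff2 minus_unique)

lemma ev_diff: "ev h x (f - g) = ev h x f - ev h x g"
  using ev_add[of x f "- g"] by (simp add: ev_minus)

lemma ev_power: "ev h x (f ^ n) = ev h x f ^ n"
  by (induction n) (simp_all add: ev_1 ev_mult)

lemma ev_sum: "ev h x (sum f A) = (\<Sum>a\<in>A. ev h x (f a))"
  by (induction A rule: infinite_finite_induct) (simp_all add: ev_0 ev_add)

lemmas ev_simps = ev_add ev_mult ev_const ev_var ev_0 ev_1 ev_minus ev_diff ev_power ev_sum

end

lemma const_0 [simp]: "const 0 = 0"
  and const_1 [simp]: "const 1 = 1"
  by (simp_all add: const_def)

lemma const_add: "const (a + b) = const a + const b"
  by (simp add: const_def single_add)

lemma const_mult: "const (a * b) = const a * const b"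
  by (simp add: const_def mult_single)

lemma const_minus: "const (- a) = - const a"
  by (simp add: const_def single_uminus)

lemma const_diff: "const (a - b) = const a - const b"
  by (simp add: const_def single_diff)

lemma const_eq_iff [simp]: "const a = const b \<longleftrightarrow> a = b"
  by (metis const_def lookup_single_eq)

lemma const_eq_0_iff [simp]: "const a = 0 \<longleftrightarrow> a = 0"
  using const_eq_iff[of a 0] by (simp del: const_eq_iff)

lemma const_dvd_1: "c \<noteq> 0 \<Longrightarrow> const c dvd 1"
  by (rule dvdI[of _ _ "const (inverse c)"]) (simp flip: const_mult)

lemma var_power: "var i ^ n = Poly_Mapping.single (Poly_Mapping.single i n) 1"
  by (induction n) (simp_all add: var_def mult_single flip: single_add)

lemma monomial_var: "monomial var m = Poly_Mapping.single m 1"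
proof -
  have "monomial var m = Poly_Mapping.single (\<Sum>i\<in>A. Poly_Mapping.single i (Poly_Mapping.lookup m i)) 1"
    if "A = UNIV" for A
  proof -
    have "(\<Prod>i\<in>A. var i ^ Poly_Mapping.lookup m i) =
      Poly_Mapping.single (\<Sum>i\<in>A. Poly_Mapping.single i (Poly_Mapping.lookup m i)) 1" if "finite A" for A
      using that by induction (simp_all add: var_power mult_single)
    then show ?thesis using that by (simp add: monomial_def)
  qed
  moreover have "(\<Sum>i\<in>UNIV. Poly_Mapping.single i (Poly_Mapping.lookup m i)) = m"
    by (rule poly_mapping_eqI) (simp add: lookup_sum lookup_single when_def)
  ultimately show ?thesis by metis
qed

lemma single_eq_const_monomial: "Poly_Mapping.single m c = const c * monomial var m"
  by (simp add: monomial_var const_def mult_single)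

lemma tpoly_ring_induct [case_names const var add mult]:
  fixes f :: tpoly
  assumes const: "\<And>c. P (const c)" and var: "\<And>i. P (var i)"
    and add: "\<And>f g. P f \<Longrightarrow> P g \<Longrightarrow> P (f + g)"
    and mult: "\<And>f g. P f \<Longrightarrow> P g \<Longrightarrow> P (f * g)"
  shows "P f"
proof (induction f rule: tpoly_induct)
  case (single m c)
  have P1: "P 1" using const[of 1] by simp
  have pow: "P (var i ^ n)" for i n
    by (induction n) (auto intro: P1 var mult)
  have "P (\<Prod>i\<in>A. var i ^ Poly_Mapping.lookup m i)" if "finite A" for A
    using that by induction (auto intro: P1 mult pow)
  then show ?case
    by (simp add: single_eq_const_monomial monomial_def const mult)
qed (fact add)

definition mdeg :: "(3 \<Rightarrow>\<^sub>0 nat) \<Rightarrow> nat" where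
  "mdeg m = (\<Sum>i\<in>UNIV. Poly_Mapping.lookup m i)"

lemma is_form_iff: "is_form n f \<longleftrightarrow> (\<forall>m\<in>Poly_Mapping.keys f. mdeg m = n)"
  by (simp add: is_form_def mdeg_def)

text \<open>\<open>grade f\<close> is \<open>f(T x\<^sub>0, T x\<^sub>1, T x\<^sub>2)\<close> as a polynomial in \<open>T\<close>; its coefficients are the homogeneous
  components of \<open>f\<close>.\<close>

definition grade :: "tpoly \<Rightarrow> tpoly poly" where
  "grade = ev (\<lambda>c. [:const c:]) (\<lambda>i. monom (var i) 1)"

interpretation grade: coeff_hom "\<lambda>c. [:const c:]"
  by unfold_locales (simp_all add: const_add const_mult)

lemmas grade_simps = grade.ev_simps[of "\<lambda>i. monom (var i) 1", folded grade_def]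

definition hcomp :: "nat \<Rightarrow> tpoly \<Rightarrow> tpoly" where
  "hcomp n f = coeff (grade f) n"

lemma grade_single: "grade (Poly_Mapping.single m c) = monom (Poly_Mapping.single m c) (mdeg m)"
proof -
  have "(\<Prod>i\<in>A. monom (var i) 1 ^ Poly_Mapping.lookup m i) =
     monom (\<Prod>i\<in>A. var i ^ Poly_Mapping.lookup m i) (\<Sum>i\<in>A. Poly_Mapping.lookup m i)" if "finite A" for A
    using that by induction (simp_all add: monom_power mult_monom)
  then have "monomial (\<lambda>i. monom (var i) 1) m = monom (monomial var m) (mdeg m)"
    by (simp add: monomial_def mdeg_def)
  then show ?thesis
    unfolding grade_def grade.ev_single by (simp add: single_eq_const_monomial smult_monom)
qed

lemma lookup_hcomp: "Poly_Mapping.lookup (hcomp n f) m = (if mdeg m = n then Poly_Mapping.lookup f m else 0)"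
  by (induction f rule: tpoly_induct)
    (auto simp: hcomp_def grade_single grade_simps lookup_single lookup_add when_def)

lemma is_form_iff_hcomp: "is_form n f \<longleftrightarrow> hcomp n f = f"
  unfolding is_form_iff poly_mapping_eq_iff fun_eq_iff lookup_hcomp
  by (metis in_keys_iff)

lemma is_form_iff_grade: "is_form n f \<longleftrightarrow> grade f = monom f n"
proof
  assume "is_form n f"
  then have "hcomp k f = (if k = n then f else 0)" for k
    by (intro poly_mapping_eqI) (auto simp: lookup_hcomp is_form_iff in_keys_iff)
  then show "grade f = monom f n"
    by (intro poly_eqI) (simp add: hcomp_def)
qed (simp add: is_form_iff_hcomp hcomp_def)

lemma hcomp_add: "hcomp n (f + g) = hcomp n f + hcomp n g"
  and hcomp_diff: "hcomp n (f - g) = hcomp n f - hcomp n g"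
  and hcomp_minus: "hcomp n (- f) = - hcomp n f"
  and hcomp_0 [simp]: "hcomp n 0 = 0"
  by (simp_all add: hcomp_def grade_simps)

lemma hcomp_sum: "hcomp n (sum f A) = (\<Sum>a\<in>A. hcomp n (f a))"
  by (induction A rule: infinite_finite_induct) (simp_all add: hcomp_add)

text \<open>Taking the degree \<open>n\<close> part of an identity such as
  \<open>f = A * F + B * G\<close> with forms \<open>F\<close>, \<open>G\<close> replaces the
  cofactors by forms. The guard \<open>n < k\<close> is there because subtraction of naturals
  truncates.\<close>

lemma hcomp_mult_form: "is_form k g \<Longrightarrow> hcomp n (f * g) = (if n < k then 0 else hcomp (n - k) f * g)"
proof -
  assume "is_form k g"
  then have "grade (f * g) = grade f * monom g k"
    by (simp add: grade_simps is_form_iff_grade)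
  then have "coeff (grade (f * g)) n = coeff (monom g k * grade f) n"
    by (simp only: mult.commute)
  then show ?thesis
    by (simp add: hcomp_def coeff_monom_mult mult.commute[of g])
qed

lemma hcomp_form: "is_form k g \<Longrightarrow> hcomp n g = (if n = k then g else 0)"
  by (simp add: is_form_iff_grade hcomp_def)

lemma is_form_hcomp: "is_form n (hcomp n f)"
  by (auto simp: is_form_iff in_keys_iff lookup_hcomp split: if_splits)

lemma sum_hcomp: "\<exists>N. \<forall>n\<ge>N. f = (\<Sum>k\<le>n. hcomp k f)"
proof -
  have "f = (\<Sum>k\<le>n. hcomp k f)" if "n \<ge> Max (mdeg ` Poly_Mapping.keys f)" for n
  proof (rule poly_mapping_eqI)
    fix m
    have "mdeg m \<le> n" if "m \<in> Poly_Mapping.keys f"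
      using that \<open>n \<ge> _\<close> by (meson Max_ge finite_imageI finite_keys image_eqI le_trans)
    then show "Poly_Mapping.lookup f m = Poly_Mapping.lookup (\<Sum>k\<le>n. hcomp k f) m"
      by (auto simp: lookup_sum lookup_hcomp in_keys_iff)
  qed
  then show ?thesis by blast
qed

lemma is_form_0 [simp]: "is_form n 0"
  by (simp add: is_form_def)

lemma is_form_add: "is_form n f \<Longrightarrow> is_form n g \<Longrightarrow> is_form n (f + g)"
  and is_form_diff: "is_form n f \<Longrightarrow> is_form n g \<Longrightarrow> is_form n (f - g)"
  and is_form_minus: "is_form n f \<Longrightarrow> is_form n (- f)"
  by (simp_all add: is_form_iff_hcomp hcomp_add hcomp_diff hcomp_minus)

lemma is_form_sum: "(\<And>a. a \<in> A \<Longrightarrow> is_form n (f a)) \<Longrightarrow> is_form n (sum f A)"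
  by (simp add: is_form_iff_hcomp hcomp_sum)

lemma is_form_mult: "is_form m f \<Longrightarrow> is_form n g \<Longrightarrow> is_form (m + n) (f * g)"
  by (simp add: is_form_iff_grade grade_simps mult_monom)

lemma is_form_const [simp]: "is_form 0 (const c)"
  by (simp add: is_form_iff_grade grade_simps monom_0)

lemma is_form_1 [simp]: "is_form 0 1"
  using is_form_const[of 1] by simp

lemma is_form_var [simp]: "is_form 1 (var i)"
  by (simp add: is_form_iff_grade grade_simps)

lemmas is_form_var_Suc_0 [simp] = is_form_var[unfolded One_nat_def]

lemma is_form_const_mult: "is_form n f \<Longrightarrow> is_form n (const c * f)"
  using is_form_mult[of 0 "const c" n f] by simp

lemma is_form_power: "is_form m f \<Longrightarrow> is_form (n * m) (f ^ n)"
  by (induction n) (auto intro: is_form_mult)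

lemma is_form_deg_unique: "is_form m f \<Longrightarrow> is_form n f \<Longrightarrow> f \<noteq> 0 \<Longrightarrow> m = n"
  by (metis hcomp_form is_form_iff_hcomp)

lemma is_form_0_const: "is_form 0 f \<Longrightarrow> \<exists>c. f = const c"
proof -
  assume f: "is_form 0 f"
  have "Poly_Mapping.lookup f m = 0" if "m \<noteq> 0" for m
  proof -
    have "mdeg m \<noteq> 0"
      using that by (auto simp: mdeg_def poly_mapping_eq_iff fun_eq_iff)
    then show ?thesis using f by (metis is_form_iff in_keys_iff)
  qed
  then have "f = const (Poly_Mapping.lookup f 0)"
    by (intro poly_mapping_eqI) (auto simp: const_def lookup_single when_def)
  then show ?thesis by blast
qed

text \<open>Order at 0 and degree are both additive, and the order never exceeds the degree. They
  agree for the product, hence for each factor, and then \<open>X ^ degree P\<close> divides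
  \<open>P\<close>.\<close>

lemma monom_factor:
  fixes P Q :: "'r :: idom poly"
  assumes "P * Q = monom c n" "c \<noteq> 0"
  shows "\<exists>a k. P = monom a k"
proof -
  have nz: "P \<noteq> 0" "Q \<noteq> 0" using assms by auto
  have "monom c n = monom 1 n * [:c:]" by (simp add: monom_altdef)
  moreover have "monom 1 n = [:-0, 1:: 'r:] ^ n" by (simp add: monom_altdef)
  ultimately have "order 0 (monom c n) = n"
    using assms(2) order_power_n_n[of "0 :: 'r" n] by (simp add: order_smult)
  then have "order 0 P + order 0 Q = n"
    using order_mult[of P Q 0] assms by simp
  moreover have "degree P + degree Q = n"
    using degree_mult_eq[OF nz] assms by (simp add: degree_monom_eq)
  ultimately have "order 0 P = degree P"
    using order_degree[OF nz(1), of 0] order_degree[OF nz(2), of 0] by linarith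
  then have "[:0, 1:] ^ degree P dvd P"
    using order_1[of 0 P] by simp
  then obtain R where R: "P = [:0, 1:] ^ degree P * R" by (elim dvdE)
  then have "R \<noteq> 0" using nz by auto
  have "degree P = degree P + degree R"
    using \<open>R \<noteq> 0\<close> by (subst R) (simp add: degree_mult_eq degree_power_eq)
  then obtain r where "R = [:r:]" by (metis add_cancel_right_right degree_eq_zeroE)
  then have "P = monom r (degree P)"
    using R by (simp add: monom_altdef mult.commute)
  then show ?thesis by blast
qed

text \<open>\<open>grade\<close> maps into a polynomial ring over a domain and sends forms to
  monomials, so \<open>monom_factor\<close> applies. A monomial \<open>grade f\<close> means that
  only one homogeneous component of \<open>f\<close> is nonzero.\<close>

lemma is_form_factor:
  assumes "is_form n (f * g)" "f * g \<noteq> 0"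
  shows "\<exists>k. is_form k f"
proof -
  have "grade f * grade g = monom (f * g) n"
    using assms(1) by (simp add: is_form_iff_grade grade_simps)
  from monom_factor[OF this assms(2)] obtain a k where a: "grade f = monom a k" by blast
  have "f = hcomp k f"
  proof (rule poly_mapping_eqI)
    fix m
    have "Poly_Mapping.lookup f m = Poly_Mapping.lookup (hcomp (mdeg m) f) m"
      by (simp add: lookup_hcomp)
    then show "Poly_Mapping.lookup f m = Poly_Mapping.lookup (hcomp k f) m"
      using lookup_hcomp[of k f m] by (cases "mdeg m = k") (auto simp: hcomp_def a)
  qed
  then show ?thesis by (metis is_form_hcomp)
qed

lemma is_form_dvd:
  assumes "is_form n f" "f \<noteq> 0" "g dvd f"
  obtains k q where "k \<le> n" "is_form k g" "is_form (n - k) q" "f = g * q"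
proof -
  from assms obtain q where q: "f = g * q" by (elim dvdE)
  obtain k where k: "is_form k g" using is_form_factor[of n g q] assms q by auto
  obtain j where j: "is_form j q" using is_form_factor[of n q g] assms q by (auto simp: mult.commute)
  have "k + j = n"
    using is_form_mult[OF k j] assms is_form_deg_unique q by blast
  then show ?thesis using that[of k q] k j q by auto
qed

lemma dvd_1_iff_const: "f dvd 1 \<longleftrightarrow> (\<exists>c. c \<noteq> 0 \<and> f = const c)"
proof
  assume "f dvd 1"
  then obtain k q where "k \<le> 0" "is_form k f" "1 = f * q"
    using is_form_dvd[OF is_form_1, of f] by force
  then show "\<exists>c. c \<noteq> 0 \<and> f = const c"
    using is_form_0_const[of f] by force
qed (use const_dvd_1 in auto)

interpretation eval: coeff_hom "\<lambda>c. c"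
  by unfold_locales simp_all

lemma eval_tpoly_ev: "eval_tpoly f v = ev (\<lambda>c. c) (\<lambda>i. v $ i) f"
  by (simp add: eval_tpoly_def ev_def monomial_def)

lemmas eval_simps [simp] = eval.ev_simps[of "\<lambda>i. v $ i" for v, folded eval_tpoly_ev]

lemma eval_form_scale: "is_form n f \<Longrightarrow> eval_tpoly f (c *s v) = c ^ n * eval_tpoly f v"
proof -
  assume f: "is_form n f"
  have "(\<Prod>i\<in>UNIV. (c *s v) $ i ^ Poly_Mapping.lookup m i) = c ^ n * (\<Prod>i\<in>UNIV. v $ i ^ Poly_Mapping.lookup m i)"
    if "m \<in> Poly_Mapping.keys f" for m
  proof -
    have "c ^ n = (\<Prod>i\<in>UNIV. c ^ Poly_Mapping.lookup m i)"
      using f that by (auto simp: is_form_def simp flip: power_sum)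
    then show ?thesis by (simp add: power_mult_distrib prod.distrib)
  qed
  then show ?thesis
    by (auto simp: eval_tpoly_def sum_distrib_left intro!: sum.cong)
qed

interpretation subst: coeff_hom const
  by unfold_locales (simp_all add: const_add const_mult)

lemma eval_subst: "eval_tpoly (ev const x f) v = eval_tpoly f (\<chi> i. eval_tpoly (x i) v)"
  by (induction f rule: tpoly_ring_induct) (simp_all add: subst.ev_simps)

lemma is_form_subst:
  assumes "\<And>i. is_form 1 (x i)" "is_form n f"
  shows "is_form n (ev const x f)"
proof -
  have "is_form (\<Sum>i\<in>A. Poly_Mapping.lookup m i) (\<Prod>i\<in>A. x i ^ Poly_Mapping.lookup m i)" if "finite A" for A m
    using that
  proof induction
    case (insert i A)
    then show ?case
      using is_form_power[OF assms(1), of "Poly_Mapping.lookup m i" i] by (auto intro!: is_form_mult)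
  qed simp
  from this[OF finite] have "is_form (mdeg m) (monomial x m)" for m
    by (simp add: mdeg_def monomial_def)
  then have "is_form n (monomial x m)" if "m \<in> Poly_Mapping.keys f" for m
    using assms(2) that by (auto simp: is_form_iff)
  then show ?thesis
    unfolding ev_def by (intro is_form_sum is_form_const_mult)
qed

text \<open>Modulo \<open>l\<close> the substitution is the identity on constants and variables, and
  congruences respect sums and products.\<close>

lemma subst_cong_dvd:
  assumes "\<And>i. l dvd var i - x i"
  shows "l dvd f - ev const x f"
proof (induction f rule: tpoly_ring_induct)
  case (add f g)
  have "f + g - ev const x (f + g) = (f - ev const x f) + (g - ev const x g)"
    by (simp add: subst.ev_simps)
  then show ?case using add by (metis dvd_add)
next
  case (mult f g)
  have "f * g - ev const x f * ev const x g = f * (g - ev const x g) + (f - ev const x f) * ev const x g"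
    by (simp add: algebra_simps)
  then show ?case using mult by (simp add: subst.ev_simps)
qed (use assms in \<open>simp_all add: subst.ev_simps\<close>)

section \<open>Unique factorization\<close>

text \<open>From here on the variables are indexed by 1, 2, 3; in type \<open>3\<close> the numeral 3 is 0, so \<open>x\<^sub>3\<close> is
  \<open>x\<^sub>0\<close>.\<close>

definition to_polys :: "tpoly \<Rightarrow> complex poly poly poly" where
  "to_polys = ev (\<lambda>c. [:[:[:c:]:]:])
     (\<lambda>i. if i = 1 then [:[:[:0, 1:]:]:] else if i = 2 then [:[:0, 1:]:] else [:0, 1:])"

interpretation polys: coeff_hom "\<lambda>c. [:[:[:c:]:]:]"
  by unfold_locales (simp_all add: one_pCons)

lemmas to_polys_simps = polys.ev_simps[of "\<lambda>i. if i = 1 then [:[:[:0, 1:]:]:] else if i = 2 then [:[:0, 1:]:] else [:0, 1:]",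
  folded to_polys_def]

lemma prod_3: "prod f (UNIV :: 3 set) = f 1 * f 2 * f 3"
  unfolding UNIV_3 by (simp add: ac_simps)

lemma X_power: "[:0, 1 :: 'a :: comm_semiring_1:] ^ n = monom 1 n"
  by (simp add: monom_altdef)

lemma to_polys_single: "to_polys (Poly_Mapping.single m c) =
  monom (monom (monom c (Poly_Mapping.lookup m 1)) (Poly_Mapping.lookup m 2)) (Poly_Mapping.lookup m 3)"
proof -
  have X: "[:[:[:0, 1:]:]:] ^ i = [:[:monom (1::complex) i:]:]" "[:[:0, 1:]:] ^ i = [:monom (1::complex poly) i:]" for i
    by (simp_all only: poly_const_pow X_power)
  have "to_polys (Poly_Mapping.single m c) = [:[:[:c:]:]:] *
    ([:[:monom 1 (Poly_Mapping.lookup m 1):]:] * [:monom 1 (Poly_Mapping.lookup m 2):] * monom 1 (Poly_Mapping.lookup m 3))"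
    unfolding to_polys_def polys.ev_single monomial_def prod_3 by (simp add: X X_power)
  then show ?thesis by (simp add: smult_monom)
qed

lemma poly_mapping_3_eqI:
  "Poly_Mapping.lookup m (1::3) = Poly_Mapping.lookup n 1 \<Longrightarrow> Poly_Mapping.lookup m 2 = Poly_Mapping.lookup n 2 \<Longrightarrow>
   Poly_Mapping.lookup m 3 = Poly_Mapping.lookup n 3 \<Longrightarrow> m = n"
proof (rule poly_mapping_eqI)
  fix k assume "Poly_Mapping.lookup m (1::3) = Poly_Mapping.lookup n 1" "Poly_Mapping.lookup m 2 = Poly_Mapping.lookup n 2"
   "Poly_Mapping.lookup m 3 = Poly_Mapping.lookup n 3"
  then show "Poly_Mapping.lookup m k = Poly_Mapping.lookup n k" using exhaust_3[of k] by auto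
qed

lemma coeff_to_polys:
  "coeff (coeff (coeff (to_polys f) (Poly_Mapping.lookup m 3)) (Poly_Mapping.lookup m 2)) (Poly_Mapping.lookup m 1) =
   Poly_Mapping.lookup f m"
proof (induction f rule: tpoly_induct)
  case (single n c)
  show ?case
  proof (cases "n = m")
    case False
    then have "\<not> (Poly_Mapping.lookup n 1 = Poly_Mapping.lookup m 1 \<and> Poly_Mapping.lookup n 2 = Poly_Mapping.lookup m 2 \<and>
      Poly_Mapping.lookup n 3 = Poly_Mapping.lookup m 3)"
      using poly_mapping_3_eqI by blast
    then show ?thesis using False by (simp add: to_polys_single lookup_single)
  qed (simp add: to_polys_single)
qed (simp add: to_polys_simps lookup_add)

lemma inj_to_polys: "to_polys f = to_polys g \<Longrightarrow> f = g"
  by (rule poly_mapping_eqI) (metis coeff_to_polys)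

lemma surj_to_polys: "\<exists>f. to_polys f = P"
proof (induction P)
  case 0
  show ?case by (rule exI[of _ 0]) (simp add: to_polys_simps)
next
  case (pCons A P)
  have "\<exists>f. to_polys f = [:A:]"
  proof (induction A)
    case 0
    show ?case by (rule exI[of _ 0]) (simp add: to_polys_simps)
  next
    case (pCons a A)
    have "\<exists>f. to_polys f = [:[:a:]:]"
    proof (induction a)
      case 0
      show ?case by (rule exI[of _ 0]) (simp add: to_polys_simps)
    next
      case (pCons c a)
      then obtain f where "to_polys f = [:[:a:]:]" by blast
      then have "to_polys (const c + var 1 * f) = [:[:pCons c a:]:]"
        by (simp add: to_polys_simps)
      then show ?case by blast
    qed
    then obtain f where "to_polys f = [:[:a:]:]" by blast
    moreover obtain g where "to_polys g = [:A:]" using pCons by blast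
    ultimately have "to_polys (f + var 2 * g) = [:pCons a A:]"
      by (simp add: to_polys_simps)
    then show ?case by blast
  qed
  then obtain f where "to_polys f = [:A:]" by blast
  moreover obtain g where "to_polys g = P" using pCons by blast
  ultimately have "to_polys (f + var 3 * g) = pCons A P"
    by (simp add: to_polys_simps)
  then show ?case by blast
qed

text \<open>As an isomorphism, \<open>to_polys\<close> carries divisibility both ways. Iterated
  univariate polynomials over a field have gcds and prime factorizations, which thereby become
  available for \<open>tpoly\<close>.\<close>

lemma to_polys_dvd_iff: "to_polys f dvd to_polys g \<longleftrightarrow> f dvd g"
proof
  assume "to_polys f dvd to_polys g"
  then obtain Q where "to_polys g = to_polys f * Q" by (elim dvdE)
  then obtain q where "to_polys g = to_polys f * to_polys q" using surj_to_polys[of Q] by blast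
  then have "g = f * q" by (intro inj_to_polys) (simp add: to_polys_simps)
  then show "f dvd g" by simp
qed (auto elim!: dvdE simp: to_polys_simps)

lemma to_polys_unit_iff: "to_polys f dvd 1 \<longleftrightarrow> f dvd 1"
  using to_polys_dvd_iff[of f 1] by (simp add: to_polys_simps)

definition no_common_factor :: "tpoly set \<Rightarrow> bool" where
  "no_common_factor A \<longleftrightarrow> (\<forall>p. (\<forall>a\<in>A. p dvd a) \<longrightarrow> p dvd 1)"

text \<open>Euclid's lemma for three coefficients: \<open>p\<close> divides the gcd of the three
  products, which is \<open>x\<close> times the gcd of \<open>a\<close>, \<open>b\<close>,
  \<open>c\<close>, and that gcd is a unit. Nothing is assumed about primality of
  \<open>p\<close>.\<close>

lemma no_common_factor_dvd_cancel:
  assumes "no_common_factor {a, b, c}" "p dvd x * a" "p dvd x * b" "p dvd x * c"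
  shows "p dvd x"
proof -
  have gcd: "q dvd y * gcd u v" if "q dvd y * u" "q dvd y * v" for q y u v :: "complex poly poly poly"
  proof -
    have "q dvd gcd (y * u) (y * v)" using that by simp
    then show ?thesis by (simp add: gcd_mult_left)
  qed
  let ?g = "gcd (to_polys a) (gcd (to_polys b) (to_polys c))"
  obtain g where g: "to_polys g = ?g" using surj_to_polys by blast
  have "?g dvd to_polys a" "?g dvd to_polys b" "?g dvd to_polys c"
    by (auto intro: dvd_trans[OF gcd_dvd2])
  then have "g dvd a" "g dvd b" "g dvd c"
    unfolding g[symmetric] to_polys_dvd_iff by auto
  then have "g dvd 1" using assms(1) by (auto simp: no_common_factor_def)
  then have unit: "?g dvd 1" using g to_polys_unit_iff by metis
  have "to_polys p dvd to_polys x * ?g"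
    using assms(2-4) by (intro gcd) (auto simp flip: to_polys_dvd_iff simp: to_polys_simps)
  then have "to_polys p dvd to_polys x"
    using unit dvd_mult_unit_iff by blast
  then show ?thesis by (simp add: to_polys_dvd_iff)
qed

lemma no_common_factor_pair_dvd:
  "no_common_factor {a, b} \<Longrightarrow> a dvd x * b \<Longrightarrow> a dvd x"
  using no_common_factor_dvd_cancel[of a b b a x] by simp

text \<open>Coprimality with \<open>C\<close> can be tested on finitely many non-units, which is
  what leaves room for a generic choice of a parameter. The normalized prime factors of
  \<open>to_polys C\<close> represent all its primes up to units.\<close>

lemma finite_prime_divisors:
  fixes C :: tpoly
  assumes "C \<noteq> 0"
  obtains P where "finite P" "\<forall>p\<in>P. \<not> p dvd 1"
    "\<forall>q. q dvd C \<longrightarrow> \<not> q dvd 1 \<longrightarrow> (\<exists>p\<in>P. p dvd q)"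
proof -
  define inv where "inv = inv_into UNIV to_polys"
  have inv: "to_polys (inv Q) = Q" for Q
    using surj_to_polys[of Q] by (metis inv_def f_inv_into_f rangeI)
  have C: "to_polys C \<noteq> 0" using assms inj_to_polys[of C 0] by (auto simp: to_polys_simps)
  let ?P = "inv ` prime_factors (to_polys C)"
  have "\<not> p dvd 1" if "p \<in> ?P" for p
    using that inv by (auto simp flip: to_polys_unit_iff simp: in_prime_factors_iff)
  moreover have "\<exists>p\<in>?P. p dvd q" if q: "q dvd C" "\<not> q dvd 1" for q
  proof -
    have "to_polys q dvd to_polys C" "\<not> to_polys q dvd 1"
      using q to_polys_dvd_iff to_polys_unit_iff by auto
    moreover from this have "to_polys q \<noteq> 0" using C by auto
    ultimately obtain r where r: "r dvd to_polys q" "prime r"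
      using prime_divisor_exists by blast
    then have "r \<in> prime_factors (to_polys C)"
      using \<open>to_polys q dvd to_polys C\<close> C by (auto simp: in_prime_factors_iff intro: dvd_trans)
    moreover have "inv r dvd q" using r inv to_polys_dvd_iff[of "inv r" q] by simp
    ultimately show ?thesis by blast
  qed
  ultimately show ?thesis by (intro that[of ?P]) simp_all
qed

lemma infinite_three:
  assumes "infinite T"
  obtains t s r where "t \<in> T" "s \<in> T" "r \<in> T" "s \<noteq> t" "r \<noteq> t" "r \<noteq> s"
proof -
  obtain S where S: "S \<subseteq> T" "card S = 3" using infinite_arbitrarily_large[OF assms] by blast
  obtain t s r where "S = {t, s, r}" "t \<noteq> s" "s \<noteq> r" "t \<noteq> r" using S(2) card_3_iff by metis
  then show ?thesis using S that[of t s r] by auto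
qed

text \<open>A prime divides at most two members of the family \<open>M\<^sub>1 + t M\<^sub>2 + t\<^sup>2 M\<^sub>3\<close>, by the Vandermonde
  determinant, unless it divides all three forms.\<close>

lemma generic_combination_coprime:
  assumes M: "no_common_factor {M1, M2, M3}" and "C \<noteq> 0"
  shows "\<exists>t. no_common_factor {M1 + const t * M2 + const (t ^ 2) * M3, C}"
proof -
  let ?F = "\<lambda>t. M1 + const t * M2 + const (t ^ 2) * M3"
  obtain P where P: "finite P" "\<forall>p\<in>P. \<not> p dvd 1"
    "\<forall>q. q dvd C \<longrightarrow> \<not> q dvd 1 \<longrightarrow> (\<exists>p\<in>P. p dvd q)"
    by (rule finite_prime_divisors[OF \<open>C \<noteq> 0\<close>])
  have cancel: "p dvd f" if "p dvd const c * f" "c \<noteq> 0" for p f c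
  proof -
    have "const (inverse c) * (const c * f) = f"
      using that by (simp flip: mult.assoc const_mult)
    then show ?thesis using that by (metis dvd_mult)
  qed
  have "finite {t. p dvd ?F t}" if "p \<in> P" for p
  proof (rule ccontr)
    assume inf: "infinite {t. p dvd ?F t}"
    obtain t s r where tsr: "t \<in> {t. p dvd ?F t}" "s \<in> {t. p dvd ?F t}" "r \<in> {t. p dvd ?F t}"
      and neq: "s \<noteq> t" "r \<noteq> t" "r \<noteq> s"
      by (rule infinite_three[OF inf])
    have t: "p dvd ?F t" and s: "p dvd ?F s" "s \<noteq> t" and r: "p dvd ?F r" "r \<noteq> t" "r \<noteq> s"
      using tsr neq by simp_all
    \<comment> \<open>A divided difference: \<open>?F a - ?F b\<close> is \<open>a - b\<close> times
      this form. A second difference then isolates \<open>M3\<close>.\<close>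
    have pair: "p dvd M2 + const (a + b) * M3" if "p dvd ?F a" "p dvd ?F b" "a \<noteq> b" for a b
    proof -
      have "p dvd ?F a - ?F b" using that by (intro dvd_diff)
      moreover have "?F a - ?F b = const (a - b) * (M2 + const (a + b) * M3)"
        by (simp add: const_diff const_add const_mult power2_eq_square algebra_simps)
      ultimately have "p dvd const (a - b) * (M2 + const (a + b) * M3)" by (simp only:)
      then show ?thesis by (rule cancel) (use that(3) in simp)
    qed
    have "p dvd (M2 + const (t + s) * M3) - (M2 + const (t + r) * M3)"
      using pair[OF t s(1)] pair[OF t r(1)] s r by (intro dvd_diff) auto
    moreover have "(M2 + const (t + s) * M3) - (M2 + const (t + r) * M3) = const (s - r) * M3"
      unfolding const_diff const_add by (simp add: left_diff_distrib distrib_right)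
    ultimately have "p dvd const (s - r) * M3" by (simp only:)
    then have 3: "p dvd M3" by (rule cancel) (use r(3) in simp)
    then have 2: "p dvd M2" using pair[OF t s(1)] s by (metis dvd_add_left_iff dvd_mult)
    have "p dvd M1 + (const t * M2 + const (t ^ 2) * M3)" using t by (simp add: add.assoc)
    moreover have "p dvd const t * M2 + const (t ^ 2) * M3" using 2 3 by (intro dvd_add dvd_mult)
    ultimately have "p dvd M1" by (metis dvd_add_left_iff)
    then have "p dvd 1" using 2 3 M by (auto simp: no_common_factor_def)
    then show False using P that by auto
  qed
  then have "finite (\<Union>p\<in>P. {t. p dvd ?F t})" using P by auto
  then obtain t where t: "t \<notin> (\<Union>p\<in>P. {t. p dvd ?F t})"
    using ex_new_if_finite[OF infinite_UNIV_char_0] by blast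
  have "no_common_factor {?F t, C}"
    unfolding no_common_factor_def
  proof (intro allI impI)
    fix q assume q: "\<forall>a\<in>{?F t, C}. q dvd a"
    show "q dvd 1"
    proof (rule ccontr)
      assume "\<not> q dvd 1"
      then obtain p where "p \<in> P" "p dvd q" using P q by auto
      then have "p dvd ?F t" using q by (auto intro: dvd_trans)
      then show False using t \<open>p \<in> P\<close> by auto
    qed
  qed
  then show ?thesis by blast
qed

section \<open>Syzygies of a cross product\<close>

lemma proportional_cancel:
  fixes M N :: "'r :: idom"
  assumes "M \<noteq> 0" "M * c = N * b" "b = \<alpha> * M"
  shows "c = \<alpha> * N"
proof -
  have "M * c = M * (\<alpha> * N)" using assms by (simp add: ac_simps)
  then show ?thesis using assms(1) by simp
qed

text \<open>If \<open>M1\<close> is nonzero, the relations show that it divides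
  \<open>b1 * M1\<close>, \<open>b1 * M2\<close> and \<open>b1 * M3\<close>, hence
  \<open>b1\<close>. The quotient is the factor, and cancelling \<open>M1\<close> gives the other
  two coordinates. The other cases are alike.\<close>

lemma proportional_to_primitive:
  assumes M: "no_common_factor {M1, M2, M3}"
    and "M1 * b2 = M2 * b1" "M1 * b3 = M3 * b1" "M2 * b3 = M3 * b2"
  shows "\<exists>\<alpha>. b1 = \<alpha> * M1 \<and> b2 = \<alpha> * M2 \<and> b3 = \<alpha> * M3"
proof -
  have "M1 \<noteq> 0 \<or> M2 \<noteq> 0 \<or> M3 \<noteq> 0"
  proof (rule ccontr)
    assume "\<not> ?thesis"
    then have "(0 :: tpoly) dvd 1" using M by (auto simp: no_common_factor_def)
    then show False by simp
  qed
  then consider "M1 \<noteq> 0" | "M2 \<noteq> 0" | "M3 \<noteq> 0" by blast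
  then show ?thesis
  proof cases
    case 1
    have "M1 dvd b1"
      by (rule no_common_factor_dvd_cancel[OF M])
        (use assms(2-3) in \<open>metis dvd_triv_left dvd_triv_right mult.commute\<close>)+
    then obtain \<alpha> where "b1 = \<alpha> * M1" by (metis dvdE mult.commute)
    moreover have "b2 = \<alpha> * M2" "b3 = \<alpha> * M3"
      using 1 assms(2-4) by (auto intro!: proportional_cancel[OF _ _ \<open>b1 = \<alpha> * M1\<close>])
    ultimately show ?thesis by blast
  next
    case 2
    have "M2 dvd b2"
      by (rule no_common_factor_dvd_cancel[OF M])
        (use assms(2,4) in \<open>metis dvd_triv_left dvd_triv_right mult.commute\<close>)+
    then obtain \<alpha> where "b2 = \<alpha> * M2" by (metis dvdE mult.commute)
    moreover have "b1 = \<alpha> * M1" "b3 = \<alpha> * M3"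
      using 2 assms(2-4) by (auto intro!: proportional_cancel[OF _ _ \<open>b2 = \<alpha> * M2\<close>])
    ultimately show ?thesis by blast
  next
    case 3
    have "M3 dvd b3"
      by (rule no_common_factor_dvd_cancel[OF M])
        (use assms(3,4) in \<open>metis dvd_triv_left dvd_triv_right mult.commute\<close>)+
    then obtain \<alpha> where "b3 = \<alpha> * M3" by (metis dvdE mult.commute)
    moreover have "b1 = \<alpha> * M1" "b2 = \<alpha> * M2"
      using 3 assms(2-4) by (auto intro!: proportional_cancel[OF _ _ \<open>b3 = \<alpha> * M3\<close>])
    ultimately show ?thesis by blast
  qed
qed

text \<open>In vector notation \<open>M = x \<times> g\<close> is orthogonal to \<open>x\<close> and
  \<open>g\<close>, so the triple product rule gives
  \<open>M \<times> (a \<times> g) = - t g\<close> and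
  \<open>M \<times> (x \<times> a) = t x\<close>. The last six identities expand
  \<open>c \<times> g\<close> and \<open>x \<times> c\<close> for
  \<open>c = a - \<alpha> x - \<beta> g\<close>.\<close>

lemma cross_product_identities:
  fixes a1 a2 a3 x1 x2 x3 g1 g2 g3 M1 M2 M3 t \<alpha> \<beta> :: "'r :: comm_ring_1"
  assumes M1: "M1 = x2 * g3 - x3 * g2" and M2: "M2 = x3 * g1 - x1 * g3" and M3: "M3 = x1 * g2 - x2 * g1"
    and t: "t = a1 * M1 + a2 * M2 + a3 * M3"
  shows "M1 * (a3 * g1 - a1 * g3) - M2 * (a2 * g3 - a3 * g2) = - g3 * t"
    and "M1 * (a1 * g2 - a2 * g1) - M3 * (a2 * g3 - a3 * g2) = g2 * t"
    and "M2 * (a1 * g2 - a2 * g1) - M3 * (a3 * g1 - a1 * g3) = - g1 * t"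
    and "M1 * (x3 * a1 - x1 * a3) - M2 * (x2 * a3 - x3 * a2) = x3 * t"
    and "M1 * (x1 * a2 - x2 * a1) - M3 * (x2 * a3 - x3 * a2) = - x2 * t"
    and "M2 * (x1 * a2 - x2 * a1) - M3 * (x3 * a1 - x1 * a3) = x1 * t"
    and "(a2 - \<alpha> * x2 - \<beta> * g2) * g3 - (a3 - \<alpha> * x3 - \<beta> * g3) * g2 = (a2 * g3 - a3 * g2) - \<alpha> * M1"
    and "(a3 - \<alpha> * x3 - \<beta> * g3) * g1 - (a1 - \<alpha> * x1 - \<beta> * g1) * g3 = (a3 * g1 - a1 * g3) - \<alpha> * M2"
    and "(a1 - \<alpha> * x1 - \<beta> * g1) * g2 - (a2 - \<alpha> * x2 - \<beta> * g2) * g1 = (a1 * g2 - a2 * g1) - \<alpha> * M3"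
    and "x2 * (a3 - \<alpha> * x3 - \<beta> * g3) - x3 * (a2 - \<alpha> * x2 - \<beta> * g2) = (x2 * a3 - x3 * a2) - \<beta> * M1"
    and "x3 * (a1 - \<alpha> * x1 - \<beta> * g1) - x1 * (a3 - \<alpha> * x3 - \<beta> * g3) = (x3 * a1 - x1 * a3) - \<beta> * M2"
    and "x1 * (a2 - \<alpha> * x2 - \<beta> * g2) - x2 * (a1 - \<alpha> * x1 - \<beta> * g1) = (x1 * a2 - x2 * a1) - \<beta> * M3"
  unfolding t M1 M2 M3 by (simp_all add: algebra_simps)

text \<open>Syzygies of the \<open>2 \<times> 2\<close> minors \<open>M = x \<times> g\<close> (Hilbert-Burch): \<open>a \<cdot> M = 0\<close> makes \<open>a \<times> g\<close> and
  \<open>x \<times> a\<close> proportional to \<open>M\<close>.\<close>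

lemma syzygy_of_minors:
  assumes M1: "M1 = x2 * g3 - x3 * g2" and M2: "M2 = x3 * g1 - x1 * g3" and M3: "M3 = x1 * g2 - x2 * g1"
    and cop: "no_common_factor {M1, M2, M3}" and syz: "a1 * M1 + a2 * M2 + a3 * M3 = 0"
  shows "\<exists>\<alpha> \<beta>. a1 = \<alpha> * x1 + \<beta> * g1 \<and> a2 = \<alpha> * x2 + \<beta> * g2 \<and> a3 = \<alpha> * x3 + \<beta> * g3"
proof -
  note ids = cross_product_identities[OF M1 M2 M3 syz[symmetric]]
  have "\<exists>\<alpha>. a2 * g3 - a3 * g2 = \<alpha> * M1 \<and> a3 * g1 - a1 * g3 = \<alpha> * M2 \<and> a1 * g2 - a2 * g1 = \<alpha> * M3"
  proof (rule proportional_to_primitive[OF cop])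
    show "M1 * (a3 * g1 - a1 * g3) = M2 * (a2 * g3 - a3 * g2)" using ids(1) by simp
    show "M1 * (a1 * g2 - a2 * g1) = M3 * (a2 * g3 - a3 * g2)" using ids(2) by simp
    show "M2 * (a1 * g2 - a2 * g1) = M3 * (a3 * g1 - a1 * g3)" using ids(3) by simp
  qed
  then obtain \<alpha> where \<alpha>: "a2 * g3 - a3 * g2 = \<alpha> * M1" "a3 * g1 - a1 * g3 = \<alpha> * M2" "a1 * g2 - a2 * g1 = \<alpha> * M3"
    by blast
  have "\<exists>\<beta>. x2 * a3 - x3 * a2 = \<beta> * M1 \<and> x3 * a1 - x1 * a3 = \<beta> * M2 \<and> x1 * a2 - x2 * a1 = \<beta> * M3"
  proof (rule proportional_to_primitive[OF cop])
    show "M1 * (x3 * a1 - x1 * a3) = M2 * (x2 * a3 - x3 * a2)" using ids(4) by simp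
    show "M1 * (x1 * a2 - x2 * a1) = M3 * (x2 * a3 - x3 * a2)" using ids(5) by simp
    show "M2 * (x1 * a2 - x2 * a1) = M3 * (x3 * a1 - x1 * a3)" using ids(6) by simp
  qed
  then obtain \<beta> where \<beta>: "x2 * a3 - x3 * a2 = \<beta> * M1" "x3 * a1 - x1 * a3 = \<beta> * M2" "x1 * a2 - x2 * a1 = \<beta> * M3"
    by blast
  define c1 c2 c3 where c: "c1 = a1 - \<alpha> * x1 - \<beta> * g1" "c2 = a2 - \<alpha> * x2 - \<beta> * g2" "c3 = a3 - \<alpha> * x3 - \<beta> * g3"
  have cg: "c2 * g3 = c3 * g2" "c3 * g1 = c1 * g3" "c1 * g2 = c2 * g1"
    using \<alpha> ids(7-9)[of \<alpha> \<beta>] unfolding c by simp_all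
  have cx: "x2 * c3 = x3 * c2" "x3 * c1 = x1 * c3" "x1 * c2 = x2 * c1"
    using \<beta> ids(10-12)[of \<alpha> \<beta>] unfolding c by simp_all
  \<comment> \<open>Used with \<open>e\<close> a coordinate of \<open>c\<close> and \<open>y\<close>
    the same coordinate of \<open>x\<close>. Since \<open>c\<close> is parallel to \<open>x\<close>,
    this coordinate of \<open>c\<close> times \<open>x \<times> g\<close> equals that of
    \<open>x\<close> times \<open>c \<times> g\<close>, which is 0. As \<open>M\<close> is nonzero,
    \<open>c\<close> vanishes.\<close>
  have "e * M1 = 0 \<and> e * M2 = 0 \<and> e * M3 = 0" if "e * x1 = y * c1" "e * x2 = y * c2" "e * x3 = y * c3" for e y
  proof -
    have "e * M1 = y * (c2 * g3 - c3 * g2)" "e * M2 = y * (c3 * g1 - c1 * g3)" "e * M3 = y * (c1 * g2 - c2 * g1)"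
      by (simp_all add: M1 M2 M3 that right_diff_distrib flip: mult.assoc)
    then show ?thesis by (simp add: cg)
  qed
  from this[of c1 x1] this[of c2 x2] this[of c3 x3]
  have zero: "c1 * M1 = 0" "c1 * M2 = 0" "c1 * M3 = 0" "c2 * M1 = 0" "c2 * M2 = 0" "c2 * M3 = 0"
    "c3 * M1 = 0" "c3 * M2 = 0" "c3 * M3 = 0"
    using cx by (simp_all add: mult.commute)
  have "M1 \<noteq> 0 \<or> M2 \<noteq> 0 \<or> M3 \<noteq> 0"
  proof (rule ccontr)
    assume "\<not> ?thesis"
    then have "(0 :: tpoly) dvd 1" using cop by (auto simp: no_common_factor_def)
    then show False by simp
  qed
  then have "c1 = 0" "c2 = 0" "c3 = 0" using zero by auto
  then show ?thesis unfolding c by (intro exI[of _ \<alpha>] exI[of _ \<beta>]) (simp add: algebra_simps)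
qed

section \<open>Hilbert functions\<close>

context vector_space
begin

text \<open>The ambient space is infinite-dimensional, where \<open>dim\<close> need not be
  monotone. A finite set \<open>B\<close> whose span contains everything is therefore carried
  through these lemmas; for forms it is the set of monomials of their degree.\<close>

lemma independent_card_le_dim_of_finite:
  assumes "independent A" "A \<subseteq> W" "W \<subseteq> span B" "finite B"
  shows "finite A" "card A \<le> dim W"
proof -
  obtain C where C: "C \<subseteq> W" "independent C" "W \<subseteq> span C" "card C = dim W"
    using basis_exists by blast
  have "finite C" using independent_span_bound[OF assms(4) C(2)] C(1) assms(3) by blast
  moreover have "A \<subseteq> span C" using assms(2) C(3) by blast
  ultimately have "finite A \<and> card A \<le> card C" using independent_span_bound assms(1) by blast
  then show "finite A" "card A \<le> dim W" using C(4) by auto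
qed

lemma dim_mono_of_finite:
  assumes "V \<subseteq> W" "W \<subseteq> span B" "finite B"
  shows "dim V \<le> dim W"
proof -
  obtain A where A: "A \<subseteq> V" "independent A" "V \<subseteq> span A" "card A = dim V"
    using basis_exists by blast
  then show ?thesis using independent_card_le_dim_of_finite(2)[OF A(2) _ assms(2,3)] assms(1) by auto
qed

lemma subspace_eq_of_dim_ge:
  assumes "V \<subseteq> W" "W \<subseteq> span B" "finite B" "subspace V" "dim W \<le> dim V"
  shows "V = W"
proof (rule ccontr)
  assume "V \<noteq> W"
  then obtain w where w: "w \<in> W" "w \<notin> V" using assms(1) by blast
  obtain A where A: "A \<subseteq> V" "independent A" "V \<subseteq> span A" "card A = dim V"
    using basis_exists by blast
  have "span A \<subseteq> V" using A(1) assms(4) by (rule span_minimal)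
  then have nw: "w \<notin> span A" using w by blast
  then have "independent (insert w A)" using A(2) by (simp add: independent_insert)
  moreover have "insert w A \<subseteq> W" using w A(1) assms(1) by blast
  ultimately have fin: "finite (insert w A)" and "card (insert w A) \<le> dim W"
    using independent_card_le_dim_of_finite[of "insert w A" W B] assms(2,3) by simp_all
  moreover have "w \<notin> A" using nw span_base by blast
  ultimately show False using A(4) assms(5) by simp
qed

text \<open>One half of Grassmann's formula: a basis \<open>A\<close> of the intersection extends to
  a basis \<open>C\<close> of \<open>U\<close>, and \<open>C - A\<close> is independent of a basis
  \<open>D\<close> of \<open>W\<close>. Only closure of \<open>X\<close> under the sums is asked
  for, so \<open>X\<close> may be larger.\<close>

lemma dim_sum_ge:
  assumes "subspace U" "subspace W" "\<And>u w. u \<in> U \<Longrightarrow> w \<in> W \<Longrightarrow> u + w \<in> X"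
    and "X \<subseteq> span B" "finite B"
  shows "dim U + dim W \<le> dim X + dim (U \<inter> W)"
proof -
  have U: "U \<subseteq> X" using assms(3)[OF _ subspace_0[OF assms(2)]] by auto
  have W: "W \<subseteq> X" using assms(3)[OF subspace_0[OF assms(1)]] by auto
  obtain A where A: "A \<subseteq> U \<inter> W" "independent A" "U \<inter> W \<subseteq> span A" "card A = dim (U \<inter> W)"
    using basis_exists by blast
  obtain C where C: "A \<subseteq> C" "C \<subseteq> U" "independent C" "U \<subseteq> span C"
    using maximal_independent_subset_extend[of A U] A by blast
  obtain D where D: "D \<subseteq> W" "independent D" "W \<subseteq> span D" "card D = dim W"
    using basis_exists by blast
  have finC: "finite C" and finD: "finite D"
    using independent_card_le_dim_of_finite(1)[OF C(3) _ assms(4,5)]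
      independent_card_le_dim_of_finite(1)[OF D(2) _ assms(4,5)] C(2) D(1) U W by auto
  have cardC: "card C = dim U" using C by (intro basis_card_eq_dim) auto
  have "independent (X' \<union> D) \<and> X' \<inter> D = {}" if "finite X'" "X' \<subseteq> C - A" for X'
    using that
  proof induction
    case empty
    show ?case using D by simp
  next
    case (insert x X')
    \<comment> \<open>If \<open>x = u + w\<close>, then \<open>w\<close> lies in both
      \<open>U\<close> and \<open>W\<close>, hence in the span of \<open>A\<close>. So
      \<open>x\<close> would depend on the other elements of the basis \<open>C\<close>.\<close>
    have "x \<notin> span (X' \<union> D)"
    proof
      assume "x \<in> span (X' \<union> D)"
      then obtain u w where uw: "x = u + w" "u \<in> span X'" "w \<in> span D"
        by (auto simp: span_Un)
      have "x \<in> U" using insert C by blast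
      moreover have "u \<in> U"
        using uw(2) span_minimal[of X' U] insert C(2) assms(1) by blast
      ultimately have "w \<in> U" using uw(1) subspace_diff[OF assms(1)] by (metis add_diff_cancel_left')
      moreover have "w \<in> W" using uw(3) span_minimal[OF D(1) assms(2)] by blast
      ultimately have "w \<in> span A" using A(3) by blast
      then have "x \<in> span (X' \<union> A)" using uw by (auto simp: span_Un)
      moreover have "X' \<union> A \<subseteq> C - {x}" using insert C(1) by blast
      ultimately have "x \<in> span (C - {x})" using span_mono by blast
      then show False using C(3) insert by (auto simp: dependent_def)
    qed
    then show ?case
      using insert span_base[of x "X' \<union> D"] by (auto simp: independent_insert)
  qed
  from this[of "C - A"] have ind: "independent ((C - A) \<union> D)" and disj: "(C - A) \<inter> D = {}"
    using finC by auto
  have "card ((C - A) \<union> D) \<le> dim X"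
    using independent_card_le_dim_of_finite(2)[OF ind _ assms(4,5)] C D U W by blast
  moreover have "card ((C - A) \<union> D) = card (C - A) + card D"
    using disj finC finD by (intro card_Un_disjoint) auto
  moreover have "card (C - A) = card C - card A" "card A \<le> card C"
    using C(1) finC by (auto intro: card_Diff_subset card_mono finite_subset)
  ultimately show ?thesis using cardC A(4) D(4) by linarith
qed

end

section \<open>Graded pieces of the polynomial ring and of an ideal with two generators\<close>

abbreviation forms :: "nat \<Rightarrow> tpoly set" where
  "forms n \<equiv> {f. is_form n f}"

lemma smult_tpoly_form: "is_form n f \<Longrightarrow> is_form n (smult_tpoly c f)"
  by (simp add: smult_tpoly_def is_form_const_mult)

lemma subspace_forms: "tpoly.subspace (forms n)"
  by (auto simp: tpoly.subspace_def is_form_add smult_tpoly_form)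

definition degree_monomials :: "nat \<Rightarrow> tpoly set" where
  "degree_monomials n = (\<lambda>m. Poly_Mapping.single m 1) ` {m. mdeg m = n}"

text \<open>The number is \<open>n + 2 choose 2\<close>; doubling avoids a division of naturals here
  and in \<open>dim_forms\<close>.\<close>

lemma card_exponents: "finite {m. mdeg m = n}" "2 * card {m. mdeg m = n} = (n + 1) * (n + 2)"
proof -
  let ?f = "\<lambda>m :: 3 \<Rightarrow>\<^sub>0 nat. (Poly_Mapping.lookup m 1, Poly_Mapping.lookup m 2)"
  let ?g = "\<lambda>(i, j). Poly_Mapping.single 1 i + Poly_Mapping.single 2 j + Poly_Mapping.single 3 (n - i - j) :: 3 \<Rightarrow>\<^sub>0 nat"
  let ?A = "SIGMA i:{..n}. {..n - i}"
  have mdeg: "mdeg m = Poly_Mapping.lookup m 1 + Poly_Mapping.lookup m 2 + Poly_Mapping.lookup m 3" for m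
    by (simp add: mdeg_def sum_3)
  have bij: "bij_betw ?f {m. mdeg m = n} ?A"
  proof (rule bij_betwI[where g = ?g])
    show "?f \<in> {m. mdeg m = n} \<rightarrow> ?A" by (auto simp: mdeg)
    show "?g \<in> ?A \<rightarrow> {m. mdeg m = n}" by (auto simp: mdeg lookup_add lookup_single)
    show "?g (?f m) = m" if "m \<in> {m. mdeg m = n}" for m
      using that by (intro poly_mapping_3_eqI) (auto simp: mdeg lookup_add lookup_single)
    show "?f (?g x) = x" if "x \<in> ?A" for x
      by (cases x) (simp add: lookup_add lookup_single)
  qed
  then show "finite {m. mdeg m = n}" using bij_betw_finite by fastforce
  have "card {m. mdeg m = n} = card ?A" using bij by (rule bij_betw_same_card)
  also have "\<dots> = (\<Sum>i\<le>n. Suc (n - i))" by simp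
  also have "\<dots> = (\<Sum>i\<le>n. Suc i)"
    by (rule sum.reindex_bij_witness[of _ "\<lambda>i. n - i" "\<lambda>i. n - i"]) auto
  also have "2 * \<dots> = (n + 1) * (n + 2)" by (induction n) auto
  finally show "2 * card {m. mdeg m = n} = (n + 1) * (n + 2)" .
qed

lemma finite_degree_monomials: "finite (degree_monomials n)"
  using card_exponents(1) by (simp add: degree_monomials_def)

lemma forms_subset_span: "forms n \<subseteq> tpoly.span (degree_monomials n)"
proof
  fix f assume "f \<in> forms n"
  then have "Poly_Mapping.single m (Poly_Mapping.lookup f m) \<in> tpoly.span (degree_monomials n)"
    if "m \<in> Poly_Mapping.keys f" for m
    using that tpoly.span_scale[OF tpoly.span_base[of "Poly_Mapping.single m 1" "degree_monomials n"], of "Poly_Mapping.lookup f m"]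
    by (auto simp: is_form_iff degree_monomials_def smult_tpoly_def const_def mult_single)
  then have "(\<Sum>m\<in>Poly_Mapping.keys f. Poly_Mapping.single m (Poly_Mapping.lookup f m)) \<in> tpoly.span (degree_monomials n)"
    by (rule tpoly.span_sum)
  then show "f \<in> tpoly.span (degree_monomials n)" by (simp add: tpoly_sum_single)
qed

lemma lookup_sum_degree_monomials:
  assumes "finite A" "m \<in> A"
  shows "Poly_Mapping.lookup (\<Sum>n\<in>A. smult_tpoly (u n) (Poly_Mapping.single n 1)) m = u m"
proof -
  have "smult_tpoly (u n) (Poly_Mapping.single n 1) = Poly_Mapping.single n (u n)" for n
    by (simp add: smult_tpoly_def const_def mult_single)
  then show ?thesis using assms by (simp add: lookup_sum lookup_single when_def)
qed

lemma independent_degree_monomials: "tpoly.independent (degree_monomials n)"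
proof (rule tpoly.independent_if_scalars_zero[OF finite_degree_monomials])
  fix u x assume sum: "(\<Sum>x\<in>degree_monomials n. smult_tpoly (u x) x) = 0" and "x \<in> degree_monomials n"
  then obtain m where m: "mdeg m = n" "x = Poly_Mapping.single m 1" by (auto simp: degree_monomials_def)
  have "inj_on (\<lambda>m. Poly_Mapping.single m (1::complex)) {m. mdeg m = n}"
    by (metis (no_types, lifting) inj_onI lookup_single_eq lookup_single_not_eq zero_neq_one)
  then have "(\<Sum>k\<in>{m. mdeg m = n}. smult_tpoly (u (Poly_Mapping.single k 1)) (Poly_Mapping.single k 1)) = 0"
    using sum by (simp add: degree_monomials_def sum.reindex)
  then show "u x = 0"
    using lookup_sum_degree_monomials[OF card_exponents(1), of m n "\<lambda>k. u (Poly_Mapping.single k 1)"] m by simp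
qed

lemma dim_forms: "2 * tpoly.dim (forms n) = (n + 1) * (n + 2)"
proof -
  have "degree_monomials n \<subseteq> forms n"
    by (auto simp: degree_monomials_def is_form_iff)
  then have "tpoly.dim (forms n) = card (degree_monomials n)"
    using tpoly.basis_card_eq_dim[OF _ forms_subset_span independent_degree_monomials] by simp
  also have "\<dots> = card {m. mdeg m = n}"
    unfolding degree_monomials_def
    by (rule card_image) (metis (no_types, lifting) inj_onI lookup_single_eq lookup_single_not_eq zero_neq_one)
  finally show ?thesis using card_exponents(2) by simp
qed

lemma dim_forms_mono: "V \<subseteq> W \<Longrightarrow> W \<subseteq> forms n \<Longrightarrow> tpoly.dim V \<le> tpoly.dim W"
  using tpoly.dim_mono_of_finite[OF _ _ finite_degree_monomials] forms_subset_span by (metis subset_trans)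

lemma subspace_forms_eq:
  "V \<subseteq> W \<Longrightarrow> W \<subseteq> forms n \<Longrightarrow> tpoly.subspace V \<Longrightarrow> tpoly.dim W \<le> tpoly.dim V \<Longrightarrow> V = W"
  using tpoly.subspace_eq_of_dim_ge[OF _ _ finite_degree_monomials] forms_subset_span by (metis subset_trans)

lemma dim_forms_sum_ge:
  assumes "tpoly.subspace U" "tpoly.subspace W" "\<And>u w. u \<in> U \<Longrightarrow> w \<in> W \<Longrightarrow> u + w \<in> X" "X \<subseteq> forms n"
  shows "tpoly.dim U + tpoly.dim W \<le> tpoly.dim X + tpoly.dim (U \<inter> W)"
  using tpoly.dim_sum_ge[OF assms(1-3) _ finite_degree_monomials] assms(4) forms_subset_span by blast

interpretation tpoly_pair: vector_space_pair smult_tpoly smult_tpoly ..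

lemma linear_mult: "Vector_Spaces.linear smult_tpoly smult_tpoly ((*) F)"
  unfolding Vector_Spaces.linear_iff
  using tpoly.vector_space_axioms by (simp add: distrib_left smult_tpoly_def mult.left_commute)

lemma subspace_mult: "tpoly.subspace V \<Longrightarrow> tpoly.subspace ((*) F ` V)"
  by (rule tpoly_pair.linear_subspace_image[OF linear_mult])

lemma dim_mult:
  assumes "F \<noteq> 0"
  shows "tpoly.dim ((*) F ` V) = tpoly.dim V"
proof -
  obtain A where A: "A \<subseteq> V" "tpoly.independent A" "V \<subseteq> tpoly.span A" "card A = tpoly.dim V"
    using tpoly.basis_exists by blast
  have inj: "inj ((*) F)" using assms by (auto simp: inj_def)
  show ?thesis
  proof (rule tpoly.dim_unique)
    show "(*) F ` A \<subseteq> (*) F ` V" using A(1) by blast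
    have "(*) F ` V \<subseteq> (*) F ` tpoly.span A" using A(3) by blast
    then show "(*) F ` V \<subseteq> tpoly.span ((*) F ` A)"
      by (simp add: tpoly_pair.linear_span_image[OF linear_mult])
    show "tpoly.independent ((*) F ` A)"
      using tpoly_pair.linear_independent_injective_image[OF linear_mult A(2), of F] inj_on_subset[OF inj]
      by blast
    show "card ((*) F ` A) = tpoly.dim V"
      using A(4) card_image[OF inj_on_subset[OF inj subset_UNIV], of A] by simp
  qed
qed

text \<open>The degree \<open>n\<close> piece of the ideal \<open>(F, G)\<close>. The cofactors are
  arbitrary polynomials, which keeps membership easy to prove; \<open>pencil_formsE\<close> turns
  them into forms.\<close>

definition pencil_forms :: "nat \<Rightarrow> tpoly \<Rightarrow> tpoly \<Rightarrow> tpoly set" where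
  "pencil_forms n F G = {f. is_form n f \<and> (\<exists>A B. f = A * F + B * G)}"

lemma pencil_formsE:
  assumes "f \<in> pencil_forms n F G" "is_form a F" "is_form b G"
  obtains A B where "f = A * F + B * G" "is_form (n - a) A" "is_form (n - b) B" "n < a \<Longrightarrow> A = 0" "n < b \<Longrightarrow> B = 0"
proof -
  obtain A B where f: "is_form n f" "f = A * F + B * G"
    using assms(1) by (auto simp: pencil_forms_def)
  have "f = hcomp n (A * F + B * G)" using f by (simp add: is_form_iff_hcomp)
  also have "\<dots> = (if n < a then 0 else hcomp (n - a) A) * F + (if n < b then 0 else hcomp (n - b) B) * G"
    by (simp add: hcomp_add hcomp_mult_form[OF assms(2)] hcomp_mult_form[OF assms(3)])
  finally have *: "f = (if n < a then 0 else hcomp (n - a) A) * F + (if n < b then 0 else hcomp (n - b) B) * G" .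
  show ?thesis by (rule that[OF *]) (simp_all add: is_form_hcomp)
qed

lemma subspace_pencil_forms: "tpoly.subspace (pencil_forms n F G)"
proof (rule tpoly.subspaceI)
  show "0 \<in> pencil_forms n F G"
    by (auto simp: pencil_forms_def intro!: exI[of _ 0])
next
  fix x y assume "x \<in> pencil_forms n F G" "y \<in> pencil_forms n F G"
  then obtain A B A' B' where "is_form n x" "x = A * F + B * G" "is_form n y" "y = A' * F + B' * G"
    by (auto simp: pencil_forms_def)
  then have "is_form n (x + y)" "x + y = (A + A') * F + (B + B') * G"
    by (simp_all only: is_form_add) (simp add: algebra_simps)
  then show "x + y \<in> pencil_forms n F G" unfolding pencil_forms_def by blast
next
  fix c x assume "x \<in> pencil_forms n F G"
  then obtain A B where "is_form n x" "x = A * F + B * G"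
    by (auto simp: pencil_forms_def)
  then have "is_form n (smult_tpoly c x)" "smult_tpoly c x = (const c * A) * F + (const c * B) * G"
    by (simp_all only: smult_tpoly_form) (simp add: smult_tpoly_def distrib_left mult.assoc)
  then show "smult_tpoly c x \<in> pencil_forms n F G" unfolding pencil_forms_def by blast
qed

text \<open>The count of the Koszul resolution. By coprimality the multiples of \<open>F\<close>
  meet those of \<open>G\<close> only in multiples of \<open>F * G\<close>, and for
  \<open>n \<ge> a + b\<close> the alternating sum of the four dimensions of forms is exactly
  \<open>a * b\<close>.\<close>

lemma dim_pencil_forms_ge:
  assumes F: "is_form a F" "F \<noteq> 0" and G: "is_form b G" "G \<noteq> 0" and cop: "no_common_factor {F, G}" and n: "n \<ge> a + b"
  shows "tpoly.dim (forms n) \<le> tpoly.dim (pencil_forms n F G) + a * b"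
proof -
  let ?U = "(*) F ` forms (n - a)" and ?W = "(*) G ` forms (n - b)"
  have "tpoly.dim ?U + tpoly.dim ?W \<le> tpoly.dim (pencil_forms n F G) + tpoly.dim (?U \<inter> ?W)"
  proof (rule dim_forms_sum_ge)
    show "pencil_forms n F G \<subseteq> forms n" by (auto simp: pencil_forms_def)
    fix u w assume "u \<in> ?U" "w \<in> ?W"
    then obtain A B where *: "is_form (n - a) A" "is_form (n - b) B" "u + w = A * F + B * G"
      by (auto simp: mult.commute)
    have "is_form n (A * F)" "is_form n (B * G)"
      using is_form_mult[OF *(1) F(1)] is_form_mult[OF *(2) G(1)] n by auto
    then show "u + w \<in> pencil_forms n F G"
      using * by (auto simp: pencil_forms_def is_form_add)
  qed (rule subspace_mult subspace_forms)+
  moreover have "?U \<inter> ?W \<subseteq> (*) (F * G) ` forms (n - a - b)"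
  proof
    fix f assume "f \<in> ?U \<inter> ?W"
    then obtain A B where A: "is_form (n - a) A" "f = F * A" and B: "is_form (n - b) B" "f = G * B" by blast
    then have "F dvd B * G" by (metis dvd_triv_left mult.commute)
    then have "F dvd B" using no_common_factor_pair_dvd[OF cop] by blast
    show "f \<in> (*) (F * G) ` forms (n - a - b)"
    proof (cases "B = 0")
      case True
      then show ?thesis using B by (auto intro!: image_eqI[of _ _ 0])
    next
      case False
      then obtain k q where "is_form k F" "is_form (n - b - k) q" "B = F * q"
        using is_form_dvd[OF B(1) _ \<open>F dvd B\<close>] by blast
      moreover from this have "k = a" using F is_form_deg_unique by blast
      ultimately show ?thesis using B by (auto intro!: image_eqI[of _ _ q] simp: mult_ac add.commute)
    qed
  qed
  then have "tpoly.dim (?U \<inter> ?W) \<le> tpoly.dim ((*) (F * G) ` forms (n - a - b))"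
  proof (rule dim_forms_mono)
    show "(*) (F * G) ` forms (n - a - b) \<subseteq> forms n"
      using is_form_mult[OF is_form_mult[OF F(1) G(1)], of "n - a - b"] n by auto
  qed
  ultimately have "tpoly.dim (forms (n - a)) + tpoly.dim (forms (n - b)) \<le>
      tpoly.dim (pencil_forms n F G) + tpoly.dim (forms (n - a - b))"
    using F G by (simp add: dim_mult)
  moreover obtain m where "n = a + b + m" using n le_Suc_ex by blast
  ultimately have "2 * tpoly.dim (forms (b + m)) + 2 * tpoly.dim (forms (a + m)) \<le>
      2 * tpoly.dim (pencil_forms n F G) + 2 * tpoly.dim (forms m)"
    by (simp add: add_ac)
  then have "(b + m + 1) * (b + m + 2) + (a + m + 1) * (a + m + 2) \<le>
      2 * tpoly.dim (pencil_forms n F G) + (m + 1) * (m + 2)"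
    by (simp only: dim_forms)
  moreover have "(n + 1) * (n + 2) + (m + 1) * (m + 2) = (b + m + 1) * (b + m + 2) + (a + m + 1) * (a + m + 2) + 2 * (a * b)"
    by (simp add: \<open>n = a + b + m\<close> algebra_simps)
  moreover have "N \<le> 2 * (D + e)" if "X \<le> 2 * D + W" "N + W = X + 2 * e" for N D e X W :: nat
    using that by simp
  ultimately have "2 * tpoly.dim (forms n) \<le> 2 * (tpoly.dim (pencil_forms n F G) + a * b)"
    unfolding dim_forms by blast
  then show ?thesis by simp
qed

section \<open>Points and their forms\<close>

definition rep :: "(complex ^ 3) set \<Rightarrow> complex ^ 3" where
  "rep p = (SOME v. v \<noteq> 0 \<and> p = vec.span {v})"

lemma rep:
  assumes "p \<in> proj_plane"
  shows "rep p \<noteq> 0" "p = vec.span {rep p}"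
proof -
  have "\<exists>v. v \<noteq> 0 \<and> p = vec.span {v}" using assms by (auto simp: proj_plane_def)
  from someI_ex[OF this] show "rep p \<noteq> 0" "p = vec.span {rep p}" by (auto simp: rep_def)
qed

lemma span_in_proj_plane: "v \<noteq> 0 \<Longrightarrow> vec.span {v} \<in> proj_plane"
  by (auto simp: proj_plane_def)

lemma rep_span:
  assumes "v \<noteq> 0"
  obtains c where "c \<noteq> 0" "rep (vec.span {v}) = c *s v"
proof -
  have "vec.span {v} = vec.span {rep (vec.span {v})}" and nz: "rep (vec.span {v}) \<noteq> 0"
    using rep[OF span_in_proj_plane[OF assms]] by auto
  then have "rep (vec.span {v}) \<in> vec.span {v}" using vec.span_base by blast
  then obtain c where "rep (vec.span {v}) = c *s v" by (auto simp: vec.span_singleton)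
  then show ?thesis using that[of c] nz by auto
qed

lemma vanishes_on_iff:
  assumes "is_form n f" "Z \<subseteq> proj_plane"
  shows "vanishes_on f Z \<longleftrightarrow> (\<forall>p\<in>Z. eval_tpoly f (rep p) = 0)"
proof
  assume "vanishes_on f Z"
  then show "\<forall>p\<in>Z. eval_tpoly f (rep p) = 0"
    using rep(2) assms(2) vec.span_base[of _ "{rep _}"] unfolding vanishes_on_def
    by (metis insertI1 subsetD)
next
  assume *: "\<forall>p\<in>Z. eval_tpoly f (rep p) = 0"
  show "vanishes_on f Z"
    unfolding vanishes_on_def
  proof (intro ballI)
    fix p v assume p: "p \<in> Z" "v \<in> p"
    then have "v \<in> vec.span {rep p}" using rep(2) assms(2) by blast
    then obtain c where "v = c *s rep p" by (auto simp: vec.span_singleton)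
    then show "eval_tpoly f v = 0" using eval_form_scale[OF assms(1)] * p by simp
  qed
qed

lemma eval_rep_span:
  assumes "is_form n f" "v \<noteq> 0"
  shows "eval_tpoly f (rep (vec.span {v})) = 0 \<longleftrightarrow> eval_tpoly f v = 0"
proof -
  obtain c where "c \<noteq> 0" "rep (vec.span {v}) = c *s v" using rep_span[OF assms(2)] .
  then show ?thesis by (simp add: eval_form_scale[OF assms(1)])
qed

lemma vanishes_on_insert: "vanishes_on f (insert p Z) \<longleftrightarrow> vanishes_on f {p} \<and> vanishes_on f Z"
  by (auto simp: vanishes_on_def)

lemma vanishes_on_subset: "vanishes_on f Z \<Longrightarrow> S \<subseteq> Z \<Longrightarrow> vanishes_on f S"
  by (auto simp: vanishes_on_def)

lemma separating_line:
  assumes "p \<in> proj_plane" "q \<in> proj_plane" "p \<noteq> q"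
  shows "\<exists>l. is_form 1 l \<and> eval_tpoly l (rep q) = 0 \<and> eval_tpoly l (rep p) \<noteq> 0"
proof -
  \<comment> \<open>If all \<open>2 \<times> 2\<close> minors of the two representatives vanished,
    the representatives would be proportional and the points equal.\<close>
  obtain i j where ij: "rep q $ i * rep p $ j \<noteq> rep q $ j * rep p $ i"
  proof (rule ccontr)
    assume "\<not> thesis"
    then have eq: "rep q $ i * rep p $ j = rep q $ j * rep p $ i" for i j using that by blast
    obtain k where k: "rep q $ k \<noteq> 0" using rep(1)[OF assms(2)] by (auto simp: vec_eq_iff)
    let ?c = "rep p $ k / rep q $ k"
    have *: "rep p = ?c *s rep q"
    proof (rule vec_eq_iff[THEN iffD2], rule allI)
      fix j
      have "rep q $ k * rep p $ j = rep q $ j * rep p $ k" by (rule eq)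
      then show "rep p $ j = (?c *s rep q) $ j" using k by (simp add: field_simps)
    qed
    then have c: "?c \<noteq> 0" using rep(1)[OF assms(1)] by (metis vector_smult_lzero)
    have "vec.span {?c *s rep q} = vec.span {rep q}"
      using vec.span_image_scale[of "{rep q}" "\<lambda>_. ?c"] c by simp
    then show False using rep(2)[OF assms(1)] rep(2)[OF assms(2)] * assms(3) by metis
  qed
  let ?l = "const (rep q $ i) * var j - const (rep q $ j) * var i"
  have "is_form 1 ?l" by (intro is_form_diff is_form_const_mult) simp_all
  then show ?thesis using ij by (intro exI[of _ ?l]) (auto simp: mult.commute)
qed

text \<open>A product of lines, one through each point of \<open>Z\<close> and all missing
  \<open>p\<close>, filled up to degree \<open>n\<close> with a power of a variable that is nonzero
  at \<open>p\<close>.\<close>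

lemma separating_form:
  assumes "finite Z" "Z \<subseteq> proj_plane" "p \<in> proj_plane" "p \<notin> Z" "n \<ge> card Z"
  shows "\<exists>f. is_form n f \<and> vanishes_on f Z \<and> eval_tpoly f (rep p) \<noteq> 0"
proof -
  have "\<forall>q\<in>Z. \<exists>l. is_form 1 l \<and> eval_tpoly l (rep q) = 0 \<and> eval_tpoly l (rep p) \<noteq> 0"
    using separating_line assms by blast
  then obtain l where l: "\<And>q. q \<in> Z \<Longrightarrow> is_form 1 (l q)" "\<And>q. q \<in> Z \<Longrightarrow> eval_tpoly (l q) (rep q) = 0"
    "\<And>q. q \<in> Z \<Longrightarrow> eval_tpoly (l q) (rep p) \<noteq> 0" by metis
  obtain i where i: "rep p $ i \<noteq> 0" using rep(1)[OF assms(3)] by (auto simp: vec_eq_iff)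
  have prod: "is_form (card S) (\<Prod>q\<in>S. l q) \<and> eval_tpoly (\<Prod>q\<in>S. l q) v = (\<Prod>q\<in>S. eval_tpoly (l q) v)"
    if "finite S" "S \<subseteq> Z" for S v
    using that
  proof induction
    case (insert q S)
    then show ?case using is_form_mult[OF l(1), of q "card S"] by auto
  qed simp
  let ?f = "(\<Prod>q\<in>Z. l q) * var i ^ (n - card Z)"
  have "is_form n ?f"
    using is_form_mult[OF conjunct1[OF prod[OF assms(1) order.refl]] is_form_power[OF is_form_var, of "n - card Z" i]] assms(5)
    by simp
  moreover have "eval_tpoly ?f v = (\<Prod>q\<in>Z. eval_tpoly (l q) v) * v $ i ^ (n - card Z)" for v
    using prod[OF assms(1)] by simp
  moreover have "(\<Prod>q\<in>Z. eval_tpoly (l q) (rep r)) = 0" if "r \<in> Z" for r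
    using that l(2) assms(1) by (intro prod_zero) auto
  moreover have "(\<Prod>q\<in>Z. eval_tpoly (l q) (rep p)) \<noteq> 0"
    using l(3) assms(1) by simp
  ultimately have "vanishes_on ?f Z" "eval_tpoly ?f (rep p) \<noteq> 0"
    using i by (simp_all only: vanishes_on_iff[OF \<open>is_form n ?f\<close> assms(2)]) simp_all
  then show ?thesis using \<open>is_form n ?f\<close> by blast
qed

section \<open>Conditions imposed by points, and Bezout's bound\<close>

definition forms_through :: "nat \<Rightarrow> (complex ^ 3) set set \<Rightarrow> tpoly set" where
  "forms_through n Z = {f. is_form n f \<and> vanishes_on f Z}"

lemma subspace_forms_through: "tpoly.subspace (forms_through n Z)"
  by (auto simp: tpoly.subspace_def forms_through_def vanishes_on_def is_form_add smult_tpoly_form)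
    (simp add: smult_tpoly_def)

text \<open>In degree at least \<open>card Z\<close> the points impose independent conditions: a
  separating form shows that each new point makes the space strictly smaller.\<close>

lemma dim_forms_through_le:
  assumes "finite Z" "Z \<subseteq> proj_plane" "n \<ge> card Z"
  shows "tpoly.dim (forms_through n Z) + card Z \<le> tpoly.dim (forms n)"
  using assms
proof (induction Z)
  case empty
  have "forms_through n {} = forms n" by (auto simp: forms_through_def vanishes_on_def)
  then show ?case by simp
next
  case (insert p Z)
  obtain f where f: "is_form n f" "vanishes_on f Z" "eval_tpoly f (rep p) \<noteq> 0"
    using separating_form[of Z p n] insert by auto
  have sub: "forms_through n (insert p Z) \<subseteq> forms_through n Z" "forms_through n Z \<subseteq> forms n"
    by (auto simp: forms_through_def vanishes_on_def)
  have "forms_through n (insert p Z) \<noteq> forms_through n Z"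
    using f vanishes_on_iff[OF f(1), of "insert p Z"] insert by (auto simp: forms_through_def)
  then have "tpoly.dim (forms_through n (insert p Z)) < tpoly.dim (forms_through n Z)"
    using subspace_forms_eq[OF sub subspace_forms_through] by linarith
  then show ?case using insert by simp
qed

lemma pencil_forms_subset_through:
  assumes "vanishes_on F S" "vanishes_on G S"
  shows "pencil_forms n F G \<subseteq> forms_through n S"
  using assms by (auto simp: pencil_forms_def forms_through_def vanishes_on_def)

text \<open>In the degree \<open>n\<close> chosen here both counts are valid: the ideal
  \<open>(F, G)\<close> has codimension at most \<open>a * b\<close>, while the larger space of
  forms through \<open>S\<close> has codimension at least \<open>card S\<close>.\<close>

lemma Bezout_bound:
  assumes "is_form a F" "F \<noteq> 0" "is_form b G" "G \<noteq> 0" "no_common_factor {F, G}"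
    and "finite S" "S \<subseteq> proj_plane" "vanishes_on F S" "vanishes_on G S"
  shows "card S \<le> a * b"
proof -
  define n where "n = a + b + card S"
  have "tpoly.dim (pencil_forms n F G) \<le> tpoly.dim (forms_through n S)"
    using pencil_forms_subset_through[OF assms(8,9)] by (rule dim_forms_mono[where n = n]) (auto simp: forms_through_def)
  moreover have "tpoly.dim (forms_through n S) + card S \<le> tpoly.dim (forms n)"
    using assms by (intro dim_forms_through_le) (simp_all add: n_def)
  moreover have "tpoly.dim (forms n) \<le> tpoly.dim (pencil_forms n F G) + a * b"
    using assms by (intro dim_pencil_forms_ge) (simp_all add: n_def)
  ultimately show ?thesis by linarith
qed

text \<open>The extreme case of \<open>Bezout_bound\<close>: with \<open>a * b\<close> points the
  two codimensions squeeze the nested spaces together.\<close>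

lemma forms_through_complete_intersection_large_degree:
  assumes "is_form a F" "F \<noteq> 0" "is_form b G" "G \<noteq> 0" "no_common_factor {F, G}"
    and "finite S" "S \<subseteq> proj_plane" "vanishes_on F S" "vanishes_on G S" "card S = a * b"
    and "n \<ge> a + b + card S"
  shows "pencil_forms n F G = forms_through n S"
proof (rule subspace_forms_eq)
  show "pencil_forms n F G \<subseteq> forms_through n S" using assms by (intro pencil_forms_subset_through)
  show "forms_through n S \<subseteq> forms n" by (auto simp: forms_through_def)
  have "tpoly.dim (forms_through n S) + card S \<le> tpoly.dim (forms n)"
    using assms by (intro dim_forms_through_le) simp_all
  moreover have "tpoly.dim (forms n) \<le> tpoly.dim (pencil_forms n F G) + a * b"
    using assms by (intro dim_pencil_forms_ge) simp_all
  ultimately show "tpoly.dim (forms_through n S) \<le> tpoly.dim (pencil_forms n F G)" using assms by linarith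
qed (rule subspace_pencil_forms)

section \<open>Restriction to a line\<close>

text \<open>A factor of a linear form is a constant or a constant multiple of that form. In the
  second case it vanishes at \<open>v\<close>, so it cannot divide \<open>m\<close>.\<close>

lemma linear_forms_no_common_factor:
  assumes "is_form 1 l" "l \<noteq> 0" "eval_tpoly l v = 0" "eval_tpoly m v \<noteq> 0"
  shows "no_common_factor {l, m}"
  unfolding no_common_factor_def
proof (intro allI impI)
  fix q assume q: "\<forall>a\<in>{l, m}. q dvd a"
  then obtain k r where k: "k \<le> 1" "is_form k q" "is_form (1 - k) r" "l = q * r"
    using is_form_dvd[OF assms(1,2), of q] by (metis insertI1)
  show "q dvd 1"
  proof (cases "k = 0")
    case True
    then show ?thesis using is_form_0_const[of q] k assms(2) const_dvd_1 by fastforce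
  next
    case False
    then have "is_form 0 r" using k by simp
    then obtain c where c: "r = const c" using is_form_0_const by blast
    with k(4) assms(2) have "c \<noteq> 0" by auto
    with assms(3) k(4) c have "eval_tpoly q v = 0" by simp
    moreover obtain s where "m = q * s" using q by (auto elim: dvdE)
    ultimately show ?thesis using assms(4) by simp
  qed
qed

lemma no_common_factor_vars:
  assumes "i \<noteq> j"
  shows "no_common_factor {var i, var j}"
proof (rule linear_forms_no_common_factor)
  let ?v = "\<chi> k. if k = j then 1 else (0 :: complex)"
  show "eval_tpoly (var i) ?v = 0" "eval_tpoly (var j) ?v \<noteq> 0" using assms by simp_all
  have "eval_tpoly (var i) (\<chi> k. 1) = 1" by simp
  then show "var i \<noteq> 0" by force
qed simp

text \<open>At a fixed point this is a nonzero polynomial in \<open>t\<close>, so finitely many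
  values of \<open>t\<close> are bad for finitely many points. The coefficient of
  \<open>var 1\<close> is always 1, which lets restriction eliminate \<open>x\<^sub>1\<close>;
  \<open>t = 0\<close> gives the coordinate line \<open>x\<^sub>1 = 0\<close>.\<close>

definition generic_line :: "complex \<Rightarrow> tpoly" where
  "generic_line t = var 1 + const t * var 2 + const (t ^ 2) * var 3"

text \<open>Restriction to \<open>generic_line t = 0\<close>, with \<open>x\<^sub>2\<close> and \<open>x\<^sub>3\<close> as coordinates on that line.\<close>

definition restrict_line :: "complex \<Rightarrow> tpoly \<Rightarrow> tpoly" where
  "restrict_line t = ev const (\<lambda>i. if i = 1 then - (const t * var 2 + const (t ^ 2) * var 3) else var i)"

lemmas restrict_line_simps =
  subst.ev_simps[of "\<lambda>i. if i = 1 then - (const t * var 2 + const (t ^ 2) * var 3) else var i" for t,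
    folded restrict_line_def]

lemma is_form_generic_line: "is_form 1 (generic_line t)"
  unfolding generic_line_def by (intro is_form_add is_form_const_mult is_form_var)

lemma generic_line_neq_0: "generic_line t \<noteq> 0"
proof
  assume "generic_line t = 0"
  then have "eval_tpoly (generic_line t) (\<chi> i. if i = 1 then 1 else 0) = 0" by simp
  then show False by (simp add: generic_line_def)
qed

lemma restrict_line_generic_line: "restrict_line t (generic_line t) = 0"
  by (simp add: generic_line_def restrict_line_simps)

lemma is_form_restrict_line: "is_form n f \<Longrightarrow> is_form n (restrict_line t f)"
  unfolding restrict_line_def
  by (rule is_form_subst) (auto intro!: is_form_minus is_form_diff is_form_const_mult)

lemma generic_line_dvd: "generic_line t dvd f - restrict_line t f"
  unfolding restrict_line_def
  by (rule subst_cong_dvd) (simp add: generic_line_def add.assoc del: minus_add_distrib)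

lemma restrict_line_decomp: obtains g where "f = restrict_line t f + generic_line t * g"
  using generic_line_dvd[of t f] by (metis add_diff_cancel_left' diff_add_cancel dvdE add.commute)

lemma eval_restrict_line: "eval_tpoly (restrict_line t f) v =
    eval_tpoly f (\<chi> i. if i = 1 then - (t * v $ 2 + t ^ 2 * v $ 3) else v $ i)"
  unfolding restrict_line_def eval_subst
  by (rule arg_cong[where f = "eval_tpoly f"]) (simp add: vec_eq_iff)

lemma generic_line_avoids:
  assumes "finite S" "S \<subseteq> proj_plane"
  shows "\<exists>t. \<forall>p\<in>S. eval_tpoly (generic_line t) (rep p) \<noteq> 0"
proof -
  have "finite {t. eval_tpoly (generic_line t) (rep p) = 0}" if "p \<in> S" for p
  proof -
    let ?P = "[:rep p $ 1, rep p $ 2, rep p $ 3:]"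
    have "rep p \<noteq> 0" using rep(1) that assms(2) by blast
    then have "rep p $ 1 \<noteq> 0 \<or> rep p $ 2 \<noteq> 0 \<or> rep p $ 3 \<noteq> 0"
      unfolding vec_eq_iff forall_3 by simp
    then have "?P \<noteq> 0" by auto
    moreover have "poly ?P t = eval_tpoly (generic_line t) (rep p)" for t
      by (simp add: generic_line_def power2_eq_square algebra_simps)
    ultimately show ?thesis using poly_roots_finite[of ?P] by simp
  qed
  then have "finite (\<Union>p\<in>S. {t. eval_tpoly (generic_line t) (rep p) = 0})" using assms(1) by blast
  then obtain t where "t \<notin> (\<Union>p\<in>S. {t. eval_tpoly (generic_line t) (rep p) = 0})"
    using ex_new_if_finite[OF infinite_UNIV_char_0] by blast
  then show ?thesis by blast
qed

interpretation pCons_hom: coeff_hom "\<lambda>c. [:c:]"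
  by unfold_locales (simp_all add: one_pCons)

lemma poly_ev_pCons: "poly (ev (\<lambda>c. [:c:]) x f) z = eval_tpoly f (\<chi> i. poly (x i) z)"
  by (induction f rule: tpoly_ring_induct) (simp_all add: pCons_hom.ev_simps)

text \<open>On \<open>x\<^sub>1 = 0\<close> this is a binary form. \<open>P\<close> is its
  polynomial in the chart \<open>x\<^sub>2 = 1\<close> and has a root unless it is constant. A
  constant \<open>P\<close> means that the form is \<open>c * x\<^sub>2 ^ k\<close> on this line,
  which \<open>Q\<close>, from the chart \<open>x\<^sub>3 = 1\<close>, shows to vanish at
  \<open>(0, 0, 1)\<close>.\<close>

lemma form_zero_on_line:
  assumes p: "is_form k p" and k: "k \<ge> 1"
  shows "\<exists>v. v \<noteq> 0 \<and> v $ 1 = 0 \<and> eval_tpoly p v = 0"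
proof -
  let ?pt = "\<lambda>x y. \<chi> i :: 3. if i = 1 then 0 else if i = 2 then x else (y :: complex)"
  define P where "P = ev (\<lambda>c. [:c:]) (\<lambda>i :: 3. if i = 1 then 0 else if i = 2 then 1 else [:0, 1:]) p"
  define Q where "Q = ev (\<lambda>c. [:c:]) (\<lambda>i :: 3. if i = 1 then 0 else if i = 2 then [:0, 1:] else 1) p"
  have P: "poly P z = eval_tpoly p (?pt 1 z)" for z
    unfolding P_def poly_ev_pCons by (rule arg_cong[where f = "eval_tpoly p"]) (simp add: vec_eq_iff)
  have Q: "poly Q z = eval_tpoly p (?pt z 1)" for z
    unfolding Q_def poly_ev_pCons by (rule arg_cong[where f = "eval_tpoly p"]) (simp add: vec_eq_iff)
  show ?thesis
  proof (cases "constant (poly P)")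
    case False
    then obtain z where "poly P z = 0" using fundamental_theorem_of_algebra by blast
    moreover have "?pt 1 z \<noteq> 0" by (simp add: vec_eq_iff exI[of _ 2])
    ultimately show ?thesis using P by (intro exI[of _ "?pt 1 z"]) simp
  next
    case True
    define c where "c = poly P 0"
    have c: "poly P z = c" for z using True unfolding c_def constant_def by blast
    have "poly (Q - monom c k) s = 0" if "s \<noteq> 0" for s
    proof -
      have eq: "?pt s 1 = s *s ?pt 1 (1 / s)" using that by (simp add: vec_eq_iff)
      have "poly Q s = s ^ k * c"
        unfolding Q eq eval_form_scale[OF p] using P[of "1 / s"] c by simp
      then show ?thesis by (simp add: poly_monom mult.commute)
    qed
    then have "UNIV - {0} \<subseteq> {s. poly (Q - monom c k) s = 0}" by blast
    moreover have "infinite (UNIV - {0 :: complex})" by (simp add: infinite_UNIV_char_0)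
    ultimately have "Q - monom c k = 0" using poly_roots_finite finite_subset by blast
    then have "poly Q 0 = 0" using k by (simp add: poly_monom)
    moreover have "?pt 0 1 \<noteq> 0" by (simp add: vec_eq_iff exI[of _ 3])
    ultimately show ?thesis using Q by (intro exI[of _ "?pt 0 1"]) simp
  qed
qed

text \<open>A common factor of positive degree would have a zero with \<open>x\<^sub>1 = 0\<close>.
  This zero corresponds to a point of the generic line at which all of \<open>A\<close>
  vanishes.\<close>

lemma no_common_factor_restrict_line:
  assumes forms: "\<And>f. f \<in> A \<Longrightarrow> \<exists>n. is_form n f"
    and zero: "\<And>v. v \<noteq> 0 \<Longrightarrow> eval_tpoly (generic_line t) v = 0 \<Longrightarrow> \<exists>f\<in>A. eval_tpoly f v \<noteq> 0"
  shows "no_common_factor (restrict_line t ` A)"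
  unfolding no_common_factor_def
proof (intro allI impI)
  fix q assume q: "\<forall>a\<in>restrict_line t ` A. q dvd a"
  have common: False if "v \<noteq> 0" "v $ 1 = 0" "\<And>f. f \<in> A \<Longrightarrow> eval_tpoly (restrict_line t f) v = 0" for v
  proof -
    \<comment> \<open>The point of the generic line whose last two coordinates are those of
      \<open>v\<close>.\<close>
    let ?w = "\<chi> i. if i = 1 then - (t * v $ 2 + t ^ 2 * v $ 3) else v $ i"
    have "v $ 2 \<noteq> 0 \<or> v $ 3 \<noteq> 0" using that(1,2) unfolding vec_eq_iff forall_3 by simp
    then have "?w \<noteq> 0" unfolding vec_eq_iff forall_3 by simp
    moreover have "eval_tpoly (generic_line t) ?w = 0" by (simp add: generic_line_def)
    ultimately obtain f where "f \<in> A" "eval_tpoly f ?w \<noteq> 0" using zero by blast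
    then show False using that(3)[of f] by (simp add: eval_restrict_line)
  qed
  have "\<exists>f\<in>A. restrict_line t f \<noteq> 0"
  proof (rule ccontr)
    assume "\<not> ?thesis"
    then have "eval_tpoly (restrict_line t f) (\<chi> i. if i = 2 then 1 else 0) = 0" if "f \<in> A" for f
      using that by simp
    moreover have "(\<chi> i. if i = 2 then 1 else (0 :: complex)) \<noteq> (0 :: complex ^ 3)"
      by (simp add: vec_eq_iff exI[of _ 2])
    ultimately show False by (intro common[of "\<chi> i. if i = 2 then 1 else 0"]) simp_all
  qed
  then obtain f n where f: "f \<in> A" "restrict_line t f \<noteq> 0" "is_form n f" using forms by blast
  moreover have "q dvd restrict_line t f" using q f by blast
  ultimately obtain k r where k: "is_form k q" "restrict_line t f = q * r"
    using is_form_dvd[OF is_form_restrict_line] by metis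
  show "q dvd 1"
  proof (cases "k = 0")
    case True
    then show ?thesis using is_form_0_const[of q] k f const_dvd_1 by fastforce
  next
    case False
    then obtain v where v: "v \<noteq> 0" "v $ 1 = 0" "eval_tpoly q v = 0"
      using form_zero_on_line[OF k(1)] by auto
    have "eval_tpoly (restrict_line t g) v = 0" if "g \<in> A" for g
    proof -
      have "q dvd restrict_line t g" using q that by blast
      then obtain s where "restrict_line t g = q * s" by (elim dvdE)
      then show ?thesis using v(3) by simp
    qed
    then show ?thesis using common v by blast
  qed
qed

text \<open>A syzygy of the restrictions is a Koszul syzygy, which lifts.\<close>

lemma generic_line_cancel_pencil:
  assumes cop: "no_common_factor {restrict_line t F, restrict_line t G}" and F: "restrict_line t F \<noteq> 0"
    and eq: "generic_line t * P = A * F + B * G"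
  shows "\<exists>A' B'. P = A' * F + B' * G"
proof -
  let ?l = "generic_line t"
  obtain A2 where A2: "A = restrict_line t A + ?l * A2" using restrict_line_decomp .
  obtain B2 where B2: "B = restrict_line t B + ?l * B2" using restrict_line_decomp .
  obtain F2 where F2: "F = restrict_line t F + ?l * F2" using restrict_line_decomp .
  obtain G2 where G2: "G = restrict_line t G + ?l * G2" using restrict_line_decomp .
  have "restrict_line t (?l * P) = restrict_line t (A * F + B * G)" using eq by simp
  then have syz: "restrict_line t A * restrict_line t F + restrict_line t B * restrict_line t G = 0"
    by (simp add: restrict_line_simps restrict_line_generic_line)
  then have "restrict_line t B * restrict_line t G = restrict_line t F * (- restrict_line t A)"
    by (simp add: eq_neg_iff_add_eq_0 mult.commute add.commute)
  then have "restrict_line t F dvd restrict_line t B * restrict_line t G" by simp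
  then have "restrict_line t F dvd restrict_line t B" using no_common_factor_pair_dvd[OF cop] by blast
  then obtain E where E: "restrict_line t B = restrict_line t F * E" by (elim dvdE)
  have "restrict_line t F * (restrict_line t A + E * restrict_line t G) = 0"
    using syz unfolding E by (simp add: algebra_simps)
  then have "restrict_line t A = - (E * restrict_line t G)"
    using F by (simp add: add_eq_0_iff2)
  then have A: "A = - (E * (G - ?l * G2)) + ?l * A2" using A2 G2 by (metis add_diff_cancel_right')
  have B: "B = (F - ?l * F2) * E + ?l * B2" using B2 E F2 by (metis add_diff_cancel_right')
  have "?l * P = ?l * ((E * G2 + A2) * F + (B2 - F2 * E) * G)"
    unfolding eq A B by (simp add: algebra_simps)
  then have "P = (E * G2 + A2) * F + (B2 - F2 * E) * G"
    using generic_line_neq_0[of t] by simp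
  then show ?thesis by blast
qed

lemma restrict_line_neq_0:
  assumes "no_common_factor {restrict_line t F, restrict_line t G}" "is_form b G" "b \<ge> 1"
  shows "restrict_line t F \<noteq> 0"
proof
  assume 0: "restrict_line t F = 0"
  then have "restrict_line t G dvd 1" using assms(1) by (auto simp: no_common_factor_def)
  then obtain c where c: "c \<noteq> 0" "restrict_line t G = const c" using dvd_1_iff_const by blast
  then have "is_form b (const c)" "const c \<noteq> 0" using is_form_restrict_line[OF assms(2), of t] by simp_all
  then show False using is_form_deg_unique[OF is_form_const] assms(3) by fastforce
qed

text \<open>\<open>S\<close> already exhausts Bezout's bound, so \<open>F\<close> and
  \<open>G\<close> have no further common zero, and in particular none on a line that misses
  \<open>S\<close>.\<close>

lemma complete_intersection_restrict_line:
  assumes F: "is_form a F" "F \<noteq> 0" and G: "is_form b G" "G \<noteq> 0" and cop: "no_common_factor {F, G}"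
    and S: "S \<subseteq> proj_plane" "finite S" "card S = a * b" "vanishes_on F S" "vanishes_on G S"
    and t: "\<forall>p\<in>S. eval_tpoly (generic_line t) (rep p) \<noteq> 0"
  shows "no_common_factor {restrict_line t F, restrict_line t G}"
proof -
  have "\<exists>f\<in>{F, G}. eval_tpoly f v \<noteq> 0" if v: "v \<noteq> 0" "eval_tpoly (generic_line t) v = 0" for v
  proof (rule ccontr)
    assume "\<not> ?thesis"
    then have FG: "eval_tpoly F v = 0" "eval_tpoly G v = 0" by auto
    let ?p = "vec.span {v}"
    have p: "?p \<in> proj_plane" using v(1) by (rule span_in_proj_plane)
    have "vanishes_on F {?p}" "vanishes_on G {?p}"
      using vanishes_on_iff[OF F(1)] vanishes_on_iff[OF G(1)] eval_rep_span[OF F(1) v(1)] eval_rep_span[OF G(1) v(1)] FG p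
      by auto
    then have "vanishes_on F (insert ?p S)" "vanishes_on G (insert ?p S)"
      using S vanishes_on_insert by blast+
    then have "card (insert ?p S) \<le> a * b"
      using Bezout_bound[OF F G cop] S p by blast
    moreover have "?p \<notin> S"
      using t eval_rep_span[OF is_form_generic_line v(1)] v(2) by blast
    ultimately show False using S by simp
  qed
  then have "no_common_factor (restrict_line t ` {F, G})"
    using F G by (intro no_common_factor_restrict_line) blast+
  then show ?thesis by simp
qed

text \<open>Multiplying by a high power of a line that misses \<open>S\<close> moves
  \<open>f\<close> to a degree where the ideal and the forms through \<open>S\<close> agree. The
  factors of the line are then cancelled one at a time.\<close>

lemma Noether_AF_BG:
  assumes F: "is_form a F" "F \<noteq> 0" "a \<ge> 1" and G: "is_form b G" "G \<noteq> 0" "b \<ge> 1" and cop: "no_common_factor {F, G}"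
    and S: "S \<subseteq> proj_plane" "finite S" "card S = a * b" "vanishes_on F S" "vanishes_on G S"
    and f: "is_form n f" "vanishes_on f S"
  shows "\<exists>A B. f = A * F + B * G"
proof -
  obtain t where t: "\<forall>p\<in>S. eval_tpoly (generic_line t) (rep p) \<noteq> 0"
    using generic_line_avoids S by blast
  let ?l = "generic_line t"
  have rcop: "no_common_factor {restrict_line t F, restrict_line t G}"
    using complete_intersection_restrict_line F G cop S t by blast
  have rF: "restrict_line t F \<noteq> 0" using restrict_line_neq_0[OF rcop G(1,3)] .
  define N where "N = a + b + card S"
  have "is_form (N + n) (?l ^ N * f)"
    using is_form_mult[OF is_form_power[OF is_form_generic_line] f(1), of N t] by simp
  moreover have "vanishes_on (?l ^ N * f) S"
    using f(2) by (auto simp: vanishes_on_def)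
  ultimately have "?l ^ N * f \<in> forms_through (N + n) S" by (simp add: forms_through_def)
  then have "?l ^ N * f \<in> pencil_forms (N + n) F G"
    using forms_through_complete_intersection_large_degree[OF F(1,2) G(1,2) cop S(2,1,4,5,3)] N_def
    by (metis le_add1)
  then have "\<exists>A B. ?l ^ N * f = A * F + B * G" by (auto simp: pencil_forms_def)
  then show ?thesis
  proof (induction N)
    case (Suc N)
    then obtain A B where "?l * (?l ^ N * f) = A * F + B * G" by (auto simp: mult.assoc)
    from generic_line_cancel_pencil[OF rcop rF this] show ?case using Suc.IH by blast
  qed simp
qed

section \<open>Ideals and schemes\<close>

lemma dehomogenize_ev: "dehomogenize i f = ev const (\<lambda>j. if j = i then 1 else var j) f"
proof -
  have "monomial (\<lambda>j. if j = i then 1 else var j) m = monomial var (Poly_Mapping.update i 0 m)" for m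
    unfolding monomial_def by (rule prod.cong) (auto simp: lookup_update)
  then show ?thesis
    by (simp add: dehomogenize_def ev_def single_eq_const_monomial)
qed

lemmas dehomogenize_simps = subst.ev_simps[of "\<lambda>j. if j = i then 1 else var j" for i, folded dehomogenize_ev]

lemma eval_dehomogenize: "eval_tpoly (dehomogenize i f) v = eval_tpoly f (\<chi> j. if j = i then 1 else v $ j)"
  unfolding dehomogenize_ev eval_subst
  by (rule arg_cong[where f = "eval_tpoly f"]) (simp add: vec_eq_iff)

lemma eval_dehomogenize_chart: "w $ i = 1 \<Longrightarrow> eval_tpoly (dehomogenize i f) w = eval_tpoly f w"
  unfolding eval_dehomogenize by (rule arg_cong[where f = "eval_tpoly f"]) (simp add: vec_eq_iff)

lemma update_inj_on_degree:
  assumes "Poly_Mapping.update i 0 m = Poly_Mapping.update i 0 m'" "mdeg m = mdeg m'"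
  shows "m = m'"
proof -
  have *: "Poly_Mapping.lookup m j = Poly_Mapping.lookup m' j" if "j \<noteq> i" for j
    using arg_cong[OF assms(1), of "\<lambda>u. Poly_Mapping.lookup u j"] that by (simp add: lookup_update)
  have "mdeg u = Poly_Mapping.lookup u i + (\<Sum>j\<in>UNIV - {i}. Poly_Mapping.lookup u j)" for u
    unfolding mdeg_def by (rule sum.remove) simp_all
  moreover have "(\<Sum>j\<in>UNIV - {i}. Poly_Mapping.lookup m j) = (\<Sum>j\<in>UNIV - {i}. Poly_Mapping.lookup m' j)"
    by (rule sum.cong) (auto simp: *)
  ultimately have "Poly_Mapping.lookup m i = Poly_Mapping.lookup m' i" using assms(2) by simp
  then show ?thesis using * by (metis poly_mapping_eqI)
qed

text \<open>Setting \<open>x\<^sub>i = 1\<close> keeps distinct monomials of equal degree distinct,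
  because the degree recovers the lost exponent.\<close>

lemma dehomogenize_eq_0:
  assumes "is_form n f" "dehomogenize i f = 0"
  shows "f = 0"
proof (rule ccontr)
  assume "f \<noteq> 0"
  then obtain m where m: "m \<in> Poly_Mapping.keys f" by (metis poly_mapping_eqI in_keys_iff lookup_zero)
  have "Poly_Mapping.lookup (dehomogenize i f) (Poly_Mapping.update i 0 m) =
    (\<Sum>k\<in>Poly_Mapping.keys f. if k = m then Poly_Mapping.lookup f m else 0)"
    unfolding dehomogenize_def lookup_sum
  proof (rule sum.cong)
    fix k assume "k \<in> Poly_Mapping.keys f"
    then have "mdeg k = mdeg m" using m assms(1) by (auto simp: is_form_iff)
    then show "Poly_Mapping.lookup (Poly_Mapping.single (Poly_Mapping.update i 0 k) (Poly_Mapping.lookup f k))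
      (Poly_Mapping.update i 0 m) = (if k = m then Poly_Mapping.lookup f m else 0)"
      using update_inj_on_degree[of i k m] by (auto simp: lookup_single when_def)
  qed simp
  then show False using m assms(2) by (auto simp: in_keys_iff)
qed

definition ideal3 :: "tpoly \<Rightarrow> tpoly \<Rightarrow> tpoly \<Rightarrow> tpoly set" where
  "ideal3 M1 M2 M3 = {A1 * M1 + A2 * M2 + A3 * M3 | A1 A2 A3. True}"

lemma ideal3I: "A1 * M1 + A2 * M2 + A3 * M3 \<in> ideal3 M1 M2 M3"
  by (auto simp: ideal3_def)

lemma ideal3_generators: "M1 \<in> ideal3 M1 M2 M3" "M2 \<in> ideal3 M1 M2 M3" "M3 \<in> ideal3 M1 M2 M3"
  using ideal3I[of 1 M1 0 M2 0 M3] ideal3I[of 0 M1 1 M2 0 M3] ideal3I[of 0 M1 0 M2 1 M3] by simp_all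

lemma ideal3_add: "f \<in> ideal3 M1 M2 M3 \<Longrightarrow> g \<in> ideal3 M1 M2 M3 \<Longrightarrow> f + g \<in> ideal3 M1 M2 M3"
proof -
  assume "f \<in> ideal3 M1 M2 M3" "g \<in> ideal3 M1 M2 M3"
  then obtain A1 A2 A3 B1 B2 B3 where "f = A1 * M1 + A2 * M2 + A3 * M3" "g = B1 * M1 + B2 * M2 + B3 * M3"
    by (auto simp: ideal3_def)
  then have "f + g = (A1 + B1) * M1 + (A2 + B2) * M2 + (A3 + B3) * M3" by (simp add: algebra_simps)
  then show ?thesis by (simp only: ideal3I)
qed

lemma ideal3_mult: "f \<in> ideal3 M1 M2 M3 \<Longrightarrow> a * f \<in> ideal3 M1 M2 M3"
proof -
  assume "f \<in> ideal3 M1 M2 M3"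
  then obtain A1 A2 A3 where "f = A1 * M1 + A2 * M2 + A3 * M3"
    by (auto simp: ideal3_def)
  then have "a * f = (a * A1) * M1 + (a * A2) * M2 + (a * A3) * M3" by (simp add: algebra_simps)
  then show ?thesis by (simp only: ideal3I)
qed

lemma subspace_ideal3: "ideal.subspace (ideal3 M1 M2 M3)"
  using ideal3_add ideal3_mult ideal3I[of 0 M1 0 M2 0 M3] by (auto simp: ideal.subspace_def)

definition minor :: "(3 \<Rightarrow> tpoly) \<Rightarrow> 3 \<Rightarrow> 3 \<Rightarrow> tpoly" where
  "minor g i j = var i * g j - var j * g i"

text \<open>The cyclic choice of indices makes the minors the coordinates of
  \<open>x \<times> g\<close>. They differ from the generators with \<open>i < j\<close> at most by
  order and sign.\<close>

lemma span_minors: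
  "ideal.span {var i * g j - var j * g i | i j :: 3. i < j} = ideal3 (minor g 2 3) (minor g 3 1) (minor g 1 2)"
  (is "ideal.span ?B = ?I")
proof
  have "minor g i j \<in> ?I" for i j
  proof -
    have neg: "minor g i j = (- 1) * minor g j i" for i j by (simp add: minor_def)
    consider "i = j" | "(i, j) = (2, 3)" | "(i, j) = (3, 1)" | "(i, j) = (1, 2)" | "(i, j) = (3, 2)" | "(i, j) = (1, 3)" | "(i, j) = (2, 1)"
      using exhaust_3[of i] exhaust_3[of j] by auto
    then show ?thesis
    proof cases
      case 1
      then show ?thesis using ideal.subspace_0[OF subspace_ideal3] by (simp add: minor_def)
    qed (use ideal3_generators ideal3_mult[of _ _ _ _ "- 1"] neg in \<open>metis prod.inject\<close>)+
  qed
  then have "?B \<subseteq> ?I" by (auto simp: minor_def)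
  then show "ideal.span ?B \<subseteq> ?I" by (rule ideal.span_minimal[OF _ subspace_ideal3])
next
  have m: "minor g i j \<in> ideal.span ?B" for i j
  proof (cases i j rule: linorder_cases)
    case less
    then show ?thesis unfolding minor_def by (intro ideal.span_base) blast
  next
    case equal
    then show ?thesis using ideal.span_zero by (simp add: minor_def)
  next
    case greater
    then have "minor g j i \<in> ideal.span ?B" unfolding minor_def by (intro ideal.span_base) blast
    then have "- minor g j i \<in> ideal.span ?B" by (rule ideal.span_neg)
    then show ?thesis by (simp add: minor_def)
  qed
  show "?I \<subseteq> ideal.span ?B"
    unfolding ideal3_def by (auto intro!: ideal.span_add ideal.span_scale m)
qed

lemma ideal3_hcomp:
  assumes M: "is_form d M1" "is_form d M2" "is_form d M3" and f: "f \<in> ideal3 M1 M2 M3"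
  obtains A1 A2 A3 where "hcomp n f = A1 * M1 + A2 * M2 + A3 * M3"
    "is_form (n - d) A1" "is_form (n - d) A2" "is_form (n - d) A3"
proof -
  obtain A1 A2 A3 where "f = A1 * M1 + A2 * M2 + A3 * M3" using f by (auto simp: ideal3_def)
  then have "hcomp n f = (if n < d then 0 else hcomp (n - d) A1) * M1 + (if n < d then 0 else hcomp (n - d) A2) * M2
    + (if n < d then 0 else hcomp (n - d) A3) * M3"
    by (simp add: hcomp_add hcomp_mult_form[OF M(1)] hcomp_mult_form[OF M(2)] hcomp_mult_form[OF M(3)])
  then show ?thesis by (rule that) (simp_all add: is_form_hcomp)
qed

text \<open>Links charts and the graded ideal: an element with the same dehomogenization is made
  homogeneous, and two forms of the same degree that agree on a chart are equal.\<close>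

lemma dehomogenize_mem_power:
  assumes M: "is_form d M1" "is_form d M2" "is_form d M3" and f: "is_form n f"
    and g: "g \<in> ideal3 M1 M2 M3" "dehomogenize i f = dehomogenize i g"
  shows "\<exists>N. var i ^ N * f \<in> ideal3 M1 M2 M3"
proof -
  obtain N where N: "\<forall>k\<ge>N. g = (\<Sum>j\<le>k. hcomp j g)" using sum_hcomp[of g] by blast
  \<comment> \<open>The components of \<open>g\<close>, brought to the common degree
    \<open>N + n\<close> by powers of \<open>var i\<close>, which the chart does not see. Each
    component stays in the ideal because the generators are forms.\<close>
  let ?h = "\<Sum>j\<le>N + n. var i ^ (N + n - j) * hcomp j g"
  have "is_form (N + n) ?h"
  proof (rule is_form_sum)
    fix j assume "j \<in> {..N + n}"
    then show "is_form (N + n) (var i ^ (N + n - j) * hcomp j g)"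
      using is_form_mult[OF is_form_power[OF is_form_var, of "N + n - j" i] is_form_hcomp[of j g]] by simp
  qed
  moreover have "is_form (N + n) (var i ^ N * f)"
    using is_form_mult[OF is_form_power[OF is_form_var, of N i] f] by simp
  ultimately have form: "is_form (N + n) (var i ^ N * f - ?h)" by (rule is_form_diff[rotated])
  have "dehomogenize i (var i ^ N * f - ?h) = dehomogenize i f - dehomogenize i (\<Sum>j\<le>N + n. hcomp j g)"
    by (simp add: dehomogenize_simps)
  also have "(\<Sum>j\<le>N + n. hcomp j g) = g" using N by simp
  finally have "dehomogenize i (var i ^ N * f - ?h) = 0" using g(2) by simp
  with form have "var i ^ N * f - ?h = 0" by (rule dehomogenize_eq_0)
  then have "var i ^ N * f = ?h" by simp
  moreover have "hcomp j g \<in> ideal3 M1 M2 M3" for j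
    by (rule ideal3_hcomp[OF M g(1), of j]) (simp add: ideal3I)
  then have "?h \<in> ideal3 M1 M2 M3"
    by (intro ideal.subspace_sum[OF subspace_ideal3] ideal3_mult)
  ultimately show ?thesis by metis
qed

text \<open>In every term of the binomial expansion the exponent of \<open>a\<close> reaches
  \<open>m\<close> or that of \<open>b\<close> reaches \<open>n\<close>.\<close>

lemma power_add_mult_mem:
  assumes I: "ideal.subspace I" and a: "a ^ m * f \<in> I" and b: "b ^ n * f \<in> I"
  shows "(a + b) ^ (m + n) * f \<in> I"
proof -
  have "(a + b) ^ (m + n) * f = (\<Sum>k\<le>m + n. (of_nat (m + n choose k) * a ^ k * b ^ (m + n - k)) * f)"
    by (simp only: binomial_ring sum_distrib_right)
  also have "\<dots> \<in> I"
  proof (rule ideal.subspace_sum[OF I])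
    fix k
    show "of_nat (m + n choose k) * a ^ k * b ^ (m + n - k) * f \<in> I"
    proof (cases "k \<ge> m")
      case True
      then have "a ^ k = a ^ (k - m) * a ^ m" by (simp flip: power_add)
      then have eq: "of_nat (m + n choose k) * a ^ k * b ^ (m + n - k) * f =
        (of_nat (m + n choose k) * a ^ (k - m) * b ^ (m + n - k)) * (a ^ m * f)" by (simp add: ac_simps)
      show ?thesis unfolding eq by (rule ideal.subspace_scale[OF I a])
    next
      case False
      then have "b ^ (m + n - k) = b ^ (m - k) * b ^ n" by (simp flip: power_add)
      then have eq: "of_nat (m + n choose k) * a ^ k * b ^ (m + n - k) * f =
        (of_nat (m + n choose k) * a ^ k * b ^ (m - k)) * (b ^ n * f)" by (simp add: ac_simps)
      show ?thesis unfolding eq by (rule ideal.subspace_scale[OF I b])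
    qed
  qed
  finally show ?thesis .
qed

text \<open>The charts supply powers of the variables, but a coordinate line may pass through points
  of \<open>Z\<close>. A line that misses them is needed for cancellation.\<close>

lemma generic_line_power_mem:
  assumes I: "ideal.subspace I" and var: "\<And>i. \<exists>N. var i ^ N * f \<in> I"
  shows "\<exists>N. generic_line t ^ N * f \<in> I"
proof -
  obtain N1 N2 N3 where N: "var 1 ^ N1 * f \<in> I" "var 2 ^ N2 * f \<in> I" "var 3 ^ N3 * f \<in> I"
    using var by blast
  have "(const c * var i) ^ N * f \<in> I" if "var i ^ N * f \<in> I" for c i N
    using ideal.subspace_scale[OF I that, of "const c ^ N"] by (simp add: power_mult_distrib mult.assoc)
  then show ?thesis
    unfolding generic_line_def using power_add_mult_mem[OF I power_add_mult_mem[OF I N(1)]] N by blast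
qed

section \<open>Vanishing ideals\<close>

lemma vanishing_ideal_vanishes: "h \<in> vanishing_ideal Z \<Longrightarrow> vanishes_on h Z"
  unfolding vanishing_ideal_def
  by (induction rule: ideal.span_induct_alt) (auto simp: vanishes_on_def)

lemma forms_through_subset_vanishing_ideal: "forms_through n Z \<subseteq> vanishing_ideal Z"
  unfolding vanishing_ideal_def forms_through_def by (auto intro!: ideal.span_base)

lemma graded_piece_vanishing_ideal: "graded_piece (vanishing_ideal Z) n = forms_through n Z"
  using vanishing_ideal_vanishes forms_through_subset_vanishing_ideal[of n Z]
  by (auto simp: graded_piece_def forms_through_def)

lemma chart_representative:
  assumes "v \<noteq> (0 :: complex ^ 3)"
  obtains i c where "c \<noteq> 0" "(c *s v) $ i = 1"
proof -
  obtain i where "v $ i \<noteq> 0" using assms by (auto simp: vec_eq_iff)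
  then show ?thesis using that[of "1 / v $ i" i] by simp
qed

section \<open>Cancelling a generic line modulo the minors\<close>

lemma combination_of_minors:
  "var 1 * minor g 2 3 + var 2 * minor g 3 1 + var 3 * minor g 1 2 = 0"
  "g 1 * minor g 2 3 + g 2 * minor g 3 1 + g 3 * minor g 1 2 = 0"
  by (simp_all add: minor_def algebra_simps)

lemma is_form_minor: "is_form (d - 1) (g i) \<Longrightarrow> is_form (d - 1) (g j) \<Longrightarrow> d \<ge> 1 \<Longrightarrow> is_form d (minor g i j)"
  unfolding minor_def
  using is_form_mult[OF is_form_var, of "d - 1" "g i" j] is_form_mult[OF is_form_var, of "d - 1" "g j" i]
  by (auto intro: is_form_diff)

lemma lift_identity:
  fixes A1 A2 A3 x1 x2 x3 g1 g2 g3 M1 M2 M3 l \<alpha> \<beta> :: "'r :: comm_ring_1"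
  assumes "A1 = \<alpha> * (x1 - l * y1) + \<beta> * (g1 - l * h1) + l * B1" "A2 = \<alpha> * (x2 - l * y2) + \<beta> * (g2 - l * h2) + l * B2"
    "A3 = \<alpha> * (x3 - l * y3) + \<beta> * (g3 - l * h3) + l * B3"
    and x: "x1 * M1 + x2 * M2 + x3 * M3 = 0" and g: "g1 * M1 + g2 * M2 + g3 * M3 = 0"
  shows "A1 * M1 + A2 * M2 + A3 * M3 =
    l * ((B1 - \<alpha> * y1 - \<beta> * h1) * M1 + (B2 - \<alpha> * y2 - \<beta> * h2) * M2 + (B3 - \<alpha> * y3 - \<beta> * h3) * M3)"
proof -
  have "A1 * M1 + A2 * M2 + A3 * M3 = \<alpha> * (x1 * M1 + x2 * M2 + x3 * M3) + \<beta> * (g1 * M1 + g2 * M2 + g3 * M3) +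
    l * ((B1 - \<alpha> * y1 - \<beta> * h1) * M1 + (B2 - \<alpha> * y2 - \<beta> * h2) * M2 + (B3 - \<alpha> * y3 - \<beta> * h3) * M3)"
    unfolding assms(1-3) by (simp add: algebra_simps)
  then show ?thesis using x g by simp
qed

text \<open>On the line the left side vanishes, so the cofactors restrict to a syzygy of the
  restricted minors. By \<open>syzygy_of_minors\<close> it combines the restricted rows
  \<open>x\<close> and \<open>g\<close>, which lift to true syzygies. After these are subtracted,
  every cofactor is divisible by the line.\<close>

lemma generic_line_cancel_minors:
  assumes cop: "no_common_factor {restrict_line t (minor g 2 3), restrict_line t (minor g 3 1), restrict_line t (minor g 1 2)}"
    and mem: "generic_line t * P \<in> ideal3 (minor g 2 3) (minor g 3 1) (minor g 1 2)"
  shows "P \<in> ideal3 (minor g 2 3) (minor g 3 1) (minor g 1 2)"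
proof -
  let ?l = "generic_line t" and ?r = "restrict_line t"
  obtain A1 A2 A3 where A: "?l * P = A1 * minor g 2 3 + A2 * minor g 3 1 + A3 * minor g 1 2"
    using mem by (auto simp: ideal3_def)
  have "?r (?l * P) = ?r (A1 * minor g 2 3 + A2 * minor g 3 1 + A3 * minor g 1 2)" using A by simp
  then have syz: "?r A1 * ?r (minor g 2 3) + ?r A2 * ?r (minor g 3 1) + ?r A3 * ?r (minor g 1 2) = 0"
    by (simp only: restrict_line_simps(1,2) restrict_line_generic_line mult_zero_left)
  have m: "?r (minor g i j) = ?r (var i) * ?r (g j) - ?r (var j) * ?r (g i)" for i j
    unfolding minor_def by (simp only: restrict_line_simps(2,8))
  obtain \<alpha> \<beta> where ab: "?r A1 = \<alpha> * ?r (var 1) + \<beta> * ?r (g 1)" "?r A2 = \<alpha> * ?r (var 2) + \<beta> * ?r (g 2)"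
    "?r A3 = \<alpha> * ?r (var 3) + \<beta> * ?r (g 3)"
    using syzygy_of_minors[OF m m m cop syz] by blast
  have dec: "\<exists>h. ?r f = f - ?l * h \<and> f = ?r f + ?l * h" for f
  proof -
    obtain h where "f = ?r f + ?l * h" by (rule restrict_line_decomp)
    then show ?thesis by (metis add_diff_cancel_right')
  qed
  have "\<forall>i. \<exists>h. ?r (var i) = var i - ?l * h" using dec by blast
  from choice[OF this] obtain y where y: "?r (var i) = var i - ?l * y i" for i by blast
  have "\<forall>i. \<exists>h. ?r (g i) = g i - ?l * h" using dec by blast
  from choice[OF this] obtain h where h: "?r (g i) = g i - ?l * h i" for i by blast
  obtain B1 where B1: "A1 = ?r A1 + ?l * B1" using dec by blast
  obtain B2 where B2: "A2 = ?r A2 + ?l * B2" using dec by blast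
  obtain B3 where B3: "A3 = ?r A3 + ?l * B3" using dec by blast
  have "?l * P = ?l * ((B1 - \<alpha> * y 1 - \<beta> * h 1) * minor g 2 3 + (B2 - \<alpha> * y 2 - \<beta> * h 2) * minor g 3 1 +
      (B3 - \<alpha> * y 3 - \<beta> * h 3) * minor g 1 2)"
    unfolding A
    by (rule lift_identity[OF B1[unfolded ab(1) y h] B2[unfolded ab(2) y h] B3[unfolded ab(3) y h] combination_of_minors])
  then have "P = (B1 - \<alpha> * y 1 - \<beta> * h 1) * minor g 2 3 + (B2 - \<alpha> * y 2 - \<beta> * h 2) * minor g 3 1 +
      (B3 - \<alpha> * y 3 - \<beta> * h 3) * minor g 1 2"
    using generic_line_neq_0[of t] mult_left_cancel by blast
  then show ?thesis by (simp only: ideal3I)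
qed

section \<open>Linear independence of three forms\<close>

definition lin_indep3 :: "tpoly \<Rightarrow> tpoly \<Rightarrow> tpoly \<Rightarrow> bool" where
  "lin_indep3 F G H \<longleftrightarrow> (\<forall>a b c. const a * F + const b * G + const c * H = 0 \<longrightarrow> a = 0 \<and> b = 0 \<and> c = 0)"

lemma lin_indep3_independent:
  assumes "lin_indep3 F G H"
  shows "tpoly.independent {F, G, H}" "card {F, G, H} = 3"
proof -
  have "F \<noteq> G"
    using assms[unfolded lin_indep3_def, rule_format, of 1 "- 1" 0] by (auto simp: const_minus)
  moreover have "F \<noteq> H"
    using assms[unfolded lin_indep3_def, rule_format, of 1 0 "- 1"] by (auto simp: const_minus)
  moreover have "G \<noteq> H"
    using assms[unfolded lin_indep3_def, rule_format, of 0 1 "- 1"] by (auto simp: const_minus)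
  ultimately have neq: "F \<noteq> G" "F \<noteq> H" "G \<noteq> H" by blast+
  then show "card {F, G, H} = 3" by simp
  show "tpoly.independent {F, G, H}"
  proof (rule tpoly.independent_if_scalars_zero)
    fix u x assume "(\<Sum>x\<in>{F, G, H}. smult_tpoly (u x) x) = 0" "x \<in> {F, G, H}"
    moreover from this have "const (u F) * F + const (u G) * G + const (u H) * H = 0"
      using neq by (simp add: smult_tpoly_def add.assoc)
    ultimately show "u x = 0" using assms unfolding lin_indep3_def by blast
  qed simp
qed

lemma span_triple: "tpoly.span {F, G, H} = {const a * F + const b * G + const c * H | a b c. True}"
  (is "_ = ?R")
proof
  have sub: "tpoly.subspace ?R"
  proof (rule tpoly.subspaceI)
    show "0 \<in> ?R" by (auto intro!: exI[of _ 0])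
  next
    fix x y assume "x \<in> ?R" "y \<in> ?R"
    then obtain a b c a' b' c' where "x = const a * F + const b * G + const c * H" "y = const a' * F + const b' * G + const c' * H"
      by blast
    then have "x + y = const (a + a') * F + const (b + b') * G + const (c + c') * H"
      by (simp add: const_add algebra_simps)
    then show "x + y \<in> ?R" by blast
  next
    fix k x assume "x \<in> ?R"
    then obtain a b c where "x = const a * F + const b * G + const c * H" by blast
    then have "smult_tpoly k x = const (k * a) * F + const (k * b) * G + const (k * c) * H"
      by (simp add: smult_tpoly_def const_mult algebra_simps)
    then show "smult_tpoly k x \<in> ?R" by blast
  qed
  have "F = const 1 * F + const 0 * G + const 0 * H" "G = const 0 * F + const 1 * G + const 0 * H"
    "H = const 0 * F + const 0 * G + const 1 * H" by simp_all
  then have "{F, G, H} \<subseteq> ?R" by blast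
  then show "tpoly.span {F, G, H} \<subseteq> ?R" by (rule tpoly.span_minimal[OF _ sub])
  have "const k * X \<in> tpoly.span {F, G, H}" if "X \<in> {F, G, H}" for k X
    using tpoly.span_scale[OF tpoly.span_base[OF that], of k] by (simp add: smult_tpoly_def)
  then show "?R \<subseteq> tpoly.span {F, G, H}" by (auto intro!: tpoly.span_add)
qed

section \<open>Reduced eigenschemes\<close>

locale reduced_eigenscheme =
  fixes d :: nat and g :: "3 \<Rightarrow> tpoly" and Z :: "(complex ^ 3) set set"
  assumes d: "d \<ge> 3" and Z: "Z \<subseteq> proj_plane" "finite Z" and g: "is_form (d - 1) (g i)"
    and scheme: "proj_scheme (ideal3 (minor g 2 3) (minor g 3 1) (minor g 1 2)) = proj_scheme (vanishing_ideal Z)"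
begin

definition "M1 = minor g 2 3"
definition "M2 = minor g 3 1"
definition "M3 = minor g 1 2"

lemma forms: "is_form d M1" "is_form d M2" "is_form d M3"
  using g d unfolding M1_def M2_def M3_def by (auto intro!: is_form_minor)

lemma charts: "dehomogenize i ` ideal3 M1 M2 M3 = dehomogenize i ` vanishing_ideal Z"
  using fun_cong[OF scheme, of i] by (simp add: proj_scheme_def M1_def M2_def M3_def)

lemma syzygies: "var 1 * M1 + var 2 * M2 + var 3 * M3 = 0"
  using combination_of_minors(1) unfolding M1_def M2_def M3_def .

text \<open>A form through \<open>Z\<close> that is nonzero at \<open>v\<close> agrees, on a chart
  containing \<open>v\<close>, with an element of the ideal, and this vanishes at \<open>v\<close>.
  The representative is scaled to have coordinate 1 because dehomogenization preserves values
  there.\<close>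

lemma zero_set:
  assumes "v \<noteq> 0" "eval_tpoly M1 v = 0" "eval_tpoly M2 v = 0" "eval_tpoly M3 v = 0"
  shows "vec.span {v} \<in> Z"
proof (rule ccontr)
  assume "vec.span {v} \<notin> Z"
  then obtain f where f: "is_form (card Z) f" "vanishes_on f Z" "eval_tpoly f (rep (vec.span {v})) \<noteq> 0"
    using separating_form[of Z "vec.span {v}" "card Z"] Z span_in_proj_plane[OF assms(1)] by auto
  obtain i c where c: "c \<noteq> 0" "(c *s v) $ i = 1" using chart_representative[OF assms(1)] .
  have "f \<in> vanishing_ideal Z"
    using forms_through_subset_vanishing_ideal f by (auto simp: forms_through_def)
  then have "dehomogenize i f \<in> dehomogenize i ` ideal3 M1 M2 M3" unfolding charts by blast
  then obtain h where h: "h \<in> ideal3 M1 M2 M3" "dehomogenize i f = dehomogenize i h" by blast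
  then have "eval_tpoly f (c *s v) = eval_tpoly h (c *s v)"
    using eval_dehomogenize_chart[OF c(2)] by metis
  moreover have "eval_tpoly h (c *s v) = 0"
    using h(1) assms(2-4) forms by (auto simp: ideal3_def eval_form_scale)
  ultimately have "eval_tpoly f v = 0" using c by (simp add: eval_form_scale[OF f(1)])
  then show False using f(3) eval_rep_span[OF f(1) assms(1)] by simp
qed

lemma ideal_vanishes:
  assumes "is_form n f" "f \<in> ideal3 M1 M2 M3"
  shows "vanishes_on f Z"
  unfolding vanishes_on_iff[OF assms(1) Z(1)]
proof
  fix p assume p: "p \<in> Z"
  then have "p \<in> proj_plane" using Z by blast
  note r = rep[OF this]
  obtain i c where c: "c \<noteq> 0" "(c *s rep p) $ i = 1" using chart_representative[OF r(1)] .
  have "dehomogenize i f \<in> dehomogenize i ` vanishing_ideal Z" using assms(2) unfolding charts[symmetric] by blast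
  then obtain h where h: "h \<in> vanishing_ideal Z" "dehomogenize i f = dehomogenize i h" by blast
  then have "eval_tpoly f (c *s rep p) = eval_tpoly h (c *s rep p)"
    using eval_dehomogenize_chart[OF c(2)] by metis
  moreover have "c *s rep p \<in> p" using r(2) vec.span_scale[OF vec.span_base[of "rep p" "{rep p}"], of c] by simp
  then have "eval_tpoly h (c *s rep p) = 0"
    using vanishing_ideal_vanishes[OF h(1)] p unfolding vanishes_on_def by blast
  ultimately show "eval_tpoly f (rep p) = 0" using c by (simp add: eval_form_scale[OF assms(1)])
qed

lemma minors_vanish: "vanishes_on M1 Z" "vanishes_on M2 Z" "vanishes_on M3 Z"
  using ideal_vanishes[OF forms(1)] ideal_vanishes[OF forms(2)] ideal_vanishes[OF forms(3)] ideal3_generators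
  by simp_all

lemma no_common_factor_restricted:
  assumes "\<forall>p\<in>Z. eval_tpoly (generic_line t) (rep p) \<noteq> 0"
  shows "no_common_factor {restrict_line t M1, restrict_line t M2, restrict_line t M3}"
proof -
  have "no_common_factor (restrict_line t ` {M1, M2, M3})"
  proof (rule no_common_factor_restrict_line)
    show "\<exists>n. is_form n f" if "f \<in> {M1, M2, M3}" for f using that forms by blast
    fix v :: "complex ^ 3" assume v: "v \<noteq> 0" "eval_tpoly (generic_line t) v = 0"
    show "\<exists>f\<in>{M1, M2, M3}. eval_tpoly f v \<noteq> 0"
    proof (rule ccontr)
      assume "\<not> ?thesis"
      then have "vec.span {v} \<in> Z" using zero_set v(1) by blast
      then show False using assms eval_rep_span[OF is_form_generic_line v(1)] v(2) by blast
    qed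
  qed
  then show ?thesis by simp
qed

lemma ex_generic_line: "\<exists>t. \<forall>p\<in>Z. eval_tpoly (generic_line t) (rep p) \<noteq> 0"
  using generic_line_avoids Z by blast

text \<open>On a line that misses \<open>Z\<close> the minors have no common zero, so a common
  factor restricts to a unit. Being a factor of a nonzero form it is itself a form, and a nonzero
  constant restriction forces degree 0.\<close>

lemma no_common_factor: "no_common_factor {M1, M2, M3}"
  unfolding no_common_factor_def
proof (intro allI impI)
  fix q assume q: "\<forall>a\<in>{M1, M2, M3}. q dvd a"
  obtain t where "\<forall>p\<in>Z. eval_tpoly (generic_line t) (rep p) \<noteq> 0" using ex_generic_line by blast
  then have cop: "no_common_factor {restrict_line t M1, restrict_line t M2, restrict_line t M3}"
    by (rule no_common_factor_restricted)
  have "restrict_line t q dvd restrict_line t a" if "a \<in> {M1, M2, M3}" for a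
  proof -
    have "q dvd a" using q that by blast
    then obtain r where "a = q * r" by (elim dvdE)
    then show ?thesis by (simp add: restrict_line_simps)
  qed
  then have "restrict_line t q dvd 1" using cop by (auto simp: no_common_factor_def)
  then obtain c where c: "c \<noteq> 0" "restrict_line t q = const c" using dvd_1_iff_const by blast
  have "\<exists>a\<in>{M1, M2, M3}. a \<noteq> 0"
  proof (rule ccontr)
    assume "\<not> ?thesis"
    then have "(0 :: tpoly) dvd 1" using cop by (auto simp: no_common_factor_def restrict_line_simps)
    then show False by simp
  qed
  then obtain a where "a \<in> {M1, M2, M3}" "a \<noteq> 0" by blast
  then obtain k where k: "is_form k q" using is_form_dvd[of d a q] forms q by blast
  then have "is_form k (const c)" using is_form_restrict_line[OF k, of t] c by simp
  then have "k = 0" using is_form_deg_unique[OF is_form_const, of k c] c by simp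
  then obtain e where e: "q = const e" using is_form_0_const k by blast
  then have "e \<noteq> 0" using c by (auto simp: restrict_line_simps)
  then show "q dvd 1" using e const_dvd_1 by simp
qed

text \<open>The charts put \<open>f\<close>, times a power of each variable, into the ideal. This
  gives a power of a line that misses \<open>Z\<close>, which
  \<open>generic_line_cancel_minors\<close> removes step by step.\<close>

lemma saturated:
  assumes f: "is_form n f" "vanishes_on f Z"
  shows "f \<in> ideal3 M1 M2 M3"
proof -
  obtain t where t: "\<forall>p\<in>Z. eval_tpoly (generic_line t) (rep p) \<noteq> 0" using ex_generic_line by blast
  have "f \<in> vanishing_ideal Z"
    using forms_through_subset_vanishing_ideal f by (auto simp: forms_through_def)
  have "\<exists>N. var i ^ N * f \<in> ideal3 M1 M2 M3" for i
  proof -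
    have "dehomogenize i f \<in> dehomogenize i ` ideal3 M1 M2 M3" unfolding charts using \<open>f \<in> _\<close> by blast
    then obtain h where "h \<in> ideal3 M1 M2 M3" "dehomogenize i f = dehomogenize i h" by blast
    then show ?thesis using dehomogenize_mem_power[OF forms f(1)] by blast
  qed
  then obtain N where "generic_line t ^ N * f \<in> ideal3 M1 M2 M3"
    using generic_line_power_mem[OF subspace_ideal3] by blast
  then show ?thesis
  proof (induction N)
    case (Suc N)
    then have "generic_line t * (generic_line t ^ N * f) \<in> ideal3 M1 M2 M3" by (simp add: mult.assoc)
    then have "generic_line t ^ N * f \<in> ideal3 M1 M2 M3"
      using generic_line_cancel_minors no_common_factor_restricted[OF t] unfolding M1_def M2_def M3_def by blast
    then show ?case by (rule Suc.IH)
  qed simp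
qed

text \<open>A constant relation is a syzygy, hence a combination of the rows \<open>x\<close> and
  \<open>g\<close>. Their entries have positive degree, so such a combination has no constant
  term.\<close>

lemma lin_indep3_minors: "lin_indep3 M1 M2 M3"
  unfolding lin_indep3_def
proof (intro allI impI)
  fix a b c assume "const a * M1 + const b * M2 + const c * M3 = 0"
  from syzygy_of_minors[OF _ _ _ no_common_factor this] obtain \<alpha> \<beta> where
    ab: "const a = \<alpha> * var 1 + \<beta> * g 1" "const b = \<alpha> * var 2 + \<beta> * g 2" "const c = \<alpha> * var 3 + \<beta> * g 3"
    unfolding M1_def M2_def M3_def minor_def by blast
  have "hcomp 0 (\<alpha> * var i + \<beta> * g i) = 0" for i
    using d by (simp add: hcomp_add hcomp_mult_form[OF is_form_var] hcomp_mult_form[OF g])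
  then have "hcomp 0 (const a) = 0" "hcomp 0 (const b) = 0" "hcomp 0 (const c) = 0"
    unfolding ab by blast+
  then show "a = 0 \<and> b = 0 \<and> c = 0" by (simp add: hcomp_form[OF is_form_const])
qed

lemma forms_through_eq: "forms_through d Z = tpoly.span {M1, M2, M3}"
proof
  show "forms_through d Z \<subseteq> tpoly.span {M1, M2, M3}"
  proof
    fix f assume "f \<in> forms_through d Z"
    then have f: "is_form d f" "vanishes_on f Z" by (auto simp: forms_through_def)
    obtain A1 A2 A3 where A: "hcomp d f = A1 * M1 + A2 * M2 + A3 * M3"
      "is_form (d - d) A1" "is_form (d - d) A2" "is_form (d - d) A3"
      by (rule ideal3_hcomp[OF forms saturated[OF f]])
    moreover have "hcomp d f = f" using f(1) by (simp add: is_form_iff_hcomp)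
    moreover obtain a b c where "A1 = const a" "A2 = const b" "A3 = const c"
      using A is_form_0_const by (metis diff_self_eq_0)
    ultimately have "f = const a * M1 + const b * M2 + const c * M3" by simp
    then show "f \<in> tpoly.span {M1, M2, M3}" unfolding span_triple by blast
  qed
  show "tpoly.span {M1, M2, M3} \<subseteq> forms_through d Z"
    using forms minors_vanish by (intro tpoly.span_minimal subspace_forms_through) (auto simp: forms_through_def)
qed

lemma dim_forms_through_3: "tpoly.dim (forms_through d Z) = 3"
  unfolding forms_through_eq
  using lin_indep3_independent[OF lin_indep3_minors] tpoly.dim_span_eq_card_independent by simp

lemma no_collinear:
  assumes S: "S \<subseteq> Z" "card S = d + 1" and l: "l \<noteq> 0" "is_form 1 l" "vanishes_on l S"
  shows False
proof -
  have "\<not> l dvd 1"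
  proof
    assume "l dvd 1"
    then obtain c where "c \<noteq> 0" "l = const c" using dvd_1_iff_const by blast
    then show False using is_form_deg_unique[OF l(2) is_form_const[of c, folded \<open>l = const c\<close>] l(1)] by simp
  qed
  \<comment> \<open>A linear form has no proper factors, so it is coprime to a minor that it does
    not divide. Bezout's bound \<open>1 * d\<close> then contradicts the \<open>d + 1\<close>
    points.\<close>
  then obtain M where M: "M \<in> {M1, M2, M3}" "\<not> l dvd M"
    using no_common_factor by (auto simp: no_common_factor_def)
  then have Mf: "is_form d M" "vanishes_on M S" "M \<noteq> 0"
    using forms minors_vanish vanishes_on_subset[OF _ S(1)] by auto
  have cop: "no_common_factor {l, M}"
    unfolding no_common_factor_def
  proof (intro allI impI)
    fix q assume q: "\<forall>a\<in>{l, M}. q dvd a"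
    then obtain k r where k: "k \<le> 1" "is_form k q" "is_form (1 - k) r" "l = q * r"
      using is_form_dvd[OF l(2,1), of q] by (metis insertI1)
    show "q dvd 1"
    proof (cases "k = 0")
      case True
      then show ?thesis using is_form_0_const[of q] k l(1) const_dvd_1 by fastforce
    next
      case False
      then have "is_form 0 r" using k by simp
      then obtain c where c: "r = const c" using is_form_0_const by blast
      with k(4) l(1) have "c \<noteq> 0" by auto
      then have "q = l * const (inverse c)" using k(4) c by (simp add: mult.assoc flip: const_mult)
      moreover have "q dvd M" using q by blast
      ultimately have "l dvd M" by (metis dvd_mult_left)
      then show ?thesis using M by blast
    qed
  qed
  have "finite S" "S \<subseteq> proj_plane" using S(1) Z finite_subset by auto
  from Bezout_bound[OF l(2,1) Mf(1,3) cop this l(3) Mf(2)] have "card S \<le> d" by simp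
  then show False using S by simp
qed

text \<open>By Noether's theorem \<open>M\<^sub>i \<in> (C, F)\<close> for a generic combination \<open>F\<close>. The relation
  \<open>x \<cdot> M = 0\<close> then shows that \<open>C\<close> divides a linear form, which must vanish, so \<open>C\<close> divides every \<open>M\<^sub>i\<close>.\<close>

lemma no_curve:
  assumes k: "2 \<le> k" and S: "S \<subseteq> Z" "card S = k * d" and C: "C \<noteq> 0" "is_form k C" "vanishes_on C S"
  shows False
proof -
  have nonunit: "\<not> C dvd 1"
  proof
    assume "C dvd 1"
    then obtain c where "c \<noteq> 0" "C = const c" using dvd_1_iff_const by blast
    then show False using is_form_deg_unique[OF C(2) is_form_const[of c, folded \<open>C = const c\<close>] C(1)] k by simp
  qed
  obtain t where "no_common_factor {M1 + const t * M2 + const (t ^ 2) * M3, C}"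
    using generic_combination_coprime[OF no_common_factor C(1)] by blast
  moreover define F where "F = M1 + const t * M2 + const (t ^ 2) * M3"
  ultimately have cop: "no_common_factor {C, F}" by (simp add: insert_commute)
  have F: "is_form d F" "vanishes_on F S"
    using forms minors_vanish vanishes_on_subset[OF _ S(1)] unfolding F_def
    by (auto intro!: is_form_add is_form_const_mult simp: vanishes_on_def)
  have "F \<noteq> 0" using cop nonunit by (auto simp: no_common_factor_def)
  have comb: "\<exists>A b. M = A * C + const b * F" if "M \<in> {M1, M2, M3}" for M
  proof -
    have M: "is_form d M" "vanishes_on M S"
      using that forms minors_vanish vanishes_on_subset[OF _ S(1)] by auto
    have "\<exists>A B. M = A * C + B * F"
      by (rule Noether_AF_BG[where S = S, OF C(2,1) _ F(1) \<open>F \<noteq> 0\<close> _ cop])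
        (use k d S Z C(3) F(2) M finite_subset in auto)
    then have "M \<in> pencil_forms d C F" using M by (simp add: pencil_forms_def)
    \<comment> \<open>\<open>M\<close> and \<open>F\<close> have the same degree \<open>d\<close>,
      so the cofactor of \<open>F\<close> is a constant.\<close>
    then obtain A B where "M = A * C + B * F" "is_form (d - d) B"
      using pencil_formsE[OF _ C(2) F(1)] by metis
    then show ?thesis using is_form_0_const[of B] by auto
  qed
  obtain A1 b1 where A1: "M1 = A1 * C + const b1 * F" using comb[of M1] by auto
  obtain A2 b2 where A2: "M2 = A2 * C + const b2 * F" using comb[of M2] by auto
  obtain A3 b3 where A3: "M3 = A3 * C + const b3 * F" using comb[of M3] by auto
  note A = A1 A2 A3
  define L where "L = const b1 * var 1 + const b2 * var 2 + const b3 * var 3"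
  have "var 1 * M1 + var 2 * M2 + var 3 * M3 = C * (var 1 * A1 + var 2 * A2 + var 3 * A3) + L * F"
    unfolding A L_def by (simp add: algebra_simps)
  then have "L * F = C * (- (var 1 * A1 + var 2 * A2 + var 3 * A3))"
    using syzygies by (metis add_eq_0_iff mult_minus_right)
  then have "C dvd L * F" by simp
  then have "C dvd L" using no_common_factor_pair_dvd[OF cop] by blast
  have L1: "is_form 1 L" unfolding L_def by (intro is_form_add is_form_const_mult is_form_var)
  have "L = 0"
  proof (rule ccontr)
    assume "L \<noteq> 0"
    obtain j q where "j \<le> 1" "is_form j C" "is_form (1 - j) q" "L = C * q"
      by (rule is_form_dvd[OF L1 \<open>L \<noteq> 0\<close> \<open>C dvd L\<close>])
    then show False using is_form_deg_unique[OF C(2) _ C(1)] k by fastforce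
  qed
  have ev: "eval_tpoly L v = b1 * v $ 1 + b2 * v $ 2 + b3 * v $ 3" for v by (simp add: L_def)
  have "b1 = 0" using ev[of "\<chi> i. if i = 1 then 1 else 0"] \<open>L = 0\<close> by simp
  moreover have "b2 = 0" using ev[of "\<chi> i. if i = 2 then 1 else 0"] \<open>L = 0\<close> by simp
  moreover have "b3 = 0" using ev[of "\<chi> i. if i = 3 then 1 else 0"] \<open>L = 0\<close> by simp
  ultimately have "\<forall>M\<in>{M1, M2, M3}. C dvd M" using A by simp
  then show False using nonunit no_common_factor by (auto simp: no_common_factor_def)
qed

end

section \<open>Point configurations with three forms of degree \<open>d\<close>\<close>

lemma ex_greatest_common_factor:
  assumes "F \<noteq> 0"
  obtains h F' G' H' where "F = h * F'" "G = h * G'" "H = h * H'" "no_common_factor {F', G', H'}"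
proof -
  let ?g = "gcd (to_polys F) (gcd (to_polys G) (to_polys H))"
  obtain h where h: "to_polys h = ?g" using surj_to_polys by blast
  have "?g dvd to_polys F" "?g dvd to_polys G" "?g dvd to_polys H"
    by (auto intro: dvd_trans[OF gcd_dvd2])
  then have "h dvd F" "h dvd G" "h dvd H"
    unfolding h[symmetric] to_polys_dvd_iff by auto
  then obtain F' G' H' where eq: "F = h * F'" "G = h * G'" "H = h * H'" by (meson dvdE)
  have "h \<noteq> 0" using eq assms by auto
  have "no_common_factor {F', G', H'}"
    unfolding no_common_factor_def
  proof (intro allI impI)
    fix q assume q: "\<forall>a\<in>{F', G', H'}. q dvd a"
    then have "h * q dvd F" "h * q dvd G" "h * q dvd H" using eq by (simp_all add: mult_dvd_mono)
    then have "to_polys (h * q) dvd ?g" by (simp only: gcd_greatest_iff to_polys_dvd_iff)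
    then have "h * q dvd h * 1" unfolding h[symmetric] to_polys_dvd_iff by simp
    then show "q dvd 1" using \<open>h \<noteq> 0\<close> by (simp add: dvd_mult_cancel_left)
  qed
  with eq show ?thesis by (rule that)
qed

lemma ex_basis3:
  assumes V: "tpoly.subspace V" "tpoly.dim V = 3"
  obtains F G H where "F \<in> V" "G \<in> V" "H \<in> V" "lin_indep3 F G H"
proof -
  obtain B where B: "B \<subseteq> V" "tpoly.independent B" "V \<subseteq> tpoly.span B" "card B = 3"
    using tpoly.basis_exists[of V] V(2) by metis
  obtain F G H where FGH: "B = {F, G, H}" "F \<noteq> G" "G \<noteq> H" "F \<noteq> H" using B(4) card_3_iff by metis
  have "lin_indep3 F G H"
    unfolding lin_indep3_def
  proof (intro allI impI)
    fix a b c assume 0: "const a * F + const b * G + const c * H = 0"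
    let ?u = "\<lambda>x. if x = F then a else if x = G then b else c"
    have sum: "(\<Sum>x\<in>B. smult_tpoly (?u x) x) = 0"
      unfolding FGH(1) using FGH(2-4) 0 by (simp add: smult_tpoly_def add.assoc)
    have "?u x = 0" if "x \<in> B" for x
      using tpoly.independentD[OF B(2) _ order.refl sum that] FGH(1) by simp
    from this[of F] this[of G] this[of H] show "a = 0 \<and> b = 0 \<and> c = 0"
      using FGH by auto
  qed
  then show ?thesis using that B(1) FGH(1) by auto
qed

lemma lin_indep3_spans:
  assumes V: "tpoly.subspace V" "tpoly.dim V = 3" "V \<subseteq> forms n" and "F \<in> V" "G \<in> V" "H \<in> V" "lin_indep3 F G H"
  shows "V = tpoly.span {F, G, H}"
proof -
  have "tpoly.span {F, G, H} \<subseteq> V" using assms by (intro tpoly.span_minimal) auto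
  moreover have "tpoly.dim (tpoly.span {F, G, H}) = 3"
    using lin_indep3_independent[OF assms(7)] tpoly.dim_span_eq_card_independent by simp
  ultimately show ?thesis using subspace_forms_eq[of "tpoly.span {F, G, H}" V n] V tpoly.subspace_span by auto
qed

lemma lin_indep3_neq_0: "lin_indep3 F G H \<Longrightarrow> F \<noteq> 0"
  unfolding lin_indep3_def by (metis add.right_neutral const_0 mult_zero_left mult_zero_right zero_neq_one)

lemma lin_indep3_not_in_pencil: "lin_indep3 F G H \<Longrightarrow> H \<noteq> const a * F + const b * G"
proof
  assume "lin_indep3 F G H" and "H = const a * F + const b * G"
  moreover from this(2) have "const a * F + const b * G + const (- 1) * H = 0"
    by (simp add: const_minus)
  ultimately show False unfolding lin_indep3_def by (metis neg_equal_0_iff_equal zero_neq_one)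
qed

section \<open>Linear forms and the Koszul complex of the variables\<close>

lemma var_neq_0: "var i \<noteq> 0"
  by (metis var_def lookup_single_eq lookup_zero zero_neq_one)

lemma linear_form_coeffs:
  assumes "is_form 1 l"
  shows "\<exists>c :: 3 \<Rightarrow> complex. l = const (c 1) * var 1 + const (c 2) * var 2 + const (c 3) * var 3"
proof -
  have "\<exists>c i. Poly_Mapping.single m (Poly_Mapping.lookup l m) = const c * var i" if "m \<in> Poly_Mapping.keys l" for m
  proof -
    have m: "Poly_Mapping.lookup m 1 + Poly_Mapping.lookup m 2 + Poly_Mapping.lookup m 3 = 1"
      using assms that by (simp add: is_form_iff mdeg_def sum_3)
    then consider "Poly_Mapping.lookup m 1 = 1" "Poly_Mapping.lookup m 2 = 0" "Poly_Mapping.lookup m 3 = 0"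
      | "Poly_Mapping.lookup m 1 = 0" "Poly_Mapping.lookup m 2 = 1" "Poly_Mapping.lookup m 3 = 0"
      | "Poly_Mapping.lookup m 1 = 0" "Poly_Mapping.lookup m 2 = 0" "Poly_Mapping.lookup m 3 = 1"
      by linarith
    then have "\<exists>i. m = Poly_Mapping.single i 1"
    proof cases
      case 1
      then show ?thesis by (intro exI[of _ 1] poly_mapping_3_eqI) (simp_all add: lookup_single)
    next
      case 2
      then show ?thesis by (intro exI[of _ 2] poly_mapping_3_eqI) (simp_all add: lookup_single)
    next
      case 3
      then show ?thesis by (intro exI[of _ 3] poly_mapping_3_eqI) (simp_all add: lookup_single)
    qed
    then show ?thesis by (metis single_eq_const_monomial monomial_var var_def)
  qed
  moreover have "\<exists>c :: 3 \<Rightarrow> complex. const a * var i = const (c 1) * var 1 + const (c 2) * var 2 + const (c 3) * var 3" for a i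
    using exhaust_3[of i] by (intro exI[of _ "\<lambda>j. if j = i then a else 0"]) auto
  ultimately have single: "\<exists>c :: 3 \<Rightarrow> complex. Poly_Mapping.single m (Poly_Mapping.lookup l m) =
      const (c 1) * var 1 + const (c 2) * var 2 + const (c 3) * var 3" if "m \<in> Poly_Mapping.keys l" for m
    using that by metis
  have "\<exists>c :: 3 \<Rightarrow> complex. (\<Sum>m\<in>A. Poly_Mapping.single m (Poly_Mapping.lookup l m)) =
      const (c 1) * var 1 + const (c 2) * var 2 + const (c 3) * var 3" if "finite A" "A \<subseteq> Poly_Mapping.keys l" for A
    using that
  proof induction
    case empty
    show ?case by (rule exI[of _ "\<lambda>_. 0"]) simp
  next
    case (insert m A)
    then obtain c :: "3 \<Rightarrow> complex" where "(\<Sum>m\<in>A. Poly_Mapping.single m (Poly_Mapping.lookup l m)) =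
      const (c 1) * var 1 + const (c 2) * var 2 + const (c 3) * var 3" by auto
    moreover obtain c' :: "3 \<Rightarrow> complex" where "Poly_Mapping.single m (Poly_Mapping.lookup l m) =
      const (c' 1) * var 1 + const (c' 2) * var 2 + const (c' 3) * var 3" using single[of m] insert by auto
    ultimately show ?case using insert
      by (intro exI[of _ "\<lambda>i. c' i + c i"]) (simp add: const_add algebra_simps)
  qed
  from this[of "Poly_Mapping.keys l"] show ?thesis by (simp add: tpoly_sum_single)
qed

text \<open>The induction over ring operations needs arbitrary polynomials, so it treats the part
  beyond the constant term. Homogeneous components are taken only at the end.\<close>

lemma form_decomp_vars:
  assumes "is_form (Suc n) P"
  shows "\<exists>Q :: 3 \<Rightarrow> tpoly. (\<forall>i. is_form n (Q i)) \<and> P = var 1 * Q 1 + var 2 * Q 2 + var 3 * Q 3"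
proof -
  have "\<exists>Q :: 3 \<Rightarrow> tpoly. P = const (Poly_Mapping.lookup P 0) + (var 1 * Q 1 + var 2 * Q 2 + var 3 * Q 3)"
  proof (induction P rule: tpoly_ring_induct)
    case (const c)
    show ?case by (rule exI[of _ "\<lambda>_. 0"]) (simp add: const_def)
  next
    case (var i)
    have "Poly_Mapping.lookup (var i) 0 = 0" by (simp add: var_def lookup_single poly_mapping_eq_iff fun_eq_iff when_def)
    then show ?case using exhaust_3[of i] by (intro exI[of _ "\<lambda>j. if j = i then 1 else 0"]) auto
  next
    case (add f g)
    then obtain Q Q' :: "3 \<Rightarrow> tpoly" where "f = const (Poly_Mapping.lookup f 0) + (var 1 * Q 1 + var 2 * Q 2 + var 3 * Q 3)"
      "g = const (Poly_Mapping.lookup g 0) + (var 1 * Q' 1 + var 2 * Q' 2 + var 3 * Q' 3)" by blast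
    then have "f + g = (const (Poly_Mapping.lookup f 0) + (var 1 * Q 1 + var 2 * Q 2 + var 3 * Q 3)) +
      (const (Poly_Mapping.lookup g 0) + (var 1 * Q' 1 + var 2 * Q' 2 + var 3 * Q' 3))" by metis
    also have "\<dots> = const (Poly_Mapping.lookup (f + g) 0) + (var 1 * (Q 1 + Q' 1) + var 2 * (Q 2 + Q' 2) + var 3 * (Q 3 + Q' 3))"
      by (simp add: lookup_add const_add algebra_simps)
    finally show ?case by (intro exI[of _ "\<lambda>i. Q i + Q' i"])
  next
    case (mult f g)
    then obtain Q Q' :: "3 \<Rightarrow> tpoly" where fg: "f = const (Poly_Mapping.lookup f 0) + (var 1 * Q 1 + var 2 * Q 2 + var 3 * Q 3)"
      "g = const (Poly_Mapping.lookup g 0) + (var 1 * Q' 1 + var 2 * Q' 2 + var 3 * Q' 3)" by blast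
    have "eval_tpoly h 0 = Poly_Mapping.lookup h 0" for h
    proof (induction h rule: tpoly_induct)
      case (single m c)
      show ?case
      proof (cases "m = 0")
        case True
        then show ?thesis by (simp add: eval_tpoly_ev eval.ev_single)
      next
        case False
        then obtain i where "Poly_Mapping.lookup m i \<noteq> 0" by (auto simp: poly_mapping_eq_iff fun_eq_iff)
        then have "monomial (\<lambda>i. (0 :: complex ^ 3) $ i) m = 0"
          unfolding monomial_def by (intro prod_zero) (auto intro!: bexI[of _ i])
        then show ?thesis using False by (simp add: eval_tpoly_ev eval.ev_single lookup_single)
      qed
    qed (simp add: lookup_add)
    then have l: "Poly_Mapping.lookup (f * g) 0 = Poly_Mapping.lookup f 0 * Poly_Mapping.lookup g 0"
      by (metis eval_simps(2))
    define a b where "a = Poly_Mapping.lookup f 0" and "b = Poly_Mapping.lookup g 0"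
    have "f * g = f * (const b + (var 1 * Q' 1 + var 2 * Q' 2 + var 3 * Q' 3))"
      using fg(2) b_def by metis
    also have "\<dots> = f * const b + (var 1 * (f * Q' 1) + var 2 * (f * Q' 2) + var 3 * (f * Q' 3))"
      by (simp add: algebra_simps)
    also have "f * const b = (const a + (var 1 * Q 1 + var 2 * Q 2 + var 3 * Q 3)) * const b"
      using fg(1) a_def by metis
    finally have "f * g = const (a * b) + (var 1 * (const b * Q 1 + f * Q' 1) + var 2 * (const b * Q 2 + f * Q' 2) +
       var 3 * (const b * Q 3 + f * Q' 3))" by (simp add: const_mult algebra_simps)
    then show ?case unfolding l a_def b_def
      by (intro exI[of _ "\<lambda>i. const (Poly_Mapping.lookup g 0) * Q i + f * Q' i"])
  qed
  then obtain Q :: "3 \<Rightarrow> tpoly" where "P = const (Poly_Mapping.lookup P 0) + (var 1 * Q 1 + var 2 * Q 2 + var 3 * Q 3)" by blast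
  then have "hcomp (Suc n) P = hcomp (Suc n) (const (Poly_Mapping.lookup P 0) + (Q 1 * var 1 + Q 2 * var 2 + Q 3 * var 3))"
    by (simp add: mult.commute)
  also have "\<dots> = hcomp n (Q 1) * var 1 + hcomp n (Q 2) * var 2 + hcomp n (Q 3) * var 3"
    by (simp add: hcomp_add hcomp_form[OF is_form_const] hcomp_mult_form[OF is_form_var])
  also have "\<dots> = var 1 * hcomp n (Q 1) + var 2 * hcomp n (Q 2) + var 3 * hcomp n (Q 3)"
    by (simp only: mult.commute)
  finally show ?thesis
    using assms by (intro exI[of _ "\<lambda>i. hcomp n (Q i)"]) (simp add: is_form_hcomp is_form_iff_hcomp[of _ P])
qed

text \<open>\<open>restrict_line 0\<close> sets \<open>x\<^sub>1 = 0\<close>.\<close>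

lemma Koszul:
  assumes M: "is_form d M1" "is_form d M2" "is_form d M3" and d: "d \<ge> 1"
    and syz: "var 1 * M1 + var 2 * M2 + var 3 * M3 = 0"
  shows "\<exists>g. (\<forall>i. is_form (d - 1) (g i)) \<and> M1 = minor g 2 3 \<and> M2 = minor g 3 1 \<and> M3 = minor g 1 2"
proof -
  let ?r = "restrict_line 0"
  have l0: "generic_line 0 = var 1" by (simp add: generic_line_def)
  obtain A2 where A2: "M2 = ?r M2 + var 1 * A2" using restrict_line_decomp[of M2 0] unfolding l0 by blast
  obtain A3 where A3: "M3 = ?r M3 + var 1 * A3" using restrict_line_decomp[of M3 0] unfolding l0 by blast
  have "?r (var 1 * M1 + var 2 * M2 + var 3 * M3) = 0" using syz by (simp add: restrict_line_simps)
  then have rel: "var 2 * ?r M2 + var 3 * ?r M3 = 0" by (simp add: restrict_line_simps)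
  then have "?r M3 * var 3 = var 2 * (- ?r M2)" by (simp add: eq_neg_iff_add_eq_0 mult.commute add.commute)
  then have "var 2 dvd ?r M3 * var 3" by simp
  \<comment> \<open>With \<open>x\<^sub>1 = 0\<close> only a relation between two terms is left, and
    coprimality of \<open>x\<^sub>2\<close> and \<open>x\<^sub>3\<close> solves it by a single
    polynomial \<open>B\<close>.\<close>
  then have "var 2 dvd ?r M3" by (rule no_common_factor_pair_dvd[OF no_common_factor_vars, rotated]) simp
  then obtain B where B: "?r M3 = var 2 * B" by (elim dvdE)
  have v: "var 1 \<noteq> 0" "var 2 \<noteq> 0" by (rule var_neq_0)+
  have "var 2 * (?r M2 + var 3 * B) = 0" using rel unfolding B by (simp add: algebra_simps)
  then have "?r M2 = - (var 3 * B)" using v by (simp add: add_eq_0_iff2)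
  then have M2: "M2 = - (var 3 * B) + var 1 * A2" and M3: "M3 = var 2 * B + var 1 * A3" using A2 A3 B by simp_all
  have "var 1 * (M1 + var 2 * A2 + var 3 * A3) = var 1 * M1 + var 2 * M2 + var 3 * M3"
    unfolding M2 M3 by (simp add: algebra_simps)
  then have "M1 + var 2 * A2 + var 3 * A3 = 0" using syz v by simp
  then have M1: "M1 = - (var 2 * A2 + var 3 * A3)" by (simp only: eq_neg_iff_add_eq_0 add.assoc)
  \<comment> \<open>Read off by comparing \<open>M2 = - (var 3 * B) + var 1 * A2\<close> with
    \<open>var 3 * g 1 - var 1 * g 3\<close>, and \<open>M3\<close> likewise. The component
    \<open>hcomp (d - 1)\<close> makes the entries forms.\<close>
  define g where "g = (\<lambda>i :: 3. hcomp (d - 1) (if i = 1 then - B else if i = 2 then A3 else - A2))"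
  have "hcomp d (A * var i) = hcomp (d - 1) A * var i" for A i
    using d by (simp add: hcomp_mult_form[OF is_form_var])
  then have h: "hcomp d (var i * A) = var i * hcomp (d - 1) A" for A i by (simp add: mult.commute)
  have "hcomp d M1 = minor g 2 3" "hcomp d M2 = minor g 3 1" "hcomp d M3 = minor g 1 2"
    unfolding M1 M2 M3 minor_def g_def by (simp_all add: hcomp_add hcomp_minus hcomp_diff h)
  then have "M1 = minor g 2 3" "M2 = minor g 3 1" "M3 = minor g 1 2"
    using M by (simp_all add: is_form_iff_hcomp)
  moreover have "is_form (d - 1) (g i)" for i by (simp add: g_def is_form_hcomp)
  ultimately show ?thesis by blast
qed

locale eigen_configuration =
  fixes d :: nat and Z :: "(complex ^ 3) set set"
  assumes d: "d \<ge> 3" and Z: "Z \<subseteq> proj_plane" "finite Z" "card Z = d ^ 2 - d + 1"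
    and dim3: "tpoly.dim (forms_through d Z) = 3"
    and no_collinear: "S \<subseteq> Z \<Longrightarrow> card S = d + 1 \<Longrightarrow> l \<noteq> 0 \<Longrightarrow> is_form 1 l \<Longrightarrow> vanishes_on l S \<Longrightarrow> False"
    and no_curve: "2 \<le> k \<Longrightarrow> k \<le> d - 1 \<Longrightarrow> S \<subseteq> Z \<Longrightarrow> card S = k * d \<Longrightarrow> C \<noteq> 0 \<Longrightarrow> is_form k C \<Longrightarrow>
      vanishes_on C S \<Longrightarrow> False"
begin

text \<open>Joins conditions (2) and (3), so that later arguments can treat a curve of any degree
  below \<open>d\<close> uniformly. The exact cardinalities are reached by passing to a
  subset.\<close>

lemma card_on_curve_less:
  assumes m: "1 \<le> m" "m \<le> d - 1" and C: "C \<noteq> 0" "is_form m C"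
    and card: "card {p \<in> Z. eval_tpoly C (rep p) = 0} \<ge> (if m = 1 then d + 1 else m * d)"
  shows False
proof -
  obtain S where S: "S \<subseteq> {p \<in> Z. eval_tpoly C (rep p) = 0}" "card S = (if m = 1 then d + 1 else m * d)"
    by (rule obtain_subset_with_card_n[OF card])
  have "S \<subseteq> Z" using S(1) by blast
  then have "S \<subseteq> proj_plane" using Z(1) by blast
  then have "vanishes_on C S" using vanishes_on_iff[OF C(2)] S(1) by blast
  then show False
    using no_collinear[OF \<open>S \<subseteq> Z\<close> _ C(1)] no_curve[OF _ m(2) \<open>S \<subseteq> Z\<close> _ C] S(2) C(2) m(1)
    by (cases "m = 1") auto
qed

lemma forms_through_d_subset: "forms_through d Z \<subseteq> forms d"
  by (auto simp: forms_through_def)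

lemma span_basis:
  assumes "F \<in> forms_through d Z" "G \<in> forms_through d Z" "H \<in> forms_through d Z" "lin_indep3 F G H"
  shows "forms_through d Z = tpoly.span {F, G, H}"
  by (rule lin_indep3_spans[OF subspace_forms_through dim3 forms_through_d_subset assms])

text \<open>With \<open>e * e\<close> common zeros, \<open>S\<close> would be a complete
  intersection of \<open>F\<close> and a generic combination \<open>K\<close>. Noether's theorem
  would then put all three forms into the span of \<open>F\<close> and \<open>K\<close>.\<close>

lemma card_common_zeros_less:
  assumes e: "e \<ge> 1" and F: "is_form e F" "is_form e G" "is_form e H" and ind: "lin_indep3 F G H"
    and cop: "no_common_factor {F, G, H}" and S: "S \<subseteq> proj_plane" "finite S"
    and van: "vanishes_on F S" "vanishes_on G S" "vanishes_on H S"
  shows "card S < e * e"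
proof -
  have F0: "F \<noteq> 0" using ind by (rule lin_indep3_neq_0)
  obtain t where "no_common_factor {F + const t * G + const (t ^ 2) * H, F}"
    using generic_combination_coprime[OF cop F0] by blast
  moreover define K where "K = F + const t * G + const (t ^ 2) * H"
  ultimately have copK: "no_common_factor {F, K}" by (simp add: insert_commute)
  have K: "is_form e K" unfolding K_def using F by (intro is_form_add is_form_const_mult)
  have vK: "vanishes_on K S" unfolding K_def using van by (simp add: vanishes_on_def)
  have K0: "K \<noteq> 0"
  proof
    assume "K = 0"
    then have "F dvd 1" using copK by (auto simp: no_common_factor_def)
    then obtain c where c: "c \<noteq> 0" "F = const c" using dvd_1_iff_const by blast
    then show False using is_form_deg_unique[OF F(1) is_form_const[of c, folded c(2)] F0] e by simp
  qed
  have le: "card S \<le> e * e"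
    by (rule Bezout_bound[OF F(1) F0 K K0 copK S(2,1) van(1) vK])
  have "card S \<noteq> e * e"
  proof
    assume eq: "card S = e * e"
    have "X \<in> tpoly.span {F, K}" if "X \<in> {F, G, H}" for X
    proof -
      have X: "is_form e X" "vanishes_on X S" using that F van by auto
      obtain A B where "X = A * F + B * K"
        using Noether_AF_BG[OF F(1) F0 e K K0 e copK S eq van(1) vK X] by blast
      then have "X \<in> pencil_forms e F K" using X by (auto simp: pencil_forms_def)
      then obtain A B where AB: "X = A * F + B * K" "is_form (e - e) A" "is_form (e - e) B"
        using pencil_formsE[OF _ F(1) K] by metis
      then obtain a b where "A = const a" "B = const b" using is_form_0_const by (metis diff_self_eq_0)
      then have "X = smult_tpoly a F + smult_tpoly b K" using AB(1) by (simp add: smult_tpoly_def)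
      then show ?thesis by (simp add: tpoly.span_add tpoly.span_scale tpoly.span_base)
    qed
    then have "{F, G, H} \<subseteq> tpoly.span {F, K}" by blast
    then have "card {F, G, H} \<le> card {F, K}"
      using tpoly.independent_span_bound[of "{F, K}" "{F, G, H}"] lin_indep3_independent(1)[OF ind] by simp
    also have "\<dots> \<le> 2" by (simp add: card_insert_if)
    finally show False using lin_indep3_independent(2)[OF ind] by simp
  qed
  then show ?thesis using le by linarith
qed

text \<open>If the three forms had a common factor \<open>h\<close> of degree \<open>m\<close>, at most \<open>(d - m)\<^sup>2 - 1\<close> points of \<open>Z\<close>
  would lie off the curve \<open>h = 0\<close>, which leaves too many on it.\<close>

lemma no_common_factor_basis:
  assumes FGH: "F \<in> forms_through d Z" "G \<in> forms_through d Z" "H \<in> forms_through d Z" and ind: "lin_indep3 F G H"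
  shows "no_common_factor {F, G, H}"
proof -
  have F: "is_form d F" "is_form d G" "is_form d H" "vanishes_on F Z" "vanishes_on G Z" "vanishes_on H Z"
    using FGH by (auto simp: forms_through_def)
  have F0: "F \<noteq> 0" using ind by (rule lin_indep3_neq_0)
  obtain h F' G' H' where h: "F = h * F'" "G = h * G'" "H = h * H'" and cop: "no_common_factor {F', G', H'}"
    by (rule ex_greatest_common_factor[OF F0])
  have "h dvd F" using h by simp
  obtain m q where m: "m \<le> d" "is_form m h" "is_form (d - m) q" "F = h * q"
    by (rule is_form_dvd[OF F(1) F0 \<open>h dvd F\<close>])
  have h0: "h \<noteq> 0" using h F0 by auto
  have ind': "lin_indep3 F' G' H'"
    unfolding lin_indep3_def
  proof (intro allI impI)
    fix a b c assume "const a * F' + const b * G' + const c * H' = 0"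
    then have "h * (const a * F' + const b * G' + const c * H') = 0" by simp
    then have "const a * F + const b * G + const c * H = 0" unfolding h by (simp add: algebra_simps)
    then show "a = 0 \<and> b = 0 \<and> c = 0" using ind unfolding lin_indep3_def by blast
  qed
  define e where "e = d - m"
  have cofactor: "is_form e X'" if X: "is_form d X" "X = h * X'" for X X'
  proof (cases "X' = 0")
    case False
    then have "X \<noteq> 0" "h dvd X" using X h0 by auto
    then obtain k r where k: "is_form k h" "is_form (d - k) r" "X = h * r" using is_form_dvd[OF X(1)] by metis
    then have "k = m" using m h0 is_form_deg_unique by blast
    then show ?thesis using k X h0 by (simp add: e_def)
  qed simp
  have F': "is_form e F'" "is_form e G'" "is_form e H'" using cofactor F h by blast+
  show ?thesis
  proof (cases "m = 0")
    case True
    then obtain c where c: "h = const c" using is_form_0_const m(2) by blast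
    then have "c \<noteq> 0" using h0 by auto
    have "q dvd 1" if q: "\<forall>a\<in>{F, G, H}. q dvd a" for q
    proof -
      have "const (inverse c) * (h * X) = X" for X
        using \<open>c \<noteq> 0\<close> unfolding c by (simp flip: mult.assoc const_mult)
      then have "q dvd X" if "q dvd h * X" for X using that by (metis dvd_mult)
      then show ?thesis using q cop unfolding h no_common_factor_def by blast
    qed
    then show ?thesis by (auto simp: no_common_factor_def)
  next
    case False
    \<comment> \<open>Otherwise the cofactors are constants, and any two constants are
      proportional.\<close>
    have "m \<noteq> d"
    proof
      assume "m = d"
      then obtain a b where ab: "F' = const a" "G' = const b" using F' is_form_0_const unfolding e_def by (metis diff_self_eq_0)
      have "const b * F' + const (- a) * G' + const 0 * H' = 0"
        unfolding ab by (simp add: const_minus mult.commute)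
      then have "a = 0" "b = 0" using ind' unfolding lin_indep3_def by (metis neg_equal_0_iff_equal)+
      then show False using lin_indep3_neq_0[OF ind'] ab by simp
    qed
    then have e: "e \<ge> 1" and dme: "d = m + e" using m(1) by (auto simp: e_def)
    let ?S = "{p \<in> Z. eval_tpoly h (rep p) \<noteq> 0}"
    have S: "?S \<subseteq> proj_plane" "finite ?S" using Z by auto
    have "vanishes_on X' ?S" if "vanishes_on X Z" "is_form d X" "X = h * X'" for X X'
    proof -
      have "eval_tpoly X' (rep p) = 0" if "p \<in> ?S" for p
      proof -
        have "eval_tpoly X (rep p) = 0"
          using vanishes_on_iff[OF \<open>is_form d X\<close> Z(1)] \<open>vanishes_on X Z\<close> that by blast
        then show ?thesis using that \<open>X = h * X'\<close> by simp
      qed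
      then show ?thesis using vanishes_on_iff[OF cofactor[OF that(2,3)] S(1)] by blast
    qed
    then have "card ?S < e * e"
      using card_common_zeros_less[OF e F' ind' cop S] F h by blast
    moreover have "card Z = card ?S + card {p \<in> Z. eval_tpoly h (rep p) = 0}"
      using Z(2) by (subst card_Un_disjoint[symmetric]) (auto intro: arg_cong[where f = card])
    \<comment> \<open>With at most \<open>e * e - 1\<close> points off the curve, at least
      \<open>m * d + 1 + (m - 1) * (e - 1)\<close> lie on it. The extra 1 is what a line,
      \<open>m = 1\<close>, requires.\<close>
    moreover have "d ^ 2 - d + 1 = e * e + m * d + (m - 1) * (e - 1)"
    proof -
      obtain m' where m': "m = Suc m'" using False by (cases m) auto
      obtain e' where e': "e = Suc e'" using e by (cases e) auto
      show ?thesis unfolding dme m' e' power2_eq_square by (simp add: algebra_simps)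
    qed
    ultimately have "card {p \<in> Z. eval_tpoly h (rep p) = 0} \<ge> m * d + 1" using Z(3) by linarith
    then have "card {p \<in> Z. eval_tpoly h (rep p) = 0} \<ge> (if m = 1 then d + 1 else m * d)" by auto
    moreover have "1 \<le> m" "m \<le> d - 1" using False e dme by auto
    ultimately have False using card_on_curve_less h0 m(2) by blast
    then show ?thesis ..
  qed
qed

text \<open>Coprimality gives \<open>P = - (w * N)\<close> and \<open>Q = u * N\<close> with
  \<open>N\<close> of degree \<open>d - 1\<close>. A point of \<open>Z\<close> off
  \<open>N = 0\<close> lies on both lines, so there is at most one, and the other
  \<open>(d - 1) * d\<close> points violate condition (3) for \<open>k = d - 1\<close>.\<close>

lemma reducible_syzygy:
  assumes u: "is_form 1 u" "u \<noteq> 0" and w: "is_form 1 w" "w \<noteq> 0" and cop: "no_common_factor {u, w}"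
    and PQ: "P \<in> forms_through d Z" "Q \<in> forms_through d Z" "P \<noteq> 0 \<or> Q \<noteq> 0" and syz: "u * P + w * Q = 0"
  shows False
proof -
  have "Q * w = u * (- P)" using syz by (simp add: eq_neg_iff_add_eq_0 add.commute mult.commute)
  then have "u dvd Q * w" by simp
  then have "u dvd Q" by (rule no_common_factor_pair_dvd[OF cop])
  then obtain N where Q: "Q = u * N" by (elim dvdE)
  have "u * (P + w * N) = 0" using syz unfolding Q by (simp add: algebra_simps)
  then have P: "P = - (w * N)" using u by (simp add: add_eq_0_iff2)
  have N: "N \<noteq> 0" using P Q PQ by auto
  then have "Q \<noteq> 0" using Q u by simp
  have Qf: "is_form d Q" "vanishes_on Q Z" and Pf: "is_form d P" "vanishes_on P Z" using PQ by (auto simp: forms_through_def)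
  obtain k r where k: "is_form k u" "is_form (d - k) r" "Q = u * r"
    by (rule is_form_dvd[OF Qf(1) \<open>Q \<noteq> 0\<close> \<open>u dvd Q\<close>])
  then have "k = 1" using u is_form_deg_unique by blast
  then have Nf: "is_form (d - 1) N" using k Q u by simp
  let ?S = "{p \<in> Z. eval_tpoly N (rep p) \<noteq> 0}"
  have S: "?S \<subseteq> proj_plane" "finite ?S" using Z by auto
  have "eval_tpoly u (rep p) = 0 \<and> eval_tpoly w (rep p) = 0" if "p \<in> ?S" for p
  proof -
    have "eval_tpoly Q (rep p) = 0" "eval_tpoly P (rep p) = 0"
      using that vanishes_on_iff[OF Qf(1) Z(1)] vanishes_on_iff[OF Pf(1) Z(1)] Qf Pf by auto
    then show ?thesis using that unfolding P Q by simp
  qed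
  then have "vanishes_on u ?S" "vanishes_on w ?S"
    using vanishes_on_iff[OF u(1) S(1)] vanishes_on_iff[OF w(1) S(1)] by blast+
  then have "card ?S \<le> 1 * 1" by (rule Bezout_bound[OF u w cop S(2,1)])
  moreover have "card Z = card ?S + card {p \<in> Z. eval_tpoly N (rep p) = 0}"
    using Z(2) by (subst card_Un_disjoint[symmetric]) (auto intro: arg_cong[where f = card])
  moreover have "d ^ 2 - d = (d - 1) * d" by (simp add: power2_eq_square diff_mult_distrib)
  ultimately have "card {p \<in> Z. eval_tpoly N (rep p) = 0} \<ge> (if d - 1 = 1 then d + 1 else (d - 1) * d)"
    using Z(3) d by simp
  moreover have "1 \<le> d - 1" "d - 1 \<le> d - 1" using d by auto
  ultimately show False using card_on_curve_less N Nf by blast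
qed

text \<open>A constant relation with \<open>c i \<noteq> 0\<close> eliminates \<open>M i\<close>
  from the linear syzygy. What remains is a syzygy of \<open>M j\<close> and \<open>M k\<close> with
  coprime linear coefficients \<open>u\<close> and \<open>w\<close>, excluded by
  \<open>reducible_syzygy\<close>.\<close>

lemma syzygy_independent:
  assumes M: "\<And>i. M i \<in> forms_through d Z" "M i0 \<noteq> 0"
    and syz: "var 1 * M 1 + var 2 * M 2 + var 3 * M (3 :: 3) = 0"
  shows "lin_indep3 (M 1) (M 2) (M 3)"
proof -
  have key: "c i = 0" if ijk: "i \<noteq> j" "i \<noteq> k" "j \<noteq> k" and rel: "const (c i) * M i + const (c j) * M j + const (c k) * M k = 0"
    and syz': "var i * M i + var j * M j + var k * M k = 0" for c :: "3 \<Rightarrow> complex" and i j k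
  proof (rule ccontr)
    assume ci: "c i \<noteq> 0"
    define u w where "u = const (c i) * var j - const (c j) * var i" and "w = const (c i) * var k - const (c k) * var i"
    let ?v = "\<chi> l. if l = k then 1 else (0 :: complex)"
    let ?v' = "\<chi> l. if l = j then 1 else (0 :: complex)"
    have uw: "is_form 1 u" "is_form 1 w" unfolding u_def w_def by (intro is_form_diff is_form_const_mult is_form_var)+
    have ev: "eval_tpoly u ?v = 0" "eval_tpoly w ?v \<noteq> 0" "eval_tpoly u ?v' \<noteq> 0"
      using ijk ci by (simp_all add: u_def w_def)
    then have nz: "u \<noteq> 0" "w \<noteq> 0" by auto
    have "u * M j + w * M k = const (c i) * (var i * M i + var j * M j + var k * M k) -
        var i * (const (c i) * M i + const (c j) * M j + const (c k) * M k)"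
      unfolding u_def w_def by (simp add: algebra_simps)
    then have "u * M j + w * M k = 0" using rel syz' by simp
    moreover have "M j \<noteq> 0 \<or> M k \<noteq> 0"
    proof (rule ccontr)
      assume "\<not> ?thesis"
      then have jk: "M j = 0" "M k = 0" by auto
      then have "M i = 0" using rel ci by simp
      moreover have "i0 = i \<or> i0 = j \<or> i0 = k" using ijk exhaust_3[of i] exhaust_3[of j] exhaust_3[of k] exhaust_3[of i0] by auto
      ultimately show False using M(2) jk by auto
    qed
    ultimately show False
      using reducible_syzygy[OF uw(1) nz(1) uw(2) nz(2) linear_forms_no_common_factor[OF uw(1) nz(1) ev(1,2)] M(1) M(1)] by blast
  qed
  show ?thesis
    unfolding lin_indep3_def
  proof (intro allI impI)
    fix a b c assume rel: "const a * M 1 + const b * M 2 + const c * M 3 = 0"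
    let ?c = "\<lambda>i :: 3. if i = 1 then a else if i = 2 then b else c"
    have "?c 1 = 0" by (rule key[of 1 2 3]) (use rel syz in simp_all)
    moreover have "?c 2 = 0" by (rule key[of 2 1 3]) (use rel syz in \<open>simp_all add: ac_simps\<close>)
    moreover have "?c 3 = 0" by (rule key[of 3 1 2]) (use rel syz in \<open>simp_all add: ac_simps\<close>)
    ultimately show "a = 0 \<and> b = 0 \<and> c = 0" by simp
  qed
qed

end

section \<open>The residual of a complete intersection\<close>

text \<open>\<open>F, G\<close> is a complete intersection of degree \<open>d\<^sup>2\<close> through \<open>Z\<close>, and \<open>q n\<close> is the dimension in
  degree \<open>d + n\<close> of \<open>(F, G, H) / (F, G)\<close>. It is at most \<open>d - 1\<close>, the degree of the residual scheme,
  and it increases strictly up to \<open>n = d - 2\<close>, since otherwise \<open>H\<close> would annihilate a power of the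
  maximal ideal modulo \<open>(F, G, l)\<close>. So \<open>q n = n + 1\<close> for \<open>n \<le> d - 2\<close>.\<close>

locale liaison = eigen_configuration +
  fixes F G H :: tpoly and t :: complex
  assumes FGH: "F \<in> forms_through d Z" "G \<in> forms_through d Z" "H \<in> forms_through d Z"
    and ind: "lin_indep3 F G H" and cop: "no_common_factor {F, G}"
    and rcop: "no_common_factor {restrict_line t F, restrict_line t G}"
    and avoid: "\<And>p. p \<in> Z \<Longrightarrow> eval_tpoly (generic_line t) (rep p) \<noteq> 0"
begin

abbreviation "l \<equiv> generic_line t"
abbreviation "r \<equiv> restrict_line t"
abbreviation "J n \<equiv> pencil_forms n F G"
definition "V n = {f. is_form n f \<and> f \<in> ideal3 F G H}"
definition "q n = int (tpoly.dim (V (d + n))) - int (tpoly.dim (J (d + n)))"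

lemma FGH_forms: "is_form d F" "is_form d G" "is_form d H"
  and FGH_vanish: "vanishes_on F Z" "vanishes_on G Z" "vanishes_on H Z"
  using FGH by (auto simp: forms_through_def)

lemma F_neq_0: "F \<noteq> 0" using ind by (rule lin_indep3_neq_0)

lemma G_neq_0: "G \<noteq> 0"
proof
  assume "G = 0"
  then have "const 0 * F + const 1 * G + const 0 * H = 0" by simp
  then show False using ind unfolding lin_indep3_def by (metis zero_neq_one)
qed

lemma restrict_neq_0: "r F \<noteq> 0" "r G \<noteq> 0"
proof -
  show "r F \<noteq> 0" using restrict_line_neq_0[OF rcop FGH_forms(2)] d by simp
  have "no_common_factor {r G, r F}" using rcop by (simp add: insert_commute)
  then show "r G \<noteq> 0" using restrict_line_neq_0[OF _ FGH_forms(1)] d by simp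
qed

lemma J_subset_V: "J n \<subseteq> V n"
proof
  fix f assume "f \<in> J n"
  then obtain A B where f: "is_form n f" "f = A * F + B * G + 0 * H" by (auto simp: pencil_forms_def)
  then show "f \<in> V n" unfolding V_def using ideal3I by blast
qed

lemma V_subset_I: "V n \<subseteq> forms_through n Z"
  using FGH_vanish by (auto simp: V_def ideal3_def forms_through_def vanishes_on_def)

lemma subspace_V: "tpoly.subspace (V n)"
  using ideal3_add ideal3_mult ideal.subspace_0[OF subspace_ideal3]
  by (auto simp: tpoly.subspace_def V_def is_form_add smult_tpoly_form smult_tpoly_def is_form_const_mult)

lemma forms_through_sub: "forms_through n Z \<subseteq> forms n"
  by (auto simp: forms_through_def)

lemma V_sub: "V n \<subseteq> forms n"
  by (auto simp: V_def)

lemma line_mult_form: "is_form n w \<Longrightarrow> is_form (Suc n) (l * w)"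
  using is_form_mult[OF is_form_generic_line] by simp

lemma cancel_line:
  assumes "is_form n w" "l * w \<in> J m"
  shows "w \<in> J n"
proof -
  obtain A B where "l * w = A * F + B * G" using assms(2) by (auto simp: pencil_forms_def)
  from generic_line_cancel_pencil[OF rcop restrict_neq_0(1) this] show ?thesis
    using assms(1) by (simp add: pencil_forms_def)
qed

text \<open>Multiplication by \<open>l\<close> is injective modulo \<open>(F, G)\<close>, so
  \<open>J (Suc n)\<close> meets \<open>l * W\<close> only inside \<open>l * J n\<close>;
  Grassmann's inequality gives the first claim. If the dimensions leave no room, the sum of
  \<open>J (Suc n)\<close> and \<open>l * W\<close> fills \<open>W'\<close>.\<close>

lemma growth:
  assumes W: "tpoly.subspace W" "W \<subseteq> forms n" and W': "tpoly.subspace W'" "W' \<subseteq> forms (Suc n)"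
    and lW: "\<And>w. w \<in> W \<Longrightarrow> l * w \<in> W'" and JW: "J (Suc n) \<subseteq> W'"
  shows "tpoly.dim W + tpoly.dim (J (Suc n)) \<le> tpoly.dim W' + tpoly.dim (J n)"
    and "tpoly.dim W' + tpoly.dim (J n) \<le> tpoly.dim W + tpoly.dim (J (Suc n)) \<Longrightarrow> f \<in> W' \<Longrightarrow>
      \<exists>j\<in>J (Suc n). \<exists>w\<in>W. f = j + l * w"
proof -
  let ?lW = "(*) l ` W"
  let ?X = "{x + y |x y. x \<in> J (Suc n) \<and> y \<in> ?lW}"
  have sub: "tpoly.subspace (J (Suc n))" "tpoly.subspace ?lW"
    using subspace_pencil_forms subspace_mult[OF W(1)] by blast+
  have X: "?X \<subseteq> W'" using JW lW tpoly.subspace_add[OF W'(1)] by blast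
  have "tpoly.dim (J (Suc n)) + tpoly.dim ?lW \<le> tpoly.dim ?X + tpoly.dim (J (Suc n) \<inter> ?lW)"
    by (rule dim_forms_sum_ge[OF sub]) (use X W'(2) in blast)+
  moreover have "J (Suc n) \<inter> ?lW \<subseteq> (*) l ` J n"
    using cancel_line W(2) by blast
  then have "tpoly.dim (J (Suc n) \<inter> ?lW) \<le> tpoly.dim ((*) l ` J n)"
    by (rule dim_forms_mono[where n = "Suc n"]) (auto simp: pencil_forms_def line_mult_form)
  ultimately have 1: "tpoly.dim W + tpoly.dim (J (Suc n)) \<le> tpoly.dim ?X + tpoly.dim (J n)"
    by (simp add: dim_mult[OF generic_line_neq_0])
  moreover have "tpoly.dim ?X \<le> tpoly.dim W'" using X W'(2) by (rule dim_forms_mono)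
  ultimately show "tpoly.dim W + tpoly.dim (J (Suc n)) \<le> tpoly.dim W' + tpoly.dim (J n)" by linarith
  assume "tpoly.dim W' + tpoly.dim (J n) \<le> tpoly.dim W + tpoly.dim (J (Suc n))" and f: "f \<in> W'"
  then have "tpoly.dim W' \<le> tpoly.dim ?X" using 1 by linarith
  then have "?X = W'" using subspace_forms_eq[OF X W'(2) tpoly.subspace_sums[OF sub]] by blast
  then show "\<exists>j\<in>J (Suc n). \<exists>w\<in>W. f = j + l * w" using f by blast
qed

text \<open>In large degrees the codimensions differ by at most
  \<open>d * d - card Z = d - 1\<close>. By \<open>growth\<close> the difference does not decrease
  with the degree, so the bound descends to all \<open>n\<close>.\<close>

lemma dim_forms_through_upper: "tpoly.dim (forms_through n Z) \<le> tpoly.dim (J n) + (d - 1)"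
proof (cases "n \<ge> d + d + card Z")
  case True
  have "tpoly.dim (forms_through n Z) + card Z \<le> tpoly.dim (forms n)"
    using dim_forms_through_le[OF Z(2,1)] True by simp
  moreover have "tpoly.dim (forms n) \<le> tpoly.dim (J n) + d * d"
    using dim_pencil_forms_ge[OF FGH_forms(1) F_neq_0 FGH_forms(2) G_neq_0 cop] True by simp
  moreover have "d * d = card Z + (d - 1)" using Z(3) d by (simp add: power2_eq_square)
  ultimately show ?thesis by linarith
next
  case False
  then have "n \<le> d + d + card Z" by simp
  then show ?thesis
  proof (induction rule: inc_induct)
    case base
    have "tpoly.dim (forms_through (d + d + card Z) Z) + card Z \<le> tpoly.dim (forms (d + d + card Z))"
      using dim_forms_through_le[OF Z(2,1)] by simp
    moreover have "tpoly.dim (forms (d + d + card Z)) \<le> tpoly.dim (J (d + d + card Z)) + d * d"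
      using dim_pencil_forms_ge[OF FGH_forms(1) F_neq_0 FGH_forms(2) G_neq_0 cop] by simp
    moreover have "d * d = card Z + (d - 1)" using Z(3) d by (simp add: power2_eq_square)
    ultimately show ?case by linarith
  next
    case (step n)
    have "tpoly.dim (forms_through n Z) + tpoly.dim (J (Suc n)) \<le> tpoly.dim (forms_through (Suc n) Z) + tpoly.dim (J n)"
    proof (rule growth(1))
      show "l * w \<in> forms_through (Suc n) Z" if "w \<in> forms_through n Z" for w
        using that by (auto simp: forms_through_def vanishes_on_def line_mult_form)
      show "J (Suc n) \<subseteq> forms_through (Suc n) Z" using J_subset_V V_subset_I by blast
    qed (rule subspace_forms_through forms_through_sub)+
    then show ?case using step.IH by linarith
  qed
qed

text \<open>That is, \<open>h \<in> (F, G, l)\<close>.\<close>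

definition "restricted_mem h \<longleftrightarrow> (\<exists>A B. r h = A * r F + B * r G)"

lemma restricted_memI: "h = A * F + B * G + l * R \<Longrightarrow> restricted_mem h"
  unfolding restricted_mem_def by (auto simp: restrict_line_simps restrict_line_generic_line)

lemma restricted_mem_form:
  assumes "is_form n h" "restricted_mem h"
  obtains A B where "r h = A * r F + B * r G" "is_form (n - d) A" "is_form (n - d) B"
proof -
  have "r h \<in> pencil_forms n (r F) (r G)"
    using assms is_form_restrict_line by (auto simp: restricted_mem_def pencil_forms_def)
  then show ?thesis
    using pencil_formsE[OF _ is_form_restrict_line[OF FGH_forms(1), of t] is_form_restrict_line[OF FGH_forms(2), of t]] that by metis
qed

text \<open>The socle of \<open>\<complex>[x\<^sub>2, x\<^sub>3] / (F, G)\<close> lives in degree \<open>2d - 2\<close>.\<close>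

lemma socle:
  assumes h: "is_form n h" "d \<le> Suc n" "n < 2 * d - 2" and mem: "restricted_mem (var 2 * h)" "restricted_mem (var 3 * h)"
  shows "restricted_mem h"
proof -
  have f: "is_form (Suc n) (var i * h)" for i using is_form_mult[OF is_form_var h(1)] by simp
  obtain A B where AB: "r (var 2 * h) = A * r F + B * r G" "is_form (Suc n - d) A" "is_form (Suc n - d) B"
    by (rule restricted_mem_form[OF f mem(1)])
  obtain A' B' where AB': "r (var 3 * h) = A' * r F + B' * r G" "is_form (Suc n - d) A'" "is_form (Suc n - d) B'"
    by (rule restricted_mem_form[OF f mem(2)])
  have r2: "var 2 * r h = A * r F + B * r G" and r3: "var 3 * r h = A' * r F + B' * r G"
    using AB(1) AB'(1) by (simp_all add: restrict_line_simps)
  define D E where "D = var 3 * A - var 2 * A'" and "E = var 3 * B - var 2 * B'"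
  have "D * r F + E * r G = var 3 * (A * r F + B * r G) - var 2 * (A' * r F + B' * r G)"
    unfolding D_def E_def by (simp add: algebra_simps)
  also have "\<dots> = 0" unfolding r2[symmetric] r3[symmetric] by (simp add: mult.left_commute)
  finally have DE: "D * r F + E * r G = 0" .
  have forms: "is_form (Suc (Suc n - d)) D"
    using is_form_diff[OF is_form_mult[OF is_form_var AB(2)] is_form_mult[OF is_form_var AB'(2)]] unfolding D_def by simp
  \<comment> \<open>The relations for \<open>var 2 * h\<close> and \<open>var 3 * h\<close>
    eliminate \<open>r h\<close>, leaving a syzygy \<open>(D, E)\<close> of \<open>r F\<close> and
    \<open>r G\<close>. So \<open>r G\<close>, of degree \<open>d\<close>, divides \<open>D\<close>,
    of degree \<open>n + 2 - d < d\<close>; here the bound \<open>n < 2 * d - 2\<close>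
    enters.\<close>
  have "D = 0"
  proof (rule ccontr)
    assume "D \<noteq> 0"
    have "D * r F = r G * (- E)" using DE by (simp add: eq_neg_iff_add_eq_0 mult.commute)
    then have "r G dvd D * r F" by simp
    then have "r G dvd D" using no_common_factor_pair_dvd[of "r G" "r F" D] rcop by (simp add: insert_commute)
    obtain k s where k: "k \<le> Suc (Suc n - d)" "is_form k (r G)" "is_form (Suc (Suc n - d) - k) s" "D = r G * s"
      by (rule is_form_dvd[OF forms \<open>D \<noteq> 0\<close> \<open>r G dvd D\<close>])
    then have "k = d" using is_form_restrict_line[OF FGH_forms(2), of t] restrict_neq_0(2) is_form_deg_unique by blast
    then show False using k(1) h d by linarith
  qed
  then have "E = 0" using DE restrict_neq_0 by simp
  have cop23: "no_common_factor {var 2, var 3}" by (rule no_common_factor_vars) simp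
  have "A * var 3 = var 2 * A'" "B * var 3 = var 2 * B'"
    using \<open>D = 0\<close> \<open>E = 0\<close> by (simp_all add: D_def E_def mult.commute)
  then have "var 2 dvd A * var 3" "var 2 dvd B * var 3" by simp_all
  then have "var 2 dvd A" "var 2 dvd B" using no_common_factor_pair_dvd[OF cop23] by blast+
  then obtain A2 B2 where "A = var 2 * A2" "B = var 2 * B2" by (meson dvdE)
  then have "var 2 * r h = var 2 * (A2 * r F + B2 * r G)" using r2 by (simp add: algebra_simps)
  then have "r h = A2 * r F + B2 * r G" using var_neq_0 mult_left_cancel by blast
  then show ?thesis unfolding restricted_mem_def by blast
qed

text \<open>Otherwise \<open>H = a F + b G + K l\<close> with \<open>K\<close> of degree
  \<open>d - 1\<close>, and \<open>K\<close> vanishes on \<open>Z\<close> because \<open>l\<close>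
  misses \<open>Z\<close>. The three multiples \<open>var i * K\<close> would then span all forms of
  degree \<open>d\<close> through \<open>Z\<close>, giving \<open>F\<close> and \<open>G\<close> the
  common factor \<open>K\<close>.\<close>

lemma not_restricted_mem_H: "\<not> restricted_mem H"
proof
  assume "restricted_mem H"
  then obtain A B where AB: "r H = A * r F + B * r G" by (auto simp: restricted_mem_def)
  obtain H2 where H2: "H = r H + l * H2" by (rule restrict_line_decomp)
  obtain F2 where F2: "F = r F + l * F2" by (rule restrict_line_decomp)
  obtain G2 where G2: "G = r G + l * G2" by (rule restrict_line_decomp)
  have "H = A * r F + B * r G + l * H2" using H2 AB by simp
  also have "\<dots> = A * (r F + l * F2) + B * (r G + l * G2) + l * (H2 - A * F2 - B * G2)"
    by (simp add: algebra_simps)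
  finally have "H = A * F + B * G + (H2 - A * F2 - B * G2) * l"
    using F2 G2 by (simp add: mult.commute)
  then have "hcomp d H = hcomp d (A * F + B * G + (H2 - A * F2 - B * G2) * l)" by simp
  then have H: "H = hcomp 0 A * F + hcomp 0 B * G + hcomp (d - 1) (H2 - A * F2 - B * G2) * l"
    using FGH_forms d
    by (simp add: hcomp_add hcomp_mult_form[OF FGH_forms(1)] hcomp_mult_form[OF FGH_forms(2)]
        hcomp_mult_form[OF is_form_generic_line] is_form_iff_hcomp)
  define K where "K = hcomp (d - 1) (H2 - A * F2 - B * G2)"
  have K: "is_form (d - 1) K" by (simp add: K_def is_form_hcomp)
  obtain a b where ab: "hcomp 0 A = const a" "hcomp 0 B = const b" using is_form_hcomp is_form_0_const by blast
  have H: "H = const a * F + const b * G + K * l" using H unfolding ab K_def .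
  have "K \<noteq> 0" using H lin_indep3_not_in_pencil[OF ind, of a b] by auto
  have Kz: "eval_tpoly K (rep p) = 0" if "p \<in> Z" for p
  proof -
    have "eval_tpoly F (rep p) = 0" "eval_tpoly G (rep p) = 0" "eval_tpoly H (rep p) = 0"
      using FGH_vanish that vanishes_on_iff[OF FGH_forms(1) Z(1)] vanishes_on_iff[OF FGH_forms(2) Z(1)]
        vanishes_on_iff[OF FGH_forms(3) Z(1)] by blast+
    moreover have "eval_tpoly H (rep p) = a * eval_tpoly F (rep p) + b * eval_tpoly G (rep p) + eval_tpoly K (rep p) * eval_tpoly l (rep p)"
      by (subst H) simp
    ultimately show ?thesis using avoid[OF that] by simp
  qed
  have form: "is_form d (var i * K)" for i using is_form_mult[OF is_form_var K] d by simp
  have "vanishes_on (var i * K) Z" for i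
    using vanishes_on_iff[OF form Z(1)] Kz by simp
  then have mem: "var i * K \<in> forms_through d Z" for i using form by (simp add: forms_through_def)
  have "lin_indep3 (var 1 * K) (var 2 * K) (var 3 * K)"
    unfolding lin_indep3_def
  proof (intro allI impI)
    fix a b c assume "const a * (var 1 * K) + const b * (var 2 * K) + const c * (var 3 * K) = 0"
    then have "(const a * var 1 + const b * var 2 + const c * var 3) * K = 0" by (simp add: algebra_simps)
    then have L0: "const a * var 1 + const b * var 2 + const c * var 3 = 0" using \<open>K \<noteq> 0\<close> by simp
    have ev: "a * v $ 1 + b * v $ 2 + c * v $ 3 = 0" for v :: "complex ^ 3"
      using arg_cong[OF L0, of "\<lambda>f. eval_tpoly f v"] by simp
    show "a = 0 \<and> b = 0 \<and> c = 0"
      using ev[of "\<chi> i. if i = 1 then 1 else 0"] ev[of "\<chi> i. if i = 2 then 1 else 0"] ev[of "\<chi> i. if i = 3 then 1 else 0"]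
      by simp
  qed
  from span_basis[OF mem mem mem this]
  have *: "forms_through d Z = {const a * (var 1 * K) + const b * (var 2 * K) + const c * (var 3 * K) |a b c. True}"
    unfolding span_triple .
  have "K dvd X" if "X \<in> forms_through d Z" for X
    using that unfolding * by (auto intro!: dvd_add)
  then have "K dvd 1" using cop FGH by (auto simp: no_common_factor_def)
  then obtain c where c: "c \<noteq> 0" "K = const c" using dvd_1_iff_const by blast
  then show False using is_form_deg_unique[OF K is_form_const[of c, folded c(2)] \<open>K \<noteq> 0\<close>] d by simp
qed

lemma q_step:
  assumes n: "n + 3 \<le> d"
  shows "q n + 1 \<le> q (Suc n)"
proof -
  have growthV: "tpoly.subspace (V k)" "V k \<subseteq> forms k" "\<And>w. w \<in> V k \<Longrightarrow> l * w \<in> V (Suc k)" "J (Suc k) \<subseteq> V (Suc k)" for k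
    using subspace_V V_sub J_subset_V line_mult_form ideal3_mult by (auto simp: V_def)
  have "tpoly.dim (V (d + n)) + tpoly.dim (J (Suc (d + n))) \<le> tpoly.dim (V (Suc (d + n))) + tpoly.dim (J (d + n))"
    by (rule growth(1)[OF growthV(1,2) growthV(1,2)]) (use growthV in blast)+
  then have "q n \<le> q (Suc n)" by (simp add: q_def)
  moreover have "q n \<noteq> q (Suc n)"
  proof
    assume "q n = q (Suc n)"
    then have le: "tpoly.dim (V (Suc (d + n))) + tpoly.dim (J (d + n)) \<le> tpoly.dim (V (d + n)) + tpoly.dim (J (Suc (d + n)))"
      by (simp add: q_def)
    \<comment> \<open>Equality makes multiplication by \<open>l\<close> surjective modulo
      \<open>(F, G)\<close>, so every form of degree \<open>Suc n\<close> carries \<open>H\<close>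
      into \<open>(F, G, l)\<close>.\<close>
    have start: "restricted_mem (P * H)" if P: "is_form (Suc n) P" for P
    proof -
      have "0 * F + 0 * G + P * H \<in> ideal3 F G H" by (rule ideal3I)
      then have "P * H \<in> V (Suc (d + n))"
        using is_form_mult[OF P FGH_forms(3)] by (simp add: V_def add.commute)
      have "\<exists>j\<in>J (Suc (d + n)). \<exists>w\<in>V (d + n). P * H = j + l * w"
        by (rule growth(2)[OF growthV(1,2) growthV(1,2) _ _ le \<open>P * H \<in> _\<close>]) (use growthV in blast)+
      then obtain j w where "j \<in> J (Suc (d + n))" "P * H = j + l * w" by blast
      then show ?thesis by (auto simp: pencil_forms_def intro: restricted_memI)
    qed
    have up: "restricted_mem (P * H)" if "Suc n \<le> m" "is_form m P" for m P
      using that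
    proof (induction m arbitrary: P rule: dec_induct)
      case base
      then show ?case by (rule start)
    next
      case (step m)
      obtain Q :: "3 \<Rightarrow> tpoly" where Q: "\<And>i. is_form m (Q i)" "P = var 1 * Q 1 + var 2 * Q 2 + var 3 * Q 3"
        using form_decomp_vars[OF step.prems] by blast
      have "\<forall>i. \<exists>A B. r (Q i * H) = A * r F + B * r G" using step.IH[OF Q(1)] by (simp add: restricted_mem_def)
      then obtain A B where AB: "\<And>i. r (Q i * H) = A i * r F + B i * r G" by metis
      have "r (P * H) = r (var 1) * r (Q 1 * H) + r (var 2) * r (Q 2 * H) + r (var 3) * r (Q 3 * H)"
        unfolding Q(2) by (simp add: restrict_line_simps(1,2) distrib_right mult.assoc)
      also have "\<dots> = (r (var 1) * A 1 + r (var 2) * A 2 + r (var 3) * A 3) * r F +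
          (r (var 1) * B 1 + r (var 2) * B 2 + r (var 3) * B 3) * r G"
        unfolding AB by (simp add: algebra_simps)
      finally show ?case unfolding restricted_mem_def by blast
    qed
    \<comment> \<open>The degree \<open>d + m\<close> of \<open>P * H\<close> is below
      \<open>2 * d - 2\<close> when \<open>m < d - 2\<close>, so \<open>socle\<close> descends from
      \<open>m = d - 2\<close> to \<open>m = 0\<close>, that is, to \<open>H\<close> itself.\<close>
    have down: "restricted_mem (P * H)" if "m \<le> d - 2" "is_form m P" for m P
      using that
    proof (induction m arbitrary: P rule: inc_induct)
      case base
      then show ?case by (rule up[rotated]) (use n in simp)
    next
      case (step m)
      have "restricted_mem (var i * (P * H))" for i
      proof -
        have "is_form (Suc m) (var i * P)" using is_form_mult[OF is_form_var step.prems] by simp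
        from step.IH[OF this] show ?thesis by (simp add: mult.assoc)
      qed
      then show ?case
        by (intro socle[OF is_form_mult[OF step.prems FGH_forms(3)]]) (use step.hyps d in simp_all)
    qed
    have "restricted_mem (1 * H)" by (rule down[of 0]) simp_all
    then show False using not_restricted_mem_H by simp
  qed
  ultimately show ?thesis by linarith
qed

lemma q_0: "q 0 \<ge> 1"
proof (rule ccontr)
  assume "\<not> q 0 \<ge> 1"
  then have "tpoly.dim (V d) \<le> tpoly.dim (J d)" by (simp add: q_def)
  then have "J d = V d" using subspace_forms_eq[OF J_subset_V V_sub subspace_pencil_forms] by blast
  moreover have "H \<in> V d" using FGH_forms ideal3_generators by (simp add: V_def)
  ultimately have "H \<in> J d" by simp
  then obtain A B where AB: "H = A * F + B * G" "is_form (d - d) A" "is_form (d - d) B"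
    using pencil_formsE[OF _ FGH_forms(1,2)] by metis
  then obtain a b where "A = const a" "B = const b" using is_form_0_const by (metis diff_self_eq_0)
  then show False using AB(1) lin_indep3_not_in_pencil[OF ind] by blast
qed

lemma q_increase: "k \<le> n \<Longrightarrow> n + 2 \<le> d \<Longrightarrow> q k + int (n - k) \<le> q n"
proof (induction n rule: dec_induct)
  case (step n)
  then show ?case using q_step[of n] by (simp add: Suc_diff_le)
qed simp

lemma q_upper: "q n \<le> int (d - 1)"
proof -
  have "tpoly.dim (V (d + n)) \<le> tpoly.dim (forms_through (d + n) Z)"
    using V_subset_I forms_through_sub by (rule dim_forms_mono)
  then show ?thesis using dim_forms_through_upper[of "d + n"] by (simp add: q_def)
qed

lemma q_large: "d - 2 \<le> n \<Longrightarrow> q n \<ge> int (d - 1)"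
proof (induction n rule: dec_induct)
  case base
  have "q 0 + int (d - 2 - 0) \<le> q (d - 2)" by (rule q_increase) (use d in simp_all)
  then show ?case using q_0 d by simp
next
  case (step n)
  have "tpoly.dim (V (d + n)) + tpoly.dim (J (Suc (d + n))) \<le> tpoly.dim (V (Suc (d + n))) + tpoly.dim (J (d + n))"
    by (rule growth(1)) (use subspace_V V_sub J_subset_V line_mult_form ideal3_mult in \<open>auto simp: V_def\<close>)
  then have "q n \<le> q (Suc n)" by (simp add: q_def)
  then show ?case using step.IH by linarith
qed

text \<open>From degree \<open>2 * d - 2\<close> on, \<open>(F, G, H)\<close> modulo
  \<open>(F, G)\<close> attains the dimension \<open>d - 1\<close> that bounds all forms through
  \<open>Z\<close> modulo \<open>(F, G)\<close>.\<close>

lemma forms_through_eq_V: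
  assumes "2 * d - 2 \<le> n"
  shows "forms_through n Z = V n"
proof -
  obtain m where m: "n = d + m" "d - 2 \<le> m" using assms d by (intro that[of "n - d"]) auto
  have "tpoly.dim (forms_through n Z) \<le> tpoly.dim (V n)"
    using dim_forms_through_upper[of n] q_large[OF m(2)] unfolding q_def m(1) by linarith
  then show ?thesis using subspace_forms_eq[OF V_subset_I forms_through_sub subspace_V] by blast
qed

text \<open>If \<open>(F, G)\<close> contained no nonzero linear multiple of \<open>H\<close>, the
  three products with the variables would give \<open>q 1 \<ge> 3\<close>. Strict growth would then
  give \<open>q (d - 2) \<ge> d\<close>, above the bound \<open>d - 1\<close>.\<close>

lemma ex_linear_relation:
  obtains k A B where "is_form 1 k" "k \<noteq> 0" "is_form 1 A" "is_form 1 B" "A * F + B * G = k * H"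
proof -
  let ?U = "(*) H ` forms 1"
  have H0: "H \<noteq> 0" using lin_indep3_not_in_pencil[OF ind, of 0 0] by auto
  have "\<not> J (Suc d) \<inter> ?U \<subseteq> {0}"
  proof
    assume "J (Suc d) \<inter> ?U \<subseteq> {0}"
    then have "tpoly.dim (J (Suc d) \<inter> ?U) \<le> card ({} :: tpoly set)" by (intro tpoly.dim_le_card) simp_all
    moreover have "tpoly.dim (J (Suc d)) + tpoly.dim ?U \<le> tpoly.dim (V (Suc d)) + tpoly.dim (J (Suc d) \<inter> ?U)"
    proof (rule dim_forms_sum_ge[OF subspace_pencil_forms subspace_mult[OF subspace_forms] _ V_sub])
      fix u w assume u: "u \<in> J (Suc d)" and "w \<in> ?U"
      then obtain P where P: "is_form 1 P" "w = 0 * F + 0 * G + P * H" by (auto simp: mult.commute)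
      then have "w \<in> ideal3 F G H" by (simp only: ideal3I)
      moreover have "is_form (Suc d) w" using is_form_mult[OF P(1) FGH_forms(3)] P(2) by simp
      ultimately have "w \<in> V (Suc d)" by (simp add: V_def)
      then show "u + w \<in> V (Suc d)" using u J_subset_V tpoly.subspace_add[OF subspace_V] by blast
    qed
    moreover have "tpoly.dim ?U = 3" using dim_mult[OF H0, of "forms 1"] dim_forms[of 1] by simp
    ultimately have "q 1 \<ge> 3" by (simp add: q_def)
    moreover have "q 1 + int (d - 2 - 1) \<le> q (d - 2)" by (rule q_increase) (use d in simp_all)
    ultimately show False using q_upper[of "d - 2"] d by simp
  qed
  then obtain k where k: "is_form 1 k" "H * k \<in> J (Suc d)" "H * k \<noteq> 0" by blast
  obtain A B where "H * k = A * F + B * G" "is_form (Suc d - d) A" "is_form (Suc d - d) B"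
    by (rule pencil_formsE[OF k(2) FGH_forms(1,2)])
  moreover from this have "A * F + B * G = k * H" by (simp add: mult.commute[of k])
  ultimately show ?thesis using that[of k A B] k(1,3) by fastforce
qed

end

section \<open>The characterization\<close>

lemma finite_common_zeros:
  assumes "is_form a F" "F \<noteq> 0" "is_form b G" "G \<noteq> 0" "no_common_factor {F, G}"
  shows "finite {p \<in> proj_plane. eval_tpoly F (rep p) = 0 \<and> eval_tpoly G (rep p) = 0}" (is "finite ?X")
proof (rule ccontr)
  assume "infinite ?X"
  from infinite_arbitrarily_large[OF this, of "a * b + 1"]
  obtain S where "finite S \<and> card S = a * b + 1 \<and> S \<subseteq> ?X" by (rule exE)
  then have S: "S \<subseteq> ?X" "finite S" "card S = a * b + 1" by simp_all
  then have "S \<subseteq> proj_plane" by blast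
  moreover from this have "vanishes_on F S" "vanishes_on G S"
    using S(1) vanishes_on_iff[OF assms(1)] vanishes_on_iff[OF assms(3)] by blast+
  ultimately have "card S \<le> a * b" using Bezout_bound[OF assms S(2)] by blast
  then show False using S(3) by simp
qed

lemma ideal3_minimal:
  assumes "ideal.subspace I" "M1 \<in> I" "M2 \<in> I" "M3 \<in> I"
  shows "ideal3 M1 M2 M3 \<subseteq> I"
  using ideal.subspace_add[OF assms(1)] ideal.subspace_scale[OF assms(1)] assms(2-4)
  by (auto simp: ideal3_def)

lemma (in eigen_configuration) ex_minors:
  "\<exists>g. (\<forall>i. is_form (d - 1) (g i)) \<and>
    proj_scheme (ideal3 (minor g 2 3) (minor g 3 1) (minor g 1 2)) = proj_scheme (vanishing_ideal Z)"
proof -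
  obtain F F2 H where F: "F \<in> forms_through d Z" "F2 \<in> forms_through d Z" "H \<in> forms_through d Z"
    and ind0: "lin_indep3 F F2 H"
    by (rule ex_basis3[OF subspace_forms_through dim3])
  have cop3: "no_common_factor {F, F2, H}" by (rule no_common_factor_basis[OF F ind0])
  have F0: "F \<noteq> 0" using ind0 by (rule lin_indep3_neq_0)
  have Fd: "is_form d F" using F by (simp add: forms_through_def)
  obtain s where "no_common_factor {F + const s * F2 + const (s ^ 2) * H, F}"
    using generic_combination_coprime[OF cop3 F0] by blast
  moreover define G where "G = F + const s * F2 + const (s ^ 2) * H"
  ultimately have cop: "no_common_factor {F, G}" by (simp add: insert_commute)
  have nonunit: "\<not> F dvd 1"
  proof
    assume "F dvd 1"
    then obtain c where c: "c \<noteq> 0" "F = const c" using dvd_1_iff_const by blast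
    then show False using is_form_deg_unique[OF Fd is_form_const[of c, folded c(2)] F0] d by simp
  qed
  \<comment> \<open>Needed for \<open>F\<close>, \<open>G\<close>, \<open>H\<close> to remain a
    basis when \<open>G\<close> replaces \<open>F2\<close>.\<close>
  have "s \<noteq> 0"
  proof
    assume "s = 0"
    then have "G = F" by (simp add: G_def)
    then show False using cop nonunit by (auto simp: no_common_factor_def)
  qed
  have G: "G \<in> forms_through d Z"
    using F unfolding G_def forms_through_def by (auto intro!: is_form_add is_form_const_mult simp: vanishes_on_def)
  have ind: "lin_indep3 F G H"
    unfolding lin_indep3_def
  proof (intro allI impI)
    fix a b c assume "const a * F + const b * G + const c * H = 0"
    then have "const (a + b) * F + const (b * s) * F2 + const (b * s ^ 2 + c) * H = 0"
      unfolding G_def by (simp add: const_add const_mult algebra_simps)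
    then have "a + b = 0" "b * s = 0" "b * s ^ 2 + c = 0" using ind0 unfolding lin_indep3_def by blast+
    then show "a = 0 \<and> b = 0 \<and> c = 0" using \<open>s \<noteq> 0\<close> by simp
  qed
  have Gd: "is_form d G" using G by (simp add: forms_through_def)
  have G0: "G \<noteq> 0" using cop nonunit by (auto simp: no_common_factor_def)
  \<comment> \<open>\<open>Z\<close> together with any residual points. The line has to miss all
    common zeros of \<open>F\<close> and \<open>G\<close> for their restrictions to be
    coprime.\<close>
  let ?X = "{p \<in> proj_plane. eval_tpoly F (rep p) = 0 \<and> eval_tpoly G (rep p) = 0}"
  have "finite ?X" by (rule finite_common_zeros[OF Fd F0 Gd G0 cop])
  then obtain t where t: "\<forall>p\<in>?X. eval_tpoly (generic_line t) (rep p) \<noteq> 0"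
    using generic_line_avoids[of ?X] by blast
  have "Z \<subseteq> ?X"
    using F(1) G Z(1) vanishes_on_iff[OF Fd Z(1)] vanishes_on_iff[OF Gd Z(1)] by (auto simp: forms_through_def)
  have "no_common_factor (restrict_line t ` {F, G})"
  proof (rule no_common_factor_restrict_line)
    show "\<exists>n. is_form n f" if "f \<in> {F, G}" for f using that Fd Gd by blast
    fix v :: "complex ^ 3" assume v: "v \<noteq> 0" "eval_tpoly (generic_line t) v = 0"
    show "\<exists>f\<in>{F, G}. eval_tpoly f v \<noteq> 0"
    proof (rule ccontr)
      assume "\<not> ?thesis"
      then have "vec.span {v} \<in> ?X"
        using span_in_proj_plane[OF v(1)] eval_rep_span[OF Fd v(1)] eval_rep_span[OF Gd v(1)] by simp
      then show False using t eval_rep_span[OF is_form_generic_line v(1)] v(2) by blast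
    qed
  qed
  then have rcop: "no_common_factor {restrict_line t F, restrict_line t G}" by simp
  interpret liaison d Z F G H t
    by unfold_locales (use F G ind cop rcop t \<open>Z \<subseteq> ?X\<close> in auto)
  obtain k A B where k: "is_form 1 k" "k \<noteq> 0" and A: "is_form 1 A" and B: "is_form 1 B" and rel: "A * F + B * G = k * H"
    by (rule ex_linear_relation)
  obtain a where a: "A = const (a 1) * var 1 + const (a 2) * var 2 + const (a (3::3)) * var 3"
    using linear_form_coeffs[OF A] by blast
  obtain b where b: "B = const (b 1) * var 1 + const (b 2) * var 2 + const (b (3::3)) * var 3"
    using linear_form_coeffs[OF B] by blast
  obtain c where c: "k = const (c 1) * var 1 + const (c 2) * var 2 + const (c (3::3)) * var 3"
    using linear_form_coeffs[OF k(1)] by blast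
  \<comment> \<open>The coefficient of \<open>var i\<close> in the relation
    \<open>A * F + B * G - k * H = 0\<close>, once its linear coefficients are expanded.\<close>
  define M where "M i = const (a i) * F + const (b i) * G + const (- c i) * H" for i
  have Mmem: "M i \<in> forms_through d Z" for i
    using FGH unfolding M_def forms_through_def by (auto intro!: is_form_add is_form_const_mult simp: vanishes_on_def)
  have "\<exists>i. c i \<noteq> 0"
  proof (rule ccontr)
    assume "\<not> ?thesis"
    then show False using c k(2) by simp
  qed
  then obtain i0 where "c i0 \<noteq> 0" by blast
  then have M0: "M i0 \<noteq> 0" using ind unfolding lin_indep3_def M_def by (metis neg_equal_0_iff_equal)
  have "var 1 * M 1 + var 2 * M 2 + var 3 * M 3 = A * F + B * G - k * H"
    unfolding M_def a b c by (simp add: const_minus algebra_simps)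
  then have syz: "var 1 * M 1 + var 2 * M 2 + var 3 * M 3 = 0" using rel by simp
  have Mind: "lin_indep3 (M 1) (M 2) (M 3)" by (rule syzygy_independent[where M = M, OF Mmem M0 syz])
  have Md: "is_form d (M i)" for i using Mmem by (simp add: forms_through_def)
  obtain g where g: "\<And>i. is_form (d - 1) (g i)" "M 1 = minor g 2 3" "M 2 = minor g 3 1" "M 3 = minor g 1 2"
    using Koszul[OF Md Md Md _ syz] d by auto
  let ?I = "ideal3 (M 1) (M 2) (M 3)"
  have "forms_through d Z \<subseteq> ?I"
    unfolding span_basis[OF Mmem Mmem Mmem Mind] span_triple by (auto intro: ideal3I)
  then have "ideal3 F G H \<subseteq> ?I" using FGH by (intro ideal3_minimal subspace_ideal3) auto
  \<comment> \<open>The \<open>M i\<close> span the forms of degree \<open>d\<close> through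
    \<open>Z\<close>, so their ideal contains \<open>F\<close>, \<open>G\<close> and
    \<open>H\<close>, which generate all forms through \<open>Z\<close> from degree
    \<open>2 * d - 2\<close> on.\<close>
  then have large: "forms_through n Z \<subseteq> ?I" if "2 * d - 2 \<le> n" for n
    using forms_through_eq_V[OF that] by (auto simp: V_def)
  have sub_van: "ideal.subspace (vanishing_ideal Z)" unfolding vanishing_ideal_def by (rule ideal.subspace_span)
  have I_sub: "?I \<subseteq> vanishing_ideal Z"
    using Mmem forms_through_subset_vanishing_ideal by (intro ideal3_minimal sub_van) blast+
  \<comment> \<open>Agreement in large degrees is enough for equality of schemes:
    \<open>var i ^ (2 * d)\<close> lifts every generator into that range, and
    \<open>dehomogenize i\<close> sends this factor to 1.\<close>
  have power: "\<exists>N. var i ^ N * f \<in> ?I" if "f \<in> vanishing_ideal Z" for i f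
    using that unfolding vanishing_ideal_def
  proof (induction rule: ideal.span_induct_alt)
    case base
    show ?case using ideal.subspace_0[OF subspace_ideal3] by simp
  next
    case (step e x y)
    then obtain n where x: "is_form n x" "vanishes_on x Z" by blast
    obtain N where N: "var i ^ N * y \<in> ?I" using step by blast
    have "is_form (2 * d + n) (var i ^ (2 * d) * x)"
      using is_form_mult[OF is_form_power[OF is_form_var, of "2 * d" i] x(1)] by simp
    then have "var i ^ (2 * d) * x \<in> forms_through (2 * d + n) Z"
      using x(2) by (simp add: forms_through_def vanishes_on_def)
    moreover have "2 * d - 2 \<le> 2 * d + n" by simp
    ultimately have X: "var i ^ (2 * d) * x \<in> ?I" using subsetD[OF large] by simp
    have "var i ^ (2 * d + N) * (e * x + y) = (var i ^ N * e) * (var i ^ (2 * d) * x) + var i ^ (2 * d) * (var i ^ N * y)"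
      by (simp add: power_add algebra_simps)
    also have "\<dots> \<in> ?I" by (intro ideal3_add ideal3_mult[OF X] ideal3_mult[OF N])
    finally show ?case by blast
  qed
  have "dehomogenize i ` ?I = dehomogenize i ` vanishing_ideal Z" for i
  proof
    show "dehomogenize i ` ?I \<subseteq> dehomogenize i ` vanishing_ideal Z" using I_sub by blast
    show "dehomogenize i ` vanishing_ideal Z \<subseteq> dehomogenize i ` ?I"
    proof
      fix x assume "x \<in> dehomogenize i ` vanishing_ideal Z"
      then obtain f where f: "f \<in> vanishing_ideal Z" "x = dehomogenize i f" by blast
      obtain N where N: "var i ^ N * f \<in> ?I" using power[OF f(1)] by blast
      have "dehomogenize i (var i ^ N * f) = x" unfolding f(2) by (simp add: dehomogenize_simps)
      then show "x \<in> dehomogenize i ` ?I" using N by blast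
    qed
  qed
  then have "proj_scheme ?I = proj_scheme (vanishing_ideal Z)" by (simp add: proj_scheme_def)
  then show ?thesis using g by metis
qed

section \<open>Tensors with prescribed forms\<close>

lemma prod_list_map_var: "prod_list (map var js) = Poly_Mapping.single (sum_list (map (\<lambda>j. Poly_Mapping.single j 1) js)) 1"
  by (induction js) (simp_all add: var_def mult_single)

lemma mdeg_sum_list: "mdeg (sum_list (map (\<lambda>j. Poly_Mapping.single j 1) js)) = length js"
  by (induction js) (simp_all add: mdeg_def lookup_add sum.distrib lookup_single when_def)

lemma is_form_tensor_form: "is_form (d - 1) (tensor_form d T i)"
  unfolding tensor_form_def
proof (rule is_form_sum)
  fix js :: "3 list" assume "js \<in> {js. length js = d - 1}"
  then show "is_form (d - 1) (smult_tpoly (T (i # js)) (prod_list (map var js)))"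
    by (intro smult_tpoly_form) (simp add: prod_list_map_var is_form_iff mdeg_sum_list del: One_nat_def)
qed

lemma ex_list_of_exponents:
  "mdeg m = n \<Longrightarrow> \<exists>js. length js = n \<and> sum_list (map (\<lambda>j. Poly_Mapping.single j 1) js) = m"
proof -
  assume m: "mdeg m = n"
  let ?js = "replicate (Poly_Mapping.lookup m 1) 1 @ replicate (Poly_Mapping.lookup m 2) 2 @ replicate (Poly_Mapping.lookup m 3) (3::3)"
  have rep: "sum_list (replicate k (Poly_Mapping.single j 1)) = Poly_Mapping.single j k" for k and j :: 3
    by (induction k) (simp_all flip: single_add)
  have "sum_list (map (\<lambda>j. Poly_Mapping.single j 1) ?js) = m"
    by (rule poly_mapping_3_eqI) (simp_all only: map_append map_replicate sum_list_append rep, simp_all add: lookup_add lookup_single)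
  moreover have "length ?js = n" using m by (simp add: mdeg_def sum_3)
  ultimately show ?thesis by blast
qed

text \<open>\<open>L\<close> selects one index list for each monomial, and the whole coefficient is
  placed there. The tensor is thus not symmetrized in its last indices, and no division by
  multinomial coefficients occurs.\<close>

lemma ex_tensor:
  assumes "d \<ge> 1" and g: "\<And>i. is_form (d - 1) (g i)"
  shows "\<exists>T\<in>tensors d. \<forall>i. tensor_form d T i = g i"
proof -
  let ?e = "\<lambda>js :: 3 list. sum_list (map (\<lambda>j. Poly_Mapping.single j 1) js) :: 3 \<Rightarrow>\<^sub>0 nat"
  let ?A = "{m. mdeg m = d - 1}"
  have "\<forall>m\<in>?A. \<exists>js. length js = d - 1 \<and> ?e js = m" using ex_list_of_exponents by blast
  then obtain L where L: "\<And>m. m \<in> ?A \<Longrightarrow> length (L m) = d - 1 \<and> ?e (L m) = m" by metis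
  define T where "T is = (if length is = d \<and> L (?e (tl is)) = tl is then Poly_Mapping.lookup (g (hd is)) (?e (tl is)) else 0)" for "is"
  have T: "T \<in> tensors d" by (simp add: tensors_def T_def)
  have "tensor_form d T i = g i" for i
  proof -
    have inj: "inj_on L ?A" by (rule inj_on_inverseI[where g = ?e]) (use L in simp)
    have "tensor_form d T i = (\<Sum>js\<in>L ` ?A. smult_tpoly (T (i # js)) (prod_list (map var js)))"
      unfolding tensor_form_def
    proof (rule sum.mono_neutral_right)
      have "{js :: 3 list. length js = d - 1} = {js. set js \<subseteq> UNIV \<and> length js = d - 1}" by simp
      then show "finite {js :: 3 list. length js = d - 1}" using finite_lists_length_eq[of "UNIV :: 3 set" "d - 1"] by simp
      show "L ` ?A \<subseteq> {js. length js = d - 1}" using L by auto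
      show "\<forall>js\<in>{js. length js = d - 1} - L ` ?A. smult_tpoly (T (i # js)) (prod_list (map var js)) = 0"
      proof
        fix js assume js: "js \<in> {js. length js = d - 1} - L ` ?A"
        then have "?e js \<in> ?A" by (simp add: mdeg_sum_list del: One_nat_def)
        then have "L (?e js) \<noteq> js" using js by (metis DiffD2 image_eqI)
        then show "smult_tpoly (T (i # js)) (prod_list (map var js)) = 0" by (simp add: T_def)
      qed
    qed
    also have "\<dots> = (\<Sum>m\<in>?A. smult_tpoly (T (i # L m)) (prod_list (map var (L m))))"
      unfolding sum.reindex[OF inj] comp_def ..
    also have "\<dots> = (\<Sum>m\<in>?A. Poly_Mapping.single m (Poly_Mapping.lookup (g i) m))"
    proof (rule sum.cong)
      fix m assume "m \<in> ?A"
      then have "length (L m) = d - 1" "?e (L m) = m" using L by auto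
      then show "smult_tpoly (T (i # L m)) (prod_list (map var (L m))) = Poly_Mapping.single m (Poly_Mapping.lookup (g i) m)"
        using assms(1) by (simp add: T_def prod_list_map_var smult_tpoly_def const_def mult_single)
    qed simp
    also have "\<dots> = (\<Sum>m\<in>Poly_Mapping.keys (g i). Poly_Mapping.single m (Poly_Mapping.lookup (g i) m))"
      by (rule sum.mono_neutral_right) (use card_exponents(1) g[of i] in \<open>auto simp: is_form_iff in_keys_iff\<close>)
    finally show ?thesis by (simp add: tpoly_sum_single)
  qed
  then show ?thesis using T by blast
qed

lemma eigenscheme_minors: "eigenscheme d T = proj_scheme
    (ideal3 (minor (tensor_form d T) 2 3) (minor (tensor_form d T) 3 1) (minor (tensor_form d T) 1 2))"
  by (simp add: eigenscheme_def eigen_ideal_def span_minors)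

theorem theorem3:
  fixes d :: nat and Z :: "(complex ^ 3) set set"
  assumes "d \<ge> 3" and "Z \<subseteq> proj_plane" and "finite Z" and "card Z = d^2 - d + 1"
  shows "(\<exists>T\<in>tensors d. eigenscheme d T = reduced_scheme Z) \<longleftrightarrow>
    tpoly.dim (graded_piece (vanishing_ideal Z) d) = 3 \<and>
    \<not> (\<exists>S\<subseteq>Z. card S = d + 1 \<and> collinear_points S) \<and>
    (\<forall>k\<in>{2..d - 1}. \<not> (\<exists>S\<subseteq>Z. card S = k * d \<and> on_curve_of_degree k S))"
proof
  assume "\<exists>T\<in>tensors d. eigenscheme d T = reduced_scheme Z"
  then obtain T where T: "eigenscheme d T = reduced_scheme Z" by blast
  interpret reduced_eigenscheme d "tensor_form d T" Z
    using T by unfold_locales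
      (simp_all add: assms is_form_tensor_form eigenscheme_minors reduced_scheme_def del: One_nat_def)
  show "tpoly.dim (graded_piece (vanishing_ideal Z) d) = 3 \<and>
    \<not> (\<exists>S\<subseteq>Z. card S = d + 1 \<and> collinear_points S) \<and>
    (\<forall>k\<in>{2..d - 1}. \<not> (\<exists>S\<subseteq>Z. card S = k * d \<and> on_curve_of_degree k S))"
    unfolding graded_piece_vanishing_ideal collinear_points_def on_curve_of_degree_def
  proof (intro conjI ballI notI)
    show "tpoly.dim (forms_through d Z) = 3" by (rule dim_forms_through_3)
  next
    assume "\<exists>S\<subseteq>Z. card S = d + 1 \<and> (\<exists>l. l \<noteq> 0 \<and> is_form 1 l \<and> vanishes_on l S)"
    then show False by (elim exE conjE) (rule no_collinear)
  next
    fix k assume k: "k \<in> {2..d - 1}" and "\<exists>S\<subseteq>Z. card S = k * d \<and> (\<exists>f. f \<noteq> 0 \<and> is_form k f \<and> vanishes_on f S)"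
    then show False by (elim exE conjE, intro no_curve[of k]) simp_all
  qed
next
  assume conditions: "tpoly.dim (graded_piece (vanishing_ideal Z) d) = 3 \<and>
    \<not> (\<exists>S\<subseteq>Z. card S = d + 1 \<and> collinear_points S) \<and>
    (\<forall>k\<in>{2..d - 1}. \<not> (\<exists>S\<subseteq>Z. card S = k * d \<and> on_curve_of_degree k S))"
  interpret eigen_configuration d Z
  proof unfold_locales
    show "tpoly.dim (forms_through d Z) = 3" using conditions by (simp add: graded_piece_vanishing_ideal)
    show False if "S \<subseteq> Z" "card S = d + 1" "l \<noteq> 0" "is_form 1 l" "vanishes_on l S" for S l
      using conditions that unfolding collinear_points_def by blast
    show False if "2 \<le> k" "k \<le> d - 1" "S \<subseteq> Z" "card S = k * d" "C \<noteq> 0" "is_form k C" "vanishes_on C S" for k S C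
    proof -
      have "k \<in> {2..d - 1}" using that(1,2) by simp
      then show False using conditions that(3-7) unfolding on_curve_of_degree_def by blast
    qed
  qed (fact assms)+
  obtain g where g: "\<And>i. is_form (d - 1) (g i)"
    "proj_scheme (ideal3 (minor g 2 3) (minor g 3 1) (minor g 1 2)) = proj_scheme (vanishing_ideal Z)"
    using ex_minors by blast
  obtain T where T: "T \<in> tensors d" "\<And>i. tensor_form d T i = g i"
    using ex_tensor[of d g] g(1) d by auto
  have "tensor_form d T = g" using T(2) by (rule ext)
  then have "eigenscheme d T = reduced_scheme Z"
    using g(2) by (simp add: eigenscheme_minors reduced_scheme_def)
  then show "\<exists>T\<in>tensors d. eigenscheme d T = reduced_scheme Z" using T(1) by blast
qed

end
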